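(* Every differentially large field $K$ (of characteristic $0$, in $m$ commuting derivations $\delta_1,\dots,\delta_m$) is PV-closed; that is, for every $n\ge1$ and all $A_1,\dots,A_m\in\mathrm{Mat}_n(K)$ satisfying the integrability condition $\delta_iA_j-\delta_jA_i=[A_i,A_j]$ for all $i,j$, there is $Z\in\mathrm{GL}_n(K)$ with $\delta_iZ=A_iZ$ for $i=1,\dots,m$.
   Context: Here $\delta_iA_j$ is obtained by applying $\delta_i$ entrywise and $[A_i,A_j]=A_iA_j-A_jA_i$. All fields have characteristic $0$; a differential field is a field with $m\geq 1$ commuting derivations. For a (differential) field extension $L/K$, $K$ is existentially closed (e.c.) in $L$ as a field (as a differential field) if every finite system of polynomial (differential polynomial) equations over $K$ with a solution in $L$ has a solution in $K$. A field $K$ is large if every irreducible affine algebraic variety over $K$ with a smooth $K$-point has a Zariski-dense set of $K$-points. A differential field $K$ is differentially large if it is large as a field and for every differential field extension $L/K$, if $K$ is e.c. in $L$ as a field then $K$ is e.c. in $L$ as a differential field. *)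

theory Defs
  imports "HOL-Algebra.Indexed_Polynomials" "HOL-Algebra.QuotRing"
    "HOL-Library.Extended_Nat" "HOL-Library.FuncSet"
begin

section \<open>Polynomials in several variables\<close>

definition mpoly_ring :: "('a, 'r) ring_scheme \<Rightarrow> 'c set \<Rightarrow> ('c multiset \<Rightarrow> 'a) ring" where
  "mpoly_ring R I =
    \<lparr>carrier = ring.indexed_pset R I (carrier R),
     monoid.mult = (\<lambda>P Q m. \<Oplus>\<^bsub>R\<^esub>a\<in>{a. a \<subseteq># m}. P a \<otimes>\<^bsub>R\<^esub> Q (m - a)),
     one = ring.indexed_const R \<one>\<^bsub>R\<^esub>,
     zero = ring.indexed_const R \<zero>\<^bsub>R\<^esub>,
     add = ring.indexed_padd R\<rparr>"

definition mpoly_eval ::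
  "('a, 'r) ring_scheme \<Rightarrow> ('b, 's) ring_scheme \<Rightarrow> ('a \<Rightarrow> 'b) \<Rightarrow> ('c \<Rightarrow> 'b) \<Rightarrow> ('c multiset \<Rightarrow> 'a) \<Rightarrow> 'b"
  where
  "mpoly_eval R S \<iota> x P =
    (\<Oplus>\<^bsub>S\<^esub>u\<in>{u. P u \<noteq> \<zero>\<^bsub>R\<^esub>}. \<iota> (P u) \<otimes>\<^bsub>S\<^esub> (\<Otimes>\<^bsub>S\<^esub>i\<in>set_mset u. x i [^]\<^bsub>S\<^esub> count u i))"

definition mpoly_pderiv ::
  "('a, 'r) ring_scheme \<Rightarrow> 'c \<Rightarrow> ('c multiset \<Rightarrow> 'a) \<Rightarrow> ('c multiset \<Rightarrow> 'a)" where
  "mpoly_pderiv R i P = (\<lambda>u. [Suc (count u i)] \<cdot>\<^bsub>R\<^esub> P (add_mset i u))"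

section \<open>Large fields\<close>

definition krull_dim :: "('a, 'r) ring_scheme \<Rightarrow> enat" where
  "krull_dim R =
    (SUP Ps \<in> {Ps. Ps \<noteq> [] \<and> (\<forall>P\<in>set Ps. primeideal P R) \<and> sorted_wrt (\<subset>) Ps}.
       enat (length Ps - 1))"

text \<open>An irreducible affine variety over \<open>K\<close> in affine \<open>k\<close>-space is given by a prime ideal
  of \<open>K[X\<^sub>0,\<dots>,X\<^sub>k\<^sub>-\<^sub>1]\<close>.\<close>

definition affine_variety :: "('a, 'r) ring_scheme \<Rightarrow> nat \<Rightarrow> (nat multiset \<Rightarrow> 'a) set \<Rightarrow> bool" where
  "affine_variety K k P \<longleftrightarrow> primeideal P (mpoly_ring K {..<k})"

definition variety_dim :: "('a, 'r) ring_scheme \<Rightarrow> nat \<Rightarrow> (nat multiset \<Rightarrow> 'a) set \<Rightarrow> enat" where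
  "variety_dim K k P = krull_dim (mpoly_ring K {..<k} Quot P)"

definition rational_points ::
  "('a, 'r) ring_scheme \<Rightarrow> nat \<Rightarrow> (nat multiset \<Rightarrow> 'a) set \<Rightarrow> (nat \<Rightarrow> 'a) set" where
  "rational_points K k P =
    {x \<in> {..<k} \<rightarrow>\<^sub>E carrier K. \<forall>f\<in>P. mpoly_eval K K id x f = \<zero>\<^bsub>K\<^esub>}"

definition lin_indep_rows ::
  "('a, 'r) ring_scheme \<Rightarrow> nat \<Rightarrow> nat \<Rightarrow> (nat \<Rightarrow> nat \<Rightarrow> 'a) \<Rightarrow> bool" where
  "lin_indep_rows K r k v \<longleftrightarrow>
    (\<forall>c\<in>{..<r} \<rightarrow> carrier K.
       (\<forall>j<k. (\<Oplus>\<^bsub>K\<^esub>i\<in>{..<r}. c i \<otimes>\<^bsub>K\<^esub> v i j) = \<zero>\<^bsub>K\<^esub>) \<longrightarrow> (\<forall>i<r. c i = \<zero>\<^bsub>K\<^esub>))"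

text \<open>The rows of the Jacobian matrix range over the gradients of all elements of the ideal
  rather than over those of a chosen generating set; at a point of the variety both families
  span the same space, so the rank is the same.\<close>

definition jacobian_rank ::
  "('a, 'r) ring_scheme \<Rightarrow> nat \<Rightarrow> (nat multiset \<Rightarrow> 'a) set \<Rightarrow> (nat \<Rightarrow> 'a) \<Rightarrow> enat" where
  "jacobian_rank K k P x =
    (SUP r \<in> {r. \<exists>f\<in>{..<r} \<rightarrow> P.
        lin_indep_rows K r k (\<lambda>i j. mpoly_eval K K id x (mpoly_pderiv K j (f i)))}. enat r)"

definition smooth_point ::
  "('a, 'r) ring_scheme \<Rightarrow> nat \<Rightarrow> (nat multiset \<Rightarrow> 'a) set \<Rightarrow> (nat \<Rightarrow> 'a) \<Rightarrow> bool" where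
  "smooth_point K k P x \<longleftrightarrow> jacobian_rank K k P x + variety_dim K k P = enat k"

text \<open>Density is tested on the nonempty basic open subsets \<open>f \<noteq> 0\<close>, i.e. those with \<open>f \<notin> P\<close>.\<close>

definition zariski_dense_points ::
  "('a, 'r) ring_scheme \<Rightarrow> nat \<Rightarrow> (nat multiset \<Rightarrow> 'a) set \<Rightarrow> bool" where
  "zariski_dense_points K k P \<longleftrightarrow>
    (\<forall>f\<in>carrier (mpoly_ring K {..<k}) - P.
       \<exists>x\<in>rational_points K k P. mpoly_eval K K id x f \<noteq> \<zero>\<^bsub>K\<^esub>)"

definition large_field :: "('a, 'r) ring_scheme \<Rightarrow> bool" where
  "large_field K \<longleftrightarrow> field K \<and>
    (\<forall>k P. affine_variety K k P \<and> (\<exists>x\<in>rational_points K k P. smooth_point K k P x) \<longrightarrow>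
       zariski_dense_points K k P)"

section \<open>Differential fields\<close>

text \<open>The \<open>m\<close> derivations \<open>\<delta>\<^sub>1,\<dots>,\<delta>\<^sub>m\<close> are indexed by \<open>0,\<dots>,m-1\<close>; the values of \<open>der\<close> at other
  indices and outside the carrier are irrelevant.\<close>

record 'a diff_ring = "'a ring" +
  der :: "nat \<Rightarrow> 'a \<Rightarrow> 'a"

locale diff_field = field K for K :: "('a, 'r) diff_ring_scheme" (structure) +
  fixes m :: nat
  assumes m_pos: "1 \<le> m"
    and char_zero: "\<And>n::nat. 0 < n \<Longrightarrow> [n] \<cdot> \<one> \<noteq> \<zero>"
    and der_closed: "\<lbrakk>i < m; x \<in> carrier K\<rbrakk> \<Longrightarrow> der K i x \<in> carrier K"
    and der_add: "\<lbrakk>i < m; x \<in> carrier K; y \<in> carrier K\<rbrakk> \<Longrightarrow>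
      der K i (x \<oplus> y) = der K i x \<oplus> der K i y"
    and der_mult: "\<lbrakk>i < m; x \<in> carrier K; y \<in> carrier K\<rbrakk> \<Longrightarrow>
      der K i (x \<otimes> y) = der K i x \<otimes> y \<oplus> x \<otimes> der K i y"
    and der_commute: "\<lbrakk>i < m; j < m; x \<in> carrier K\<rbrakk> \<Longrightarrow>
      der K i (der K j x) = der K j (der K i x)"

definition diff_field_ext ::
  "nat \<Rightarrow> ('a, 'r) diff_ring_scheme \<Rightarrow> ('b, 's) diff_ring_scheme \<Rightarrow> ('a \<Rightarrow> 'b) \<Rightarrow> bool" where
  "diff_field_ext m K L \<iota> \<longleftrightarrow> diff_field K m \<and> diff_field L m \<and> \<iota> \<in> ring_hom K L \<and>
    (\<forall>i<m. \<forall>x\<in>carrier K. \<iota> (der K i x) = der L i (\<iota> x))"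

section \<open>Existential closedness\<close>

definition ec_as_field ::
  "('a, 'r) ring_scheme \<Rightarrow> ('b, 's) ring_scheme \<Rightarrow> ('a \<Rightarrow> 'b) \<Rightarrow> bool" where
  "ec_as_field K L \<iota> \<longleftrightarrow>
    (\<forall>(k::nat) S. finite S \<and> S \<subseteq> carrier (mpoly_ring K {..<k}) \<and>
       (\<exists>x\<in>{..<k} \<rightarrow> carrier L. \<forall>f\<in>S. mpoly_eval K L \<iota> x f = \<zero>\<^bsub>L\<^esub>) \<longrightarrow>
       (\<exists>x\<in>{..<k} \<rightarrow> carrier K. \<forall>f\<in>S. mpoly_eval K K id x f = \<zero>\<^bsub>K\<^esub>))"

text \<open>A multiset \<open>\<alpha>\<close> over \<open>{..<m}\<close> stands for the operator
  \<open>\<delta>\<^sub>0\<^bsup>\<alpha>(0)\<^esup> \<circ> \<dots> \<circ> \<delta>\<^sub>m\<^sub>-\<^sub>1\<^bsup>\<alpha>(m-1)\<^esup>\<close>; the differential polynomials in \<open>k\<close> unknowns are the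
  polynomials in the variables \<open>(j, \<alpha>)\<close>, with \<open>(j, \<alpha>)\<close> representing \<open>\<delta>\<^bsup>\<alpha>\<^esup> X\<^sub>j\<close>.\<close>

definition der_power :: "nat \<Rightarrow> ('a, 'r) diff_ring_scheme \<Rightarrow> nat multiset \<Rightarrow> 'a \<Rightarrow> 'a" where
  "der_power m K \<alpha> = foldr (\<lambda>i g. (der K i ^^ count \<alpha> i) \<circ> g) [0..<m] id"

definition diff_vars :: "nat \<Rightarrow> nat \<Rightarrow> (nat \<times> nat multiset) set" where
  "diff_vars m k = {..<k} \<times> {\<alpha>. set_mset \<alpha> \<subseteq> {..<m}}"

definition diff_poly_eval ::
  "nat \<Rightarrow> ('a, 'r) diff_ring_scheme \<Rightarrow> ('b, 's) diff_ring_scheme \<Rightarrow> ('a \<Rightarrow> 'b) \<Rightarrow> (nat \<Rightarrow> 'b) \<Rightarrow>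
    ((nat \<times> nat multiset) multiset \<Rightarrow> 'a) \<Rightarrow> 'b" where
  "diff_poly_eval m K L \<iota> x f = mpoly_eval K L \<iota> (\<lambda>(j, \<alpha>). der_power m L \<alpha> (x j)) f"

definition ec_as_diff_field ::
  "nat \<Rightarrow> ('a, 'r) diff_ring_scheme \<Rightarrow> ('b, 's) diff_ring_scheme \<Rightarrow> ('a \<Rightarrow> 'b) \<Rightarrow> bool" where
  "ec_as_diff_field m K L \<iota> \<longleftrightarrow>
    (\<forall>k S. finite S \<and> S \<subseteq> carrier (mpoly_ring K (diff_vars m k)) \<and>
       (\<exists>x\<in>{..<k} \<rightarrow> carrier L. \<forall>f\<in>S. diff_poly_eval m K L \<iota> x f = \<zero>\<^bsub>L\<^esub>) \<longrightarrow>
       (\<exists>x\<in>{..<k} \<rightarrow> carrier K. \<forall>f\<in>S. diff_poly_eval m K K id x f = \<zero>\<^bsub>K\<^esub>))"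

section \<open>Differentially large fields\<close>

text \<open>HOL has no quantification over types inside a formula, so the extensions \<open>L\<close> live on
  subsets of the type of \<open>K\<close>, related to \<open>K\<close> by an arbitrary embedding (not necessarily an
  inclusion). This is no restriction: see \<open>differentially_large_extension\<close> below.\<close>

definition differentially_large :: "nat \<Rightarrow> 'a diff_ring \<Rightarrow> bool" where
  "differentially_large m K \<longleftrightarrow> diff_field K m \<and> large_field K \<and>
    (\<forall>(L :: 'a diff_ring) \<iota>. diff_field_ext m K L \<iota> \<and> ec_as_field K L \<iota> \<longrightarrow>
       ec_as_diff_field m K L \<iota>)"

lemma hom_mpoly_eval:
  fixes L :: "('a, 'r) ring_scheme" and M :: "('b, 's) ring_scheme"
  assumes "ring_hom_cring L M g"
    and "\<And>u. f u \<noteq> \<zero>\<^bsub>K\<^esub> \<Longrightarrow> \<iota> (f u) \<in> carrier L"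
    and "\<And>u i. f u \<noteq> \<zero>\<^bsub>K\<^esub> \<Longrightarrow> i \<in># u \<Longrightarrow> x i \<in> carrier L"
  shows "g (mpoly_eval K L \<iota> x f) = mpoly_eval K M (g \<circ> \<iota>) (g \<circ> x) f"
proof -
  interpret g: ring_hom_cring L M g by fact
  have pc: "(\<Otimes>\<^bsub>L\<^esub>i\<in>set_mset u. x i [^]\<^bsub>L\<^esub> count u i) \<in> carrier L" if "f u \<noteq> \<zero>\<^bsub>K\<^esub>" for u
    using assms(3)[OF that] by (intro g.R.finprod_closed) auto
  have hp: "g (y [^]\<^bsub>L\<^esub> n) = g y [^]\<^bsub>M\<^esub> n" if "y \<in> carrier L" for y and n :: nat
    using that by (induction n) auto
  have pe: "g (\<Otimes>\<^bsub>L\<^esub>i\<in>set_mset u. x i [^]\<^bsub>L\<^esub> count u i)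
      = (\<Otimes>\<^bsub>M\<^esub>i\<in>set_mset u. g (x i) [^]\<^bsub>M\<^esub> count u i)" if "f u \<noteq> \<zero>\<^bsub>K\<^esub>" for u
    using assms(3)[OF that]
    by (subst g.hom_finprod) (auto intro!: g.S.finprod_cong' simp: hp)
  show ?thesis
    unfolding mpoly_eval_def
  proof (subst g.hom_finsum)
    show "(\<lambda>u. \<iota> (f u) \<otimes>\<^bsub>L\<^esub> (\<Otimes>\<^bsub>L\<^esub>i\<in>set_mset u. x i [^]\<^bsub>L\<^esub> count u i)) \<in> {u. f u \<noteq> \<zero>\<^bsub>K\<^esub>} \<rightarrow> carrier L"
      using assms(2) pc by auto
    show "(\<Oplus>\<^bsub>M\<^esub>u\<in>{u. f u \<noteq> \<zero>\<^bsub>K\<^esub>}. (g \<circ> (\<lambda>u. \<iota> (f u) \<otimes>\<^bsub>L\<^esub> (\<Otimes>\<^bsub>L\<^esub>i\<in>set_mset u. x i [^]\<^bsub>L\<^esub> count u i))) u)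
      = (\<Oplus>\<^bsub>M\<^esub>u\<in>{u. f u \<noteq> \<zero>\<^bsub>K\<^esub>}. (g \<circ> \<iota>) (f u) \<otimes>\<^bsub>M\<^esub> (\<Otimes>\<^bsub>M\<^esub>i\<in>set_mset u. (g \<circ> x) i [^]\<^bsub>M\<^esub> count u i))"
      using assms(2) pc pe pe[symmetric] by (intro g.S.finsum_cong') (auto simp del: g.hom_finprod)
  qed
qed

lemma mpoly_carrier_coeff:
  assumes "ring K" "f \<in> carrier (mpoly_ring K I)"
  shows "f u \<in> carrier K" "\<lbrakk>f u \<noteq> \<zero>\<^bsub>K\<^esub>; i \<in># u\<rbrakk> \<Longrightarrow> i \<in> I"
proof -
  interpret ring K by fact
  have f: "f \<in> indexed_pset I (carrier K)" using assms(2) by (simp add: mpoly_ring_def)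
  from indexed_pset_in_carrier[OF subset_refl f] show "f u \<in> carrier K"
    by (simp add: carrier_coeff_def)
  have "f u \<noteq> \<zero>\<^bsub>K\<^esub> \<longrightarrow> set_mset u \<subseteq> I" using f
  proof (induction arbitrary: u)
    case (indexed_padd P Q)
    then show ?case unfolding indexed_padd_def by (metis r_zero zero_closed)
  next
    case (indexed_pmult P i)
    have "set_mset u \<subseteq> insert i (set_mset (u - {#i#}))"
      using insert_DiffM[of i u]
      by (metis diff_single_trivial insert_subset set_mset_add_mset_insert subset_insertI subset_refl)
    then show ?case
      using indexed_pmult.IH[of "u - {#i#}"] indexed_pmult.hyps unfolding indexed_pmult_def by auto
  qed (auto simp: indexed_const_def)
  then show "\<lbrakk>f u \<noteq> \<zero>\<^bsub>K\<^esub>; i \<in># u\<rbrakk> \<Longrightarrow> i \<in> I" by blast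
qed

lemma mpoly_eval_cong:
  assumes "ring K" "cring L" "f \<in> carrier (mpoly_ring K I)"
    and "\<And>a. a \<in> carrier K \<Longrightarrow> \<iota> a \<in> carrier L"
    and "\<And>i. i \<in> I \<Longrightarrow> y i = z i" "\<And>i. i \<in> I \<Longrightarrow> y i \<in> carrier L"
  shows "mpoly_eval K L \<iota> y f = mpoly_eval K L \<iota> z f"
proof -
  interpret cring L by fact
  note fc = mpoly_carrier_coeff[OF assms(1,3)]
  have z: "z i \<in> carrier L" if "i \<in> I" for i using assms(5,6) that by metis
  have "(\<Otimes>\<^bsub>L\<^esub>i\<in>set_mset u. y i [^]\<^bsub>L\<^esub> count u i) = (\<Otimes>\<^bsub>L\<^esub>i\<in>set_mset u. z i [^]\<^bsub>L\<^esub> count u i)"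
    if "f u \<noteq> \<zero>\<^bsub>K\<^esub>" for u
    using fc(2)[OF that] assms(5) z by (intro finprod_cong') auto
  then show ?thesis
    unfolding mpoly_eval_def using fc assms(4) z
    by (intro finsum_cong') (auto intro!: m_closed finprod_closed)
qed

lemma (in diff_field) der_power_closed:
  assumes "x \<in> carrier K" shows "der_power m K \<alpha> x \<in> carrier K"
proof -
  have it: "(der K i ^^ c) y \<in> carrier K" if "i < m" "y \<in> carrier K" for i c y
    using that by (induction c) (auto simp: der_closed)
  have "foldr (\<lambda>i g. (der K i ^^ count \<alpha> i) \<circ> g) is id x \<in> carrier K" if "set is \<subseteq> {..<m}" for "is"
    using that assms it by (induction "is") auto
  from this[of "[0..<m]"] show ?thesis unfolding der_power_def by (simp add: atLeast_upt)
qed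

lemma (in diff_field) hom_der_power:
  assumes "\<And>i y. i < m \<Longrightarrow> y \<in> carrier K \<Longrightarrow> g (der K i y) = der M i (g y)"
    and "x \<in> carrier K"
  shows "g (der_power m K \<alpha> x) = der_power m M \<alpha> (g x)"
proof -
  have it: "(der K i ^^ c) y \<in> carrier K \<and> g ((der K i ^^ c) y) = (der M i ^^ c) (g y)"
    if "i < m" "y \<in> carrier K" for i c y
    using that by (induction c) (auto simp: der_closed assms(1))
  have "foldr (\<lambda>i g. (der K i ^^ count \<alpha> i) \<circ> g) is id x \<in> carrier K \<and>
     g (foldr (\<lambda>i g. (der K i ^^ count \<alpha> i) \<circ> g) is id x) =
     foldr (\<lambda>i g. (der M i ^^ count \<alpha> i) \<circ> g) is id (g x)" if "set is \<subseteq> {..<m}" for "is"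
    using that assms(2) it by (induction "is") auto
  from this[of "[0..<m]"] show ?thesis unfolding der_power_def by (simp add: atLeast_upt)
qed

lemma (in diff_field) infinite_carrier: "infinite (carrier K)"
proof -
  have "inj (\<lambda>n::nat. [n] \<cdot> \<one>)"
  proof (rule linorder_injI)
    fix a b :: nat assume "a < b"
    show "[a] \<cdot> \<one> \<noteq> [b] \<cdot> \<one>"
    proof
      assume e: "[a] \<cdot> \<one> = [b] \<cdot> \<one>"
      have "[b] \<cdot> \<one> = [a] \<cdot> \<one> \<oplus> [(b - a)] \<cdot> \<one>"
        using add.nat_pow_mult[of \<one> a "b - a"] \<open>a < b\<close> by simp
      then have "[(b - a)] \<cdot> \<one> = \<zero>"
        using e add.l_cancel_one'[of "[a] \<cdot> \<one>" "[(b - a)] \<cdot> \<one>"] by simp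
      then show False using char_zero[of "b - a"] \<open>a < b\<close> by simp
    qed
  qed
  then have "infinite (range (\<lambda>n::nat. [n] \<cdot> \<one>))" by (simp add: finite_image_iff)
  moreover have "range (\<lambda>n::nat. [n] \<cdot> \<one>) \<subseteq> carrier K" by auto
  ultimately show ?thesis using infinite_super by blast
qed

lemma finite_card_of_le:
  includes cardinal_syntax
  assumes "finite Y" "infinite B" shows "|Y| \<le>o |B|"
  using ordLeq_total[of "|Y|" "|B|"] card_of_ordLeq_finite[of B Y] assms
  by (auto simp: card_of_Well_order)

text \<open>A subset \<open>S\<close> of cardinality at most that of an infinite \<open>B\<close> is contained in a differential
  subfield with the same bound.\<close>

lemma (in diff_field) small_diff_subfield:
  includes cardinal_syntax
  assumes "infinite B" "|S| \<le>o |B|" "S \<subseteq> carrier K"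
  shows "\<exists>G. S \<subseteq> G \<and> |G| \<le>o |B| \<and> subfield G K \<and> (\<forall>i<m. \<forall>x\<in>G. der K i x \<in> G)"
proof -
  define st where "st Y = Y \<union> {\<one>} \<union> (\<lambda>(a, b). a \<oplus> b) ` (Y \<times> Y) \<union> (\<lambda>(a, b). a \<otimes> b) ` (Y \<times> Y)
     \<union> a_inv K ` Y \<union> m_inv K ` (Y - {\<zero>}) \<union> (\<Union>i\<in>{..<m}. der K i ` Y)" for Y
  define F where "F n = (st ^^ n) S" for n :: nat
  define G where "G = (\<Union>n. F n)"
  have cB: "Cinfinite |B|" using assms(1) by (simp add: cinfinite_def Field_card_of card_of_card_order_on)
  have un: "|P \<union> Q| \<le>o |B|" if "|P| \<le>o |B|" "|Q| \<le>o |B|" for P Q :: "'a set"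
    using Un_Cinfinite_bound[OF that cB] .
  have im: "|h ` Y| \<le>o |B|" if "|Y| \<le>o |B|" for h :: "'x \<Rightarrow> 'a" and Y
    by (rule ordLeq_transitive[OF card_of_image that])
  have tm: "|Y \<times> Y| \<le>o |B|" if "|Y| \<le>o |B|" for Y :: "'a set"
    using card_of_Times_ordLeq_infinite_Field[of "|B|" Y Y] that assms(1)
    by (simp add: Field_card_of card_of_card_order_on)
  have df: "|Y - Z| \<le>o |B|" if "|Y| \<le>o |B|" for Y Z :: "'a set"
    by (rule ordLeq_transitive[OF card_of_mono1 that]) simp
  have fin: "|Y| \<le>o |B|" if "finite Y" for Y :: "'x set"
    by (rule finite_card_of_le[OF that assms(1)])
  have stB: "|st Y| \<le>o |B|" if "|Y| \<le>o |B|" for Y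
  proof -
    have "|{\<one>}| \<le>o |B|" "|{..<m}| \<le>o |B|" by (intro fin; simp)+
    then show ?thesis unfolding st_def using that assms(1)
      by (intro un im tm df card_of_UNION_ordLeq_infinite ballI)
  qed
  have FB: "|F n| \<le>o |B|" for n
    unfolding F_def by (induction n) (auto simp: assms(2) stB)
  have "|UNIV :: nat set| \<le>o |B|"
    using assms(1) infinite_iff_card_of_nat[of B] by simp
  then have GB: "|G| \<le>o |B|"
    unfolding G_def using FB assms(1) by (intro card_of_UNION_ordLeq_infinite) auto
  have stc: "st Y \<subseteq> carrier K" if "Y \<subseteq> carrier K" for Y
    using that unfolding st_def by (auto simp: der_closed field_Units subset_iff)
  have Fc: "F n \<subseteq> carrier K" for n
    unfolding F_def by (induction n) (simp_all add: assms(3) stc)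
  have Fs: "F (Suc n) = st (F n)" for n by (simp add: F_def)
  have Fmono: "F n \<subseteq> F k" if "n \<le> k" for n k
    using that by (rule lift_Suc_mono_le[rotated]) (auto simp: Fs st_def)
  have G1: "\<exists>n. x \<in> F n" if "x \<in> G" for x using that by (auto simp: G_def)
  have G2: "\<exists>n. x \<in> F n \<and> y \<in> F n" if "x \<in> G" "y \<in> G" for x y
    using G1[OF that(1)] G1[OF that(2)] Fmono
    by (metis nat_le_linear subsetD)
  have GI: "x \<in> G" if "x \<in> st (F n)" for x n using that Fs[of n] unfolding G_def by blast
  have "subring G K"
  proof (rule subringI)
    show "G \<subseteq> carrier K" using Fc by (auto simp: G_def)
    show "\<one> \<in> G" by (rule GI[of _ 0]) (simp add: st_def)
    show "\<ominus> h \<in> G" if "h \<in> G" for h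
    proof -
      from G1[OF that] obtain n where "h \<in> F n" by blast
      then show ?thesis by (intro GI[of _ n]) (simp add: st_def)
    qed
    fix a b assume "a \<in> G" "b \<in> G"
    then obtain n where "a \<in> F n" "b \<in> F n" using G2 by blast
    then show "a \<otimes> b \<in> G" "a \<oplus> b \<in> G" by (intro GI[of _ n]; force simp: st_def)+
  qed
  then have "subfield G K"
  proof (rule subfieldI')
    fix k assume "k \<in> G - {\<zero>}"
    then obtain n where "k \<in> F n - {\<zero>}" using G1 by blast
    then show "inv k \<in> G" by (intro GI[of _ n]) (simp add: st_def)
  qed
  moreover have "der K i x \<in> G" if "i < m" "x \<in> G" for i x
  proof -
    from G1[OF that(2)] obtain n where "x \<in> F n" by blast
    then show ?thesis using that(1) by (intro GI[of _ n]) (auto simp: st_def)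
  qed
  moreover have "S \<subseteq> G" unfolding G_def using F_def[of 0] by auto
  ultimately show ?thesis using GB by blast
qed


text \<open>The defining property of a differentially large field extends from extensions on the type
  of \<open>K\<close> to extensions on any type: a solution in \<open>L\<close> already lies in a differential subfield
  over \<open>K\<close> of the same cardinality as \<open>K\<close>, which can be transported to a subset of \<open>'a\<close>.\<close>

lemma differentially_large_extension:
  fixes K :: "'a diff_ring" and L :: "'b diff_ring"
  assumes "differentially_large m K" "diff_field_ext m K L \<iota>" "ec_as_field K L \<iota>"
  shows "ec_as_diff_field m K L \<iota>"
  unfolding ec_as_diff_field_def
proof (intro allI impI, elim conjE bexE)
  include cardinal_syntax
  fix k :: nat and S x
  assume fin: "finite S" and S: "S \<subseteq> carrier (mpoly_ring K (diff_vars m k))"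
    and x: "x \<in> {..<k} \<rightarrow> carrier L" and sol: "\<forall>f\<in>S. diff_poly_eval m K L \<iota> x f = \<zero>\<^bsub>L\<^esub>"
  interpret K: diff_field K m using assms(2) by (simp add: diff_field_ext_def)
  interpret L: diff_field L m using assms(2) by (simp add: diff_field_ext_def)
  have \<iota>d: "\<iota> (der K i y) = der L i (\<iota> y)" if "i < m" "y \<in> carrier K" for i y
    using assms(2) that by (auto simp: diff_field_ext_def)
  have \<iota>: "\<iota> \<in> ring_hom K L" using assms(2) by (simp add: diff_field_ext_def)
  define B where "B = (UNIV :: 'a set)"
  have infB: "infinite B" unfolding B_def by (rule infinite_super[OF subset_UNIV K.infinite_carrier])
  then have cB: "Cinfinite |B|" by (simp add: cinfinite_def Field_card_of card_of_card_order_on)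
  have "|\<iota> ` carrier K| \<le>o |B|"
    by (rule ordLeq_transitive[OF card_of_image card_of_mono1]) (simp add: B_def)
  moreover have "|x ` {..<k}| \<le>o |B|"
    by (rule finite_card_of_le[OF _ infB]) simp
  ultimately have X1: "|\<iota> ` carrier K \<union> x ` {..<k}| \<le>o |B|" using Un_Cinfinite_bound[OF _ _ cB] by simp
  have X2: "\<iota> ` carrier K \<union> x ` {..<k} \<subseteq> carrier L"
    using \<iota> x by (auto simp: ring_hom_def)
  obtain G where G: "\<iota> ` carrier K \<union> x ` {..<k} \<subseteq> G" "|G| \<le>o |B|" "subfield G L"
    and Gd: "\<And>i y. i < m \<Longrightarrow> y \<in> G \<Longrightarrow> der L i y \<in> G"
    using L.small_diff_subfield[OF infB X1 X2] by metis
  have Gc: "G \<subseteq> carrier L" using subfieldE(3)[OF G(3)] .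
  obtain h :: "'b \<Rightarrow> 'a" where h: "inj_on h G"
    using G(2) card_of_ordLeq[of G B] by blast
  define g where "g = inv_into G h"
  have gh: "g (h y) = y" if "y \<in> G" for y using that h by (simp add: g_def)
  define G' where "G' = L\<lparr>carrier := G\<rparr>"
  interpret G': field G' unfolding G'_def using L.subfield_iff(2)[OF G(3)] .
  define M :: "'a diff_ring" where
    "M = \<lparr>carrier = h ` G, monoid.mult = (\<lambda>a b. h (g a \<otimes>\<^bsub>L\<^esub> g b)), one = h \<one>\<^bsub>L\<^esub>,
          zero = h \<zero>\<^bsub>L\<^esub>, add = (\<lambda>a b. h (g a \<oplus>\<^bsub>L\<^esub> g b)), der = (\<lambda>i a. h (der L i (g a)))\<rparr>"
  have "h \<in> ring_iso G' M"
    using h by (auto simp: ring_iso_def ring_hom_def M_def G'_def gh bij_betw_def)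
  from G'.ring_iso_imp_img_field[OF this] have "field M" by (simp add: M_def G'_def)
  then interpret M: field M .
  have Gcl: "\<one>\<^bsub>L\<^esub> \<in> G" "\<zero>\<^bsub>L\<^esub> \<in> G" "\<And>a b. a \<in> G \<Longrightarrow> b \<in> G \<Longrightarrow> a \<otimes>\<^bsub>L\<^esub> b \<in> G"
    "\<And>a b. a \<in> G \<Longrightarrow> b \<in> G \<Longrightarrow> a \<oplus>\<^bsub>L\<^esub> b \<in> G"
    using G'.one_closed G'.zero_closed G'.m_closed G'.a_closed by (auto simp: G'_def)
  have ghom: "g \<in> ring_hom M L"
    using Gc Gcl by (auto simp: ring_hom_def M_def gh)
  interpret g: ring_hom_cring M L g by unfold_locales (rule ghom)
  have gd: "g (der M i y) = der L i (g y)" if "i < m" "y \<in> carrier M" for i y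
    using that Gd by (auto simp: M_def gh)
  have ginj: "y = z" if "y \<in> carrier M" "z \<in> carrier M" "g y = g z" for y z
    using that by (auto simp: M_def gh)
  have Md: "der M i y \<in> carrier M" if "i < m" "y \<in> carrier M" for i y
    using that Gd by (auto simp: M_def gh)
  have gpow: "g ([n] \<cdot>\<^bsub>M\<^esub> \<one>\<^bsub>M\<^esub>) = [n] \<cdot>\<^bsub>L\<^esub> \<one>\<^bsub>L\<^esub>" for n :: nat
    by (induction n) auto
  have Mdf: "diff_field M m"
  proof
    show "1 \<le> m" by (rule K.m_pos)
    show "[n] \<cdot>\<^bsub>M\<^esub> \<one>\<^bsub>M\<^esub> \<noteq> \<zero>\<^bsub>M\<^esub>" if "0 < n" for n :: nat
      using gpow[of n] L.char_zero[OF that] g.hom_zero by metis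
    fix i y z assume i: "i < m" and y: "y \<in> carrier M" and z: "z \<in> carrier M"
    show "der M i (y \<oplus>\<^bsub>M\<^esub> z) = der M i y \<oplus>\<^bsub>M\<^esub> der M i z"
      using i y z by (intro ginj) (auto simp: Md gd L.der_add)
    show "der M i (y \<otimes>\<^bsub>M\<^esub> z) = der M i y \<otimes>\<^bsub>M\<^esub> z \<oplus>\<^bsub>M\<^esub> y \<otimes>\<^bsub>M\<^esub> der M i z"
      using i y z by (intro ginj) (auto simp: Md gd L.der_mult)
  next
    fix i j y assume "i < m" "j < m" "y \<in> carrier M"
    then show "der M i (der M j y) = der M j (der M i y)"
      by (intro ginj) (auto simp: Md gd L.der_commute)
  qed (rule Md)
  define \<kappa> where "\<kappa> = h \<circ> \<iota>"
  have \<kappa>G: "\<iota> y \<in> G" if "y \<in> carrier K" for y using G(1) that by auto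
  have g\<kappa>: "g (\<kappa> y) = \<iota> y" if "y \<in> carrier K" for y using \<kappa>G[OF that] by (simp add: \<kappa>_def gh)
  have \<kappa>c: "\<kappa> y \<in> carrier M" if "y \<in> carrier K" for y
    using \<kappa>G[OF that] by (simp add: \<kappa>_def M_def)
  have \<kappa>ext: "diff_field_ext m K M \<kappa>"
    unfolding diff_field_ext_def
  proof (intro conjI allI impI ballI)
    show "\<kappa> \<in> ring_hom K M"
      using ring_hom_mult[OF \<iota>] ring_hom_add[OF \<iota>] ring_hom_one[OF \<iota>]
      by (intro ring_hom_memI ginj) (auto simp: \<kappa>c g\<kappa>)
    show "\<kappa> (der K i y) = der M i (\<kappa> y)" if "i < m" "y \<in> carrier K" for i y
      using that by (intro ginj) (auto simp: \<kappa>c g\<kappa> gd \<iota>d Md K.der_closed)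
  qed (rule K.diff_field_axioms Mdf)+
  have evM: "g (mpoly_eval K M \<kappa> z f) = mpoly_eval K L \<iota> (g \<circ> z) f"
    if f: "f \<in> carrier (mpoly_ring K I)" and z: "\<And>i. i \<in> I \<Longrightarrow> z i \<in> carrier M"
    for f and z :: "'i \<Rightarrow> 'a" and I
  proof -
    note fc = mpoly_carrier_coeff[OF K.ring_axioms f]
    have "g (mpoly_eval K M \<kappa> z f) = mpoly_eval K L (g \<circ> \<kappa>) (g \<circ> z) f"
      using fc z by (intro hom_mpoly_eval[OF g.ring_hom_cring_axioms]) (auto simp: \<kappa>c)
    also have "\<dots> = mpoly_eval K L \<iota> (g \<circ> z) f"
      unfolding mpoly_eval_def using fc(1) by (simp add: g\<kappa>)
    finally show ?thesis .
  qed
  have evc: "mpoly_eval K M \<kappa> z f \<in> carrier M"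
    if f: "f \<in> carrier (mpoly_ring K I)" and z: "\<And>i. i \<in> I \<Longrightarrow> z i \<in> carrier M"
    for f and z :: "'i \<Rightarrow> 'a" and I
  proof -
    note fc = mpoly_carrier_coeff[OF K.ring_axioms f]
    show ?thesis unfolding mpoly_eval_def using fc z
      by (intro M.finsum_closed Pi_I M.m_closed M.finprod_closed M.nat_pow_closed) (auto simp: \<kappa>c)
  qed
  have "ec_as_field K M \<kappa>"
    unfolding ec_as_field_def
  proof (intro allI impI, elim conjE bexE)
    fix k :: nat and S z
    assume S: "finite S" "S \<subseteq> carrier (mpoly_ring K {..<k})" and z: "z \<in> {..<k} \<rightarrow> carrier M"
      and sol: "\<forall>f\<in>S. mpoly_eval K M \<kappa> z f = \<zero>\<^bsub>M\<^esub>"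
    have "mpoly_eval K L \<iota> (g \<circ> z) f = \<zero>\<^bsub>L\<^esub>" if "f \<in> S" for f
      using evM[of f "{..<k}" z] sol z S(2) that by (auto simp: Pi_iff)
    moreover have "g \<circ> z \<in> {..<k} \<rightarrow> carrier L" using z g.hom_closed by (auto simp: Pi_iff)
    ultimately show "\<exists>z\<in>{..<k} \<rightarrow> carrier K. \<forall>f\<in>S. mpoly_eval K K id z f = \<zero>\<^bsub>K\<^esub>"
      using assms(3)[unfolded ec_as_field_def, rule_format, of S k] S by blast
  qed
  with assms(1) \<kappa>ext have ecM: "ec_as_diff_field m K M \<kappa>" by (simp add: differentially_large_def)
  have "diff_poly_eval m K M \<kappa> (h \<circ> x) f = \<zero>\<^bsub>M\<^esub>" if f: "f \<in> S" for f
  proof -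
    interpret M: diff_field M m by (rule Mdf)
    have hx: "h (x j) \<in> carrier M" "g (h (x j)) = x j" if "j < k" for j
      using that G(1) by (auto simp: M_def gh)
    define z where "z = (\<lambda>(j, \<alpha>). der_power m M \<alpha> ((h \<circ> x) j))"
    have zM: "z v \<in> carrier M" if "v \<in> diff_vars m k" for v
      using that by (auto simp: z_def diff_vars_def intro!: M.der_power_closed hx)
    have zL: "(g \<circ> z) v = (\<lambda>(j, \<alpha>). der_power m L \<alpha> (x j)) v" if "v \<in> diff_vars m k" for v
      using that M.hom_der_power[of g L, OF gd] by (auto simp: z_def diff_vars_def hx)
    have fS: "f \<in> carrier (mpoly_ring K (diff_vars m k))" using f S by blast
    have "mpoly_eval K L \<iota> (g \<circ> z) f = diff_poly_eval m K L \<iota> x f"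
      unfolding diff_poly_eval_def
      using zL g.hom_closed[OF zM] ring_hom_closed[OF \<iota>]
      by (intro mpoly_eval_cong[OF K.ring_axioms L.cring_axioms fS]) auto
    then have "g (mpoly_eval K M \<kappa> z f) = g \<zero>\<^bsub>M\<^esub>"
      using evM[OF fS zM] sol f by simp
    then show ?thesis
      unfolding diff_poly_eval_def z_def[symmetric] using evc[OF fS zM] by (intro ginj) auto
  qed
  moreover have "h \<circ> x \<in> {..<k} \<rightarrow> carrier M" using G(1) by (auto simp: M_def)
  ultimately show "\<exists>x\<in>{..<k} \<rightarrow> carrier K. \<forall>f\<in>S. diff_poly_eval m K K id x f = \<zero>\<^bsub>K\<^esub>"
    using ecM[unfolded ec_as_diff_field_def, rule_format, of S k] fin S
    by blast
qed

section \<open>Matrices and PV-closed fields\<close>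

definition mat_ring :: "('a, 'r) ring_scheme \<Rightarrow> nat \<Rightarrow> (nat \<times> nat \<Rightarrow> 'a) ring" where
  "mat_ring R n =
    \<lparr>carrier = {..<n} \<times> {..<n} \<rightarrow>\<^sub>E carrier R,
     monoid.mult = (\<lambda>A B. \<lambda>(i, j)\<in>{..<n} \<times> {..<n}. \<Oplus>\<^bsub>R\<^esub>l\<in>{..<n}. A (i, l) \<otimes>\<^bsub>R\<^esub> B (l, j)),
     one = (\<lambda>(i, j)\<in>{..<n} \<times> {..<n}. if i = j then \<one>\<^bsub>R\<^esub> else \<zero>\<^bsub>R\<^esub>),
     zero = (\<lambda>(i, j)\<in>{..<n} \<times> {..<n}. \<zero>\<^bsub>R\<^esub>),
     add = (\<lambda>A B. \<lambda>(i, j)\<in>{..<n} \<times> {..<n}. A (i, j) \<oplus>\<^bsub>R\<^esub> B (i, j))\<rparr>"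

definition mat_der ::
  "('a, 'r) diff_ring_scheme \<Rightarrow> nat \<Rightarrow> nat \<Rightarrow> (nat \<times> nat \<Rightarrow> 'a) \<Rightarrow> (nat \<times> nat \<Rightarrow> 'a)" where
  "mat_der K n i A = (\<lambda>p\<in>{..<n} \<times> {..<n}. der K i (A p))"

definition commutator :: "('a, 'r) ring_scheme \<Rightarrow> 'a \<Rightarrow> 'a \<Rightarrow> 'a" where
  "commutator R a b = a \<otimes>\<^bsub>R\<^esub> b \<ominus>\<^bsub>R\<^esub> b \<otimes>\<^bsub>R\<^esub> a"

definition integrable_system ::
  "nat \<Rightarrow> ('a, 'r) diff_ring_scheme \<Rightarrow> nat \<Rightarrow> (nat \<Rightarrow> nat \<times> nat \<Rightarrow> 'a) \<Rightarrow> bool" where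
  "integrable_system m K n A \<longleftrightarrow>
    (\<forall>i<m. \<forall>j<m. mat_der K n i (A j) \<ominus>\<^bsub>mat_ring K n\<^esub> mat_der K n j (A i) =
       commutator (mat_ring K n) (A i) (A j))"

definition PV_closed :: "nat \<Rightarrow> ('a, 'r) diff_ring_scheme \<Rightarrow> bool" where
  "PV_closed m K \<longleftrightarrow>
    (\<forall>n\<ge>1. \<forall>A\<in>{..<m} \<rightarrow> carrier (mat_ring K n). integrable_system m K n A \<longrightarrow>
       (\<exists>Z\<in>Units (mat_ring K n). \<forall>i<m. mat_der K n i Z = A i \<otimes>\<^bsub>mat_ring K n\<^esub> Z))"

end

theory Submission
  imports Defs
begin

text \<open>A single generic solution vector suffices. Let \<open>L = K(x\<^sub>0,\<dots>,x\<^sub>n\<^sub>-\<^sub>1)\<close> be purely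
  transcendental over \<open>K\<close> with \<open>\<delta>\<^sub>i x = A\<^sub>i x\<close>; integrability says that these derivations commute. As
  \<open>K\<close> is infinite, rational functions can be evaluated at \<open>K\<close>-points avoiding finitely many
  denominators, so \<open>K\<close> is e.c. in \<open>L\<close> as a field. Differential largeness then turns \<open>x\<close> into solution
  vectors in \<open>K\<close> on which a prescribed nonzero linear form \<open>c\<close> does not vanish (the extra equation is
  \<open>c(x) w = 1\<close>). Starting from the identity matrix, the columns are replaced by such solutions one at a
  time; taking for \<open>c\<close> the \<open>k\<close>-th row of the current inverse keeps the matrix invertible, and no
  determinants are needed.

  To avoid formal polynomials, \<open>L\<close> is the field of fractions of the ring of polynomial functions
  on \<open>K\<^sup>n\<close>, with \<open>\<delta>\<close> acting on a function \<open>f\<close> by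
  \<open>(\<delta> f)(z) = \<delta>(f(z)) + df\<^sub>z(A z - \<delta> z)\<close>.\<close>

section \<open>Polynomial functions over an infinite field\<close>

text \<open>Working with functions gives up access to coefficients, so the derivation acting on
  coefficients must be expressed through values. The chain rule does it: \<delta>(f(z)) is the value
  at z of the coefficientwise derivative of f plus df_z(\<delta> z). Removing the last term and
  adding df_z(A z) leaves exactly the formula above.

  Questions in several variables are settled on lines, where a nonzero polynomial has finitely many
  roots while the field is infinite: linear coefficients become unique, and products of nonzero
  polynomial functions stay nonzero.

  Adjoining a whole generic solution matrix would force its determinant to be inverted; for a single
  vector the nonvanishing condition is one linear form, whose inverse is just one more unknown.

  The elements of L are sets of functions on points, hence L lives on a larger type than K, while
  differential largeness speaks of extensions on the type of K;
  \<open>differentially_large_extension\<close> closes this gap.\<close>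

context ring
begin

text \<open>Only the values on the carrier matter. The formal polynomial stays hidden behind an
  existential quantifier; its main use is the bound on the number of roots in
  \<open>unipoly_finite_zeros\<close>.\<close>

definition unipoly :: "('a \<Rightarrow> 'a) \<Rightarrow> bool" where
  "unipoly u \<longleftrightarrow> (\<exists>p\<in>carrier (poly_ring R). \<forall>t\<in>carrier R. u t = eval p t)"

text \<open>Points are arbitrary functions \<open>z :: 'i \<Rightarrow> 'a\<close>; entries outside the carrier are read as
  \<open>\<zero>\<close>, so that polynomial functions are total and their equality is equality in HOL.\<close>

definition coord :: "'i \<Rightarrow> ('i \<Rightarrow> 'a) \<Rightarrow> 'a" where
  "coord i z = (if z i \<in> carrier R then z i else \<zero>)"

inductive_set polyfun :: "(('i \<Rightarrow> 'a) \<Rightarrow> 'a) set" where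
  const: "c \<in> carrier R \<Longrightarrow> (\<lambda>z. c) \<in> polyfun"
| coord: "coord i \<in> polyfun"
| add: "\<lbrakk>f \<in> polyfun; g \<in> polyfun\<rbrakk> \<Longrightarrow> (\<lambda>z. f z \<oplus> g z) \<in> polyfun"
| mult: "\<lbrakk>f \<in> polyfun; g \<in> polyfun\<rbrakk> \<Longrightarrow> (\<lambda>z. f z \<otimes> g z) \<in> polyfun"

text \<open>Base point and direction pass through \<open>coord\<close>, so that the line stays in
  the carrier for all z and v, and \<open>line z v \<zero>\<close> is the normalised form of
  z.\<close>

definition line :: "('i \<Rightarrow> 'a) \<Rightarrow> ('i \<Rightarrow> 'a) \<Rightarrow> 'a \<Rightarrow> 'i \<Rightarrow> 'a" where
  "line z v t = (\<lambda>i. coord i z \<oplus> t \<otimes> coord i v)"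

text \<open>The element d is the coefficient of t in the polynomial f(z + t v), an algebraic
  stand-in for a limit. The function u must be polynomial: with an arbitrary u one could solve for
  \<open>u t\<close> at every nonzero t, and every d would qualify.\<close>

definition has_dirder :: "(('i \<Rightarrow> 'a) \<Rightarrow> 'a) \<Rightarrow> ('i \<Rightarrow> 'a) \<Rightarrow> ('i \<Rightarrow> 'a) \<Rightarrow> 'a \<Rightarrow> bool" where
  "has_dirder f z v d \<longleftrightarrow> d \<in> carrier R \<and>
    (\<exists>u. unipoly u \<and> (\<forall>t\<in>carrier R. f (line z v t) = f z \<oplus> t \<otimes> d \<oplus> t \<otimes> (t \<otimes> u t)))"

definition dirder :: "(('i \<Rightarrow> 'a) \<Rightarrow> 'a) \<Rightarrow> ('i \<Rightarrow> 'a) \<Rightarrow> ('i \<Rightarrow> 'a) \<Rightarrow> 'a" where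
  "dirder f z v = (THE d. has_dirder f z v d)"

lemma coord_closed [simp, intro]: "coord i z \<in> carrier R"
  by (simp add: coord_def)

lemma polyfun_closed: "f \<in> polyfun \<Longrightarrow> f z \<in> carrier R"
  by (induction rule: polyfun.induct) auto

lemma polyfun_finsum:
  assumes "finite I" "\<And>i. i \<in> I \<Longrightarrow> f i \<in> polyfun"
  shows "(\<lambda>z. \<Oplus>i\<in>I. f i z) \<in> polyfun"
  using assms
proof (induction I rule: finite_induct)
  case empty
  then show ?case by (simp add: polyfun.const)
next
  case (insert x I)
  then have "(\<lambda>z. \<Oplus>i\<in>insert x I. f i z) = (\<lambda>z. f x z \<oplus> (\<Oplus>i\<in>I. f i z))"
    by (intro ext finsum_insert) (auto simp: polyfun_closed)
  then show ?case using insert by (simp add: polyfun.add)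
qed

lemma polyfun_a_inv:
  assumes "f \<in> polyfun" shows "(\<lambda>z. \<ominus> f z) \<in> polyfun"
proof -
  have "(\<lambda>z. \<ominus> f z) = (\<lambda>z. (\<ominus> \<one>) \<otimes> f z)"
    using assms by (auto simp: polyfun_closed l_minus)
  then show ?thesis using polyfun.mult[OF polyfun.const assms] by simp
qed

end

section \<open>Univariate polynomial functions\<close>

context field
begin

lemma unipoly_const: "c \<in> carrier R \<Longrightarrow> unipoly (\<lambda>t. c)"
  unfolding unipoly_def
proof (cases "c = \<zero>")
  case True
  then show "\<exists>p\<in>carrier (poly_ring R). \<forall>t\<in>carrier R. c = eval p t"
    by (intro bexI[of _ "[]"]) (auto simp: univ_poly_zero_closed)
next
  case False
  assume "c \<in> carrier R"
  then show "\<exists>p\<in>carrier (poly_ring R). \<forall>t\<in>carrier R. c = eval p t"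
    using False by (intro bexI[of _ "[c]"]) (auto simp: sym[OF univ_poly_carrier] polynomial_def)
qed

lemma unipoly_ident: "unipoly (\<lambda>t. t)"
  unfolding unipoly_def
  by (intro bexI[of _ "[\<one>, \<zero>]"]) (auto simp: sym[OF univ_poly_carrier] polynomial_def)

lemma unipoly_add:
  assumes "unipoly u" "unipoly w" shows "unipoly (\<lambda>t. u t \<oplus> w t)"
proof -
  obtain p q where p: "p \<in> carrier (poly_ring R)" "\<forall>t\<in>carrier R. u t = eval p t"
    and q: "q \<in> carrier (poly_ring R)" "\<forall>t\<in>carrier R. w t = eval q t"
    using assms unfolding unipoly_def by blast
  interpret UP: domain "poly_ring R" using univ_poly_is_domain[OF carrier_is_subring] .
  show ?thesis unfolding unipoly_def
    using p q UP.a_closed[OF p(1) q(1)] ring_hom_add[OF eval_is_hom[OF carrier_is_subring]]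
    by (intro bexI[of _ "p \<oplus>\<^bsub>poly_ring R\<^esub> q"]) auto
qed

lemma unipoly_mult:
  assumes "unipoly u" "unipoly w" shows "unipoly (\<lambda>t. u t \<otimes> w t)"
proof -
  obtain p q where p: "p \<in> carrier (poly_ring R)" "\<forall>t\<in>carrier R. u t = eval p t"
    and q: "q \<in> carrier (poly_ring R)" "\<forall>t\<in>carrier R. w t = eval q t"
    using assms unfolding unipoly_def by blast
  interpret UP: domain "poly_ring R" using univ_poly_is_domain[OF carrier_is_subring] .
  show ?thesis unfolding unipoly_def
    using p q UP.m_closed[OF p(1) q(1)] ring_hom_mult[OF eval_is_hom[OF carrier_is_subring]]
    by (intro bexI[of _ "p \<otimes>\<^bsub>poly_ring R\<^esub> q"]) auto
qed

lemma unipoly_closed: "\<lbrakk>unipoly u; t \<in> carrier R\<rbrakk> \<Longrightarrow> u t \<in> carrier R"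
  unfolding unipoly_def
  by (metis carrier_is_subring eval_poly_in_carrier univ_poly_carrier)

text \<open>The nonzero value at s rules out the zero polynomial, and any other polynomial over a
  field has finitely many roots.\<close>

lemma unipoly_finite_zeros:
  assumes "unipoly u" "s \<in> carrier R" "u s \<noteq> \<zero>"
  shows "finite {t \<in> carrier R. u t = \<zero>}"
proof -
  obtain p where p: "p \<in> carrier (poly_ring R)" "\<forall>t\<in>carrier R. u t = eval p t"
    using assms(1) unfolding unipoly_def by blast
  have "p \<noteq> []" using p(2) assms(2,3) by auto
  then have "{t \<in> carrier R. u t = \<zero>} \<subseteq> {t. is_root p t}"
    using p(2) by (auto simp: is_root_def)
  then show ?thesis using finite_number_of_roots[OF p(1)] finite_subset by blast
qed

section \<open>Directional derivatives as linear coefficients along lines\<close>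

lemma has_dirder_const: "c \<in> carrier R \<Longrightarrow> has_dirder (\<lambda>z. c) z v \<zero>"
  unfolding has_dirder_def using unipoly_const[of \<zero>] by auto

lemma has_dirder_coord: "has_dirder (coord i) z v (coord i v)"
  unfolding has_dirder_def using unipoly_const[of \<zero>]
  by (auto simp: line_def coord_def)

lemma has_dirder_add:
  assumes "has_dirder f z v d" "has_dirder g z v e" "f z \<in> carrier R" "g z \<in> carrier R"
  shows "has_dirder (\<lambda>z. f z \<oplus> g z) z v (d \<oplus> e)"
  unfolding has_dirder_def
proof
  obtain u w where d: "d \<in> carrier R" and e: "e \<in> carrier R" and u: "unipoly u" and w: "unipoly w"
    and fu: "\<forall>t\<in>carrier R. f (line z v t) = f z \<oplus> t \<otimes> d \<oplus> t \<otimes> (t \<otimes> u t)"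
    and gw: "\<forall>t\<in>carrier R. g (line z v t) = g z \<oplus> t \<otimes> e \<oplus> t \<otimes> (t \<otimes> w t)"
    using assms unfolding has_dirder_def by blast
  show "d \<oplus> e \<in> carrier R" using d e by simp
  show "\<exists>u. unipoly u \<and> (\<forall>t\<in>carrier R. f (line z v t) \<oplus> g (line z v t) =
     f z \<oplus> g z \<oplus> t \<otimes> (d \<oplus> e) \<oplus> t \<otimes> (t \<otimes> u t))"
  proof (intro exI conjI ballI)
    fix t assume t: "t \<in> carrier R"
    show "f (line z v t) \<oplus> g (line z v t) =
       f z \<oplus> g z \<oplus> t \<otimes> (d \<oplus> e) \<oplus> t \<otimes> (t \<otimes> (u t \<oplus> w t))"
      using t d e fu gw unipoly_closed[OF u t] unipoly_closed[OF w t] assms(3,4)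
      by (simp add: r_distr a_ac)
  qed (rule unipoly_add[OF u w])
qed

lemma has_dirder_mult:
  assumes "has_dirder f z v d" "has_dirder g z v e" "f z \<in> carrier R" "g z \<in> carrier R"
  shows "has_dirder (\<lambda>z. f z \<otimes> g z) z v (d \<otimes> g z \<oplus> f z \<otimes> e)"
  unfolding has_dirder_def
proof
  obtain u w where d: "d \<in> carrier R" and e: "e \<in> carrier R" and u: "unipoly u" and w: "unipoly w"
    and fu: "\<forall>t\<in>carrier R. f (line z v t) = f z \<oplus> t \<otimes> d \<oplus> t \<otimes> (t \<otimes> u t)"
    and gw: "\<forall>t\<in>carrier R. g (line z v t) = g z \<oplus> t \<otimes> e \<oplus> t \<otimes> (t \<otimes> w t)"
    using assms unfolding has_dirder_def by blast
  show "d \<otimes> g z \<oplus> f z \<otimes> e \<in> carrier R" using assms(3,4) d e by simp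
  \<comment> \<open>The cofactor of t^2 in the product of the two expansions: constant terms against
    remainders, the product of the linear coefficients, then the contributions of order t^3 and
    t^4.\<close>
  define h where "h = (\<lambda>t. (f z \<otimes> w t \<oplus> u t \<otimes> g z) \<oplus> (d \<otimes> e \<oplus>
       t \<otimes> (d \<otimes> w t \<oplus> e \<otimes> u t)) \<oplus> t \<otimes> (t \<otimes> (u t \<otimes> w t)))"
  show "\<exists>u. unipoly u \<and> (\<forall>t\<in>carrier R. f (line z v t) \<otimes> g (line z v t) =
     f z \<otimes> g z \<oplus> t \<otimes> (d \<otimes> g z \<oplus> f z \<otimes> e) \<oplus> t \<otimes> (t \<otimes> u t))"
  proof (intro exI conjI ballI)
    fix t assume t: "t \<in> carrier R"
    show "f (line z v t) \<otimes> g (line z v t) =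
       f z \<otimes> g z \<oplus> t \<otimes> (d \<otimes> g z \<oplus> f z \<otimes> e) \<oplus> t \<otimes> (t \<otimes> h t)"
      using assms(3,4) t d e fu gw unipoly_closed[OF u t] unipoly_closed[OF w t]
      by (simp add: h_def r_distr l_distr a_ac m_ac)
  next
    show "unipoly h" unfolding h_def using u w d e assms(3,4)
      by (intro unipoly_add unipoly_mult unipoly_const unipoly_ident) auto
  qed
qed

lemma polyfun_has_dirder:
  assumes "f \<in> polyfun" shows "\<exists>d. has_dirder f z v d"
  using assms
proof (induction rule: polyfun.induct)
  case (const c)
  then show ?case by (intro exI, rule has_dirder_const)
next
  case (coord i)
  show ?case by (rule exI, rule has_dirder_coord)
next
  case (add f g)
  then obtain d e where "has_dirder f z v d" "has_dirder g z v e" by blast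
  from has_dirder_add[OF this] add show ?case by (metis polyfun_closed)
next
  case (mult f g)
  then obtain d e where "has_dirder f z v d" "has_dirder g z v e" by blast
  from has_dirder_mult[OF this] mult show ?case by (metis polyfun_closed)
qed

end

section \<open>Consequences of an infinite ground field\<close>

locale infinite_field = field +
  assumes infinite_carrier: "infinite (carrier R)"
begin

text \<open>Three finite sets do not cover an infinite carrier. The third one,
  \<open>{\<zero>}\<close>, is removed so that \<open>unipoly_eqI\<close> can conclude from
  agreement away from the origin.\<close>

lemma unipoly_common_nonzero:
  assumes "unipoly u" "s \<in> carrier R" "u s \<noteq> \<zero>" "unipoly w" "r \<in> carrier R" "w r \<noteq> \<zero>"
  shows "\<exists>t\<in>carrier R. t \<noteq> \<zero> \<and> u t \<noteq> \<zero> \<and> w t \<noteq> \<zero>"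
proof -
  have "finite ({t \<in> carrier R. u t = \<zero>} \<union> {t \<in> carrier R. w t = \<zero>} \<union> {\<zero>})"
    using unipoly_finite_zeros assms by simp
  then have "\<not> carrier R \<subseteq> {t \<in> carrier R. u t = \<zero>} \<union> {t \<in> carrier R. w t = \<zero>} \<union> {\<zero>}"
    using infinite_carrier finite_subset by blast
  then show ?thesis by blast
qed

text \<open>If the difference of u and w were nonzero at s, it would be nonzero at some t other than
  \<open>\<zero>\<close>. The case s = \<open>\<zero>\<close> recovers a constant term after a
  factor t has been cancelled.\<close>

lemma unipoly_eqI:
  assumes "unipoly u" "unipoly w" "\<And>t. t \<in> carrier R \<Longrightarrow> t \<noteq> \<zero> \<Longrightarrow> u t = w t" "s \<in> carrier R"
  shows "u s = w s"
proof (rule ccontr)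
  assume ne: "u s \<noteq> w s"
  let ?g = "\<lambda>t. u t \<oplus> \<ominus> \<one> \<otimes> w t"
  have g: "unipoly ?g"
    by (intro unipoly_add unipoly_mult unipoly_const assms) auto
  have e: "?g t = \<zero> \<longleftrightarrow> u t = w t" if "t \<in> carrier R" for t
    using unipoly_closed[OF assms(1) that] unipoly_closed[OF assms(2) that]
    by (simp add: l_minus) (metis a_minus_def r_right_minus_eq)
  show False
    using unipoly_common_nonzero[OF g assms(4) _ g assms(4)] e assms(3,4) ne by blast
qed

text \<open>Cancelling \<open>f z\<close> and one factor t from the two expansions shows that d + t
  u(t) and e + t w(t) agree for t other than \<open>\<zero>\<close>, hence also at
  \<open>\<zero>\<close>, where they take the values d and e.\<close>

lemma has_dirder_unique:
  assumes "has_dirder f z v d" "has_dirder f z v e" "f z \<in> carrier R"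
  shows "d = e"
proof -
  obtain u w where d: "d \<in> carrier R" and e: "e \<in> carrier R" and u: "unipoly u" and w: "unipoly w"
    and fu: "\<forall>t\<in>carrier R. f (line z v t) = f z \<oplus> t \<otimes> d \<oplus> t \<otimes> (t \<otimes> u t)"
    and fw: "\<forall>t\<in>carrier R. f (line z v t) = f z \<oplus> t \<otimes> e \<oplus> t \<otimes> (t \<otimes> w t)"
    using assms unfolding has_dirder_def by blast
  have "d \<oplus> \<zero> \<otimes> u \<zero> = e \<oplus> \<zero> \<otimes> w \<zero>"
  proof (rule unipoly_eqI[where u = "\<lambda>t. d \<oplus> t \<otimes> u t" and w = "\<lambda>t. e \<oplus> t \<otimes> w t"])
    fix t assume t: "t \<in> carrier R" "t \<noteq> \<zero>"
    note c = unipoly_closed[OF u t(1)] unipoly_closed[OF w t(1)]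
    have "f z \<oplus> (t \<otimes> d \<oplus> t \<otimes> (t \<otimes> u t)) = f z \<oplus> (t \<otimes> e \<oplus> t \<otimes> (t \<otimes> w t))"
      using fu fw t c d e assms(3) by (metis a_assoc m_closed)
    then have "t \<otimes> (d \<oplus> t \<otimes> u t) = t \<otimes> (e \<oplus> t \<otimes> w t)"
      using t c d e assms(3) by (simp add: r_distr)
    then show "d \<oplus> t \<otimes> u t = e \<oplus> t \<otimes> w t" using t c d e by (simp add: m_lcancel)
  qed (use d e u w in \<open>auto intro!: unipoly_add unipoly_mult unipoly_const unipoly_ident\<close>)
  then show ?thesis using d e unipoly_closed[OF u] unipoly_closed[OF w] by simp
qed

lemma dirder_eqI: "\<lbrakk>has_dirder f z v d; f z \<in> carrier R\<rbrakk> \<Longrightarrow> dirder f z v = d"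
  unfolding dirder_def using has_dirder_unique by blast

end

section \<open>Rational functions and derivations\<close>

definition derivation :: "('a, 'r) ring_scheme \<Rightarrow> ('a \<Rightarrow> 'a) \<Rightarrow> bool" where
  "derivation R D \<longleftrightarrow> (\<forall>x\<in>carrier R. D x \<in> carrier R) \<and>
    (\<forall>x\<in>carrier R. \<forall>y\<in>carrier R. D (x \<oplus>\<^bsub>R\<^esub> y) = D x \<oplus>\<^bsub>R\<^esub> D y \<and>
       D (x \<otimes>\<^bsub>R\<^esub> y) = D x \<otimes>\<^bsub>R\<^esub> y \<oplus>\<^bsub>R\<^esub> x \<otimes>\<^bsub>R\<^esub> D y)"

lemma derivationD:
  assumes "derivation R D" "x \<in> carrier R"
  shows "D x \<in> carrier R"
    and "y \<in> carrier R \<Longrightarrow> D (x \<oplus>\<^bsub>R\<^esub> y) = D x \<oplus>\<^bsub>R\<^esub> D y"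
    and "y \<in> carrier R \<Longrightarrow> D (x \<otimes>\<^bsub>R\<^esub> y) = D x \<otimes>\<^bsub>R\<^esub> y \<oplus>\<^bsub>R\<^esub> x \<otimes>\<^bsub>R\<^esub> D y"
  using assms unfolding derivation_def by auto

lemma (in cring) derivation_zero: "derivation R D \<Longrightarrow> D \<zero> = \<zero>"
  using derivationD(1,2)[of R D \<zero>] by (metis add.l_cancel_one' r_zero zero_closed)

context ring
begin

definition fun_ring :: "('p \<Rightarrow> 'a) set \<Rightarrow> ('p \<Rightarrow> 'a) ring" where
  "fun_ring F = \<lparr>carrier = F, monoid.mult = (\<lambda>f g z. f z \<otimes> g z), one = (\<lambda>z. \<one>),
     zero = (\<lambda>z. \<zero>), add = (\<lambda>f g z. f z \<oplus> g z)\<rparr>"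

lemma fun_ring_simps [simp]:
  "carrier (fun_ring F) = F" "f \<otimes>\<^bsub>fun_ring F\<^esub> g = (\<lambda>z. f z \<otimes> g z)"
  "f \<oplus>\<^bsub>fun_ring F\<^esub> g = (\<lambda>z. f z \<oplus> g z)" "\<one>\<^bsub>fun_ring F\<^esub> = (\<lambda>z. \<one>)" "\<zero>\<^bsub>fun_ring F\<^esub> = (\<lambda>z. \<zero>)"
  by (simp_all add: fun_ring_def)

text \<open>A rational function \<open>p/q\<close> is represented by every total function that agrees with it where
  \<open>q \<noteq> \<zero>\<close>; the values elsewhere do not matter, as one sees by writing \<open>p/q = pq/q\<^sup>2\<close>. The
  ideal \<open>null_ratfun\<close> consists of the representatives of \<open>0\<close>.\<close>

definition ratfun :: "(('i \<Rightarrow> 'a) \<Rightarrow> 'a) set" where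
  "ratfun = {h. (\<forall>z. h z \<in> carrier R) \<and>
     (\<exists>p\<in>polyfun. \<exists>q\<in>polyfun. (\<exists>z. q z \<noteq> \<zero>) \<and> (\<forall>z. h z \<otimes> q z = p z))}"

definition null_ratfun :: "(('i \<Rightarrow> 'a) \<Rightarrow> 'a) set" where
  "null_ratfun = {h. (\<forall>z. h z \<in> carrier R) \<and> (\<exists>q\<in>polyfun. (\<exists>z. q z \<noteq> \<zero>) \<and> (\<forall>z. h z \<otimes> q z = \<zero>))}"

definition ratfun_field :: "(('i \<Rightarrow> 'a) \<Rightarrow> 'a) set ring" where
  "ratfun_field = fun_ring ratfun Quot null_ratfun"

definition ratfun_class :: "(('i \<Rightarrow> 'a) \<Rightarrow> 'a) \<Rightarrow> (('i \<Rightarrow> 'a) \<Rightarrow> 'a) set" where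
  "ratfun_class h = null_ratfun +>\<^bsub>fun_ring ratfun\<^esub> h"

text \<open>By the chain rule this is the coefficientwise derivative of f plus df_z(b(z)), that is,
  the derivation equal to \<delta> on constants and to \<open>b i\<close> on coordinate i. The
  family b is left general; the linear system enters only with \<open>generic_der\<close>.\<close>

definition polyder :: "('a \<Rightarrow> 'a) \<Rightarrow> ('i \<Rightarrow> ('i \<Rightarrow> 'a) \<Rightarrow> 'a) \<Rightarrow> (('i \<Rightarrow> 'a) \<Rightarrow> 'a) \<Rightarrow> ('i \<Rightarrow> 'a) \<Rightarrow> 'a" where
  "polyder \<delta> b f z = \<delta> (f z) \<oplus> dirder f z (\<lambda>i. b i z \<ominus> \<delta> (coord i z))"

end

lemma (in cring) fun_ring_cring:
  assumes "\<And>f z. f \<in> F \<Longrightarrow> f z \<in> carrier R"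
    and "(\<lambda>z. \<one>) \<in> F" "(\<lambda>z. \<zero>) \<in> F" "\<And>f. f \<in> F \<Longrightarrow> (\<lambda>z. \<ominus> f z) \<in> F"
    and "\<And>f g. f \<in> F \<Longrightarrow> g \<in> F \<Longrightarrow> (\<lambda>z. f z \<oplus> g z) \<in> F"
    and "\<And>f g. f \<in> F \<Longrightarrow> g \<in> F \<Longrightarrow> (\<lambda>z. f z \<otimes> g z) \<in> F"
  shows "cring (fun_ring F)"
proof (rule cringI)
  show "abelian_group (fun_ring F)"
  proof (rule abelian_groupI)
    fix f assume f: "f \<in> carrier (fun_ring F)"
    show "\<exists>g\<in>carrier (fun_ring F). g \<oplus>\<^bsub>fun_ring F\<^esub> f = \<zero>\<^bsub>fun_ring F\<^esub>"
      using f assms(1,4) by (intro bexI[of _ "\<lambda>z. \<ominus> f z"]) (auto simp: l_neg)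
  qed (auto simp: assms a_ac)
  show "comm_monoid (fun_ring F)"
    by (rule comm_monoidI) (auto simp: assms m_ac)
qed (auto simp: assms l_distr)

context infinite_field
begin

lemma polyfun_ring_cring: "cring (fun_ring polyfun)"
  by (rule fun_ring_cring) (auto simp: polyfun_closed polyfun_a_inv intro: polyfun.intros)

text \<open>Polynomial functions read a point only through \<open>coord\<close>. This leads from the
  normalised end points of a line back to the original points.\<close>

lemma polyfun_coord: "f \<in> polyfun \<Longrightarrow> f (\<lambda>i. coord i z) = f z"
  by (induction rule: polyfun.induct) (auto simp: coord_def)

lemma unipoly_polyfun_line: "f \<in> polyfun \<Longrightarrow> unipoly (\<lambda>t. f (line z v t))"
proof (induction rule: polyfun.induct)
  case (coord i)
  have "unipoly (\<lambda>t. coord i z \<oplus> t \<otimes> coord i v)"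
    by (intro unipoly_add unipoly_mult unipoly_const unipoly_ident) auto
  moreover have "(\<lambda>t. coord i (line z v t)) t = coord i z \<oplus> t \<otimes> coord i v" if "t \<in> carrier R" for t
    using that by (simp add: coord_def line_def)
  ultimately show ?case unfolding unipoly_def by auto
qed (auto intro: unipoly_const unipoly_add unipoly_mult)

text \<open>On the line through z and w, reaching z at parameter \<open>\<zero>\<close> and w at
  \<open>\<one>\<close>, both restrictions are univariate polynomial functions with a nonzero value,
  so some parameter avoids the zeros of both.\<close>

lemma polyfun_common_nonzero:
  assumes "f \<in> polyfun" "f z \<noteq> \<zero>" "g \<in> polyfun" "g w \<noteq> \<zero>"
  shows "\<exists>x. f x \<noteq> \<zero> \<and> g x \<noteq> \<zero>"
proof -
  let ?l = "line z (\<lambda>i. coord i w \<ominus> coord i z)"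
  have "?l \<zero> = (\<lambda>i. coord i z)" by (simp add: line_def)
  then have 0: "f (?l \<zero>) \<noteq> \<zero>" using assms polyfun_coord by metis
  have "?l \<one> = (\<lambda>i. coord i w)"
  proof
    fix i
    have "coord i z \<oplus> (coord i w \<ominus> coord i z) = coord i w"
      using coord_closed[of i z] coord_closed[of i w] by algebra
    then show "?l \<one> i = coord i w" by (simp add: line_def coord_def[of i "\<lambda>i. _ i"])
  qed
  then have 1: "g (?l \<one>) \<noteq> \<zero>" using assms polyfun_coord by metis
  show ?thesis
    using unipoly_common_nonzero[OF unipoly_polyfun_line[OF assms(1)] _ 0 unipoly_polyfun_line[OF assms(3)] _ 1]
    by blast
qed

text \<open>A common nonzero point suffices, because a field has no zero divisors. This keeps
  products of denominators admissible as denominators.\<close>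

lemma polyfun_nonzero_mult:
  assumes "p \<in> polyfun" "\<exists>z. p z \<noteq> \<zero>" "q \<in> polyfun" "\<exists>z. q z \<noteq> \<zero>"
  shows "\<exists>z. p z \<otimes> q z \<noteq> \<zero>"
  using polyfun_common_nonzero assms by (metis integral polyfun_closed)

lemma
  shows dirder_const: "c \<in> carrier R \<Longrightarrow> dirder (\<lambda>z. c) z v = \<zero>"
    and dirder_coord: "dirder (coord i) z v = coord i v"
    and dirder_add: "\<lbrakk>f \<in> polyfun; g \<in> polyfun\<rbrakk> \<Longrightarrow> dirder (\<lambda>z. f z \<oplus> g z) z v = dirder f z v \<oplus> dirder g z v"
    and dirder_mult: "\<lbrakk>f \<in> polyfun; g \<in> polyfun\<rbrakk> \<Longrightarrow>
      dirder (\<lambda>z. f z \<otimes> g z) z v = dirder f z v \<otimes> g z \<oplus> f z \<otimes> dirder g z v"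
    and dirder_closed: "f \<in> polyfun \<Longrightarrow> dirder f z v \<in> carrier R"
proof -
  have *: "has_dirder f z v (dirder f z v)" if "f \<in> polyfun" for f
    using polyfun_has_dirder[OF that] dirder_eqI polyfun_closed[OF that] by metis
  show "c \<in> carrier R \<Longrightarrow> dirder (\<lambda>z. c) z v = \<zero>"
    by (intro dirder_eqI has_dirder_const)
  show "dirder (coord i) z v = coord i v"
    by (intro dirder_eqI has_dirder_coord) simp
  show "\<lbrakk>f \<in> polyfun; g \<in> polyfun\<rbrakk> \<Longrightarrow> dirder (\<lambda>z. f z \<oplus> g z) z v = dirder f z v \<oplus> dirder g z v"
    by (intro dirder_eqI has_dirder_add *) (auto simp: polyfun_closed)
  show "\<lbrakk>f \<in> polyfun; g \<in> polyfun\<rbrakk> \<Longrightarrow>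
      dirder (\<lambda>z. f z \<otimes> g z) z v = dirder f z v \<otimes> g z \<oplus> f z \<otimes> dirder g z v"
    by (intro dirder_eqI has_dirder_mult *) (auto simp: polyfun_closed)
  show "f \<in> polyfun \<Longrightarrow> dirder f z v \<in> carrier R"
    using * has_dirder_def by blast
qed

section \<open>The derivation determined by its values on constants and coordinates\<close>

lemma
  assumes \<delta>: "derivation R \<delta>" and b: "\<And>i. b i \<in> polyfun"
  shows polyder_const: "c \<in> carrier R \<Longrightarrow> polyder \<delta> b (\<lambda>z. c) = (\<lambda>z. \<delta> c)"
    and polyder_coord: "polyder \<delta> b (coord i) = b i"
    and polyder_add: "\<lbrakk>f \<in> polyfun; g \<in> polyfun\<rbrakk> \<Longrightarrow>
      polyder \<delta> b (\<lambda>z. f z \<oplus> g z) = (\<lambda>z. polyder \<delta> b f z \<oplus> polyder \<delta> b g z)"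
    and polyder_mult: "\<lbrakk>f \<in> polyfun; g \<in> polyfun\<rbrakk> \<Longrightarrow>
      polyder \<delta> b (\<lambda>z. f z \<otimes> g z) = (\<lambda>z. polyder \<delta> b f z \<otimes> g z \<oplus> f z \<otimes> polyder \<delta> b g z)"
    and polyder_derivation: "derivation (fun_ring polyfun) (polyder \<delta> b)"
proof -
  note d = derivationD[OF \<delta>]
  note bc = polyfun_closed[OF b]
  show const: "polyder \<delta> b (\<lambda>z. c) = (\<lambda>z. \<delta> c)" if "c \<in> carrier R" for c
    using that d by (auto simp: polyder_def dirder_const)
  show coord: "polyder \<delta> b (coord i) = b i" for i
  proof
    fix z
    \<comment> \<open>The derivative of a coordinate in a direction is that component of the
      direction, so the two occurrences of \<open>\<delta> (coord i z)\<close> cancel.\<close>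
    have "\<delta> (coord i z) \<oplus> (b i z \<ominus> \<delta> (coord i z)) = b i z"
      using d(1)[OF coord_closed[of i z]] bc[of i z] by algebra
    moreover have "coord i (\<lambda>i. b i z \<ominus> \<delta> (coord i z)) = b i z \<ominus> \<delta> (coord i z)"
      using d(1)[OF coord_closed[of i z]] bc[of i z] by (simp add: coord_def)
    ultimately show "polyder \<delta> b (coord i) z = b i z"
      by (simp add: polyder_def dirder_coord)
  qed
  show add: "polyder \<delta> b (\<lambda>z. f z \<oplus> g z) = (\<lambda>z. polyder \<delta> b f z \<oplus> polyder \<delta> b g z)"
    if "f \<in> polyfun" "g \<in> polyfun" for f g
    using that by (auto simp: polyder_def dirder_add dirder_closed d polyfun_closed a_ac)
  show mult: "polyder \<delta> b (\<lambda>z. f z \<otimes> g z) = (\<lambda>z. polyder \<delta> b f z \<otimes> g z \<oplus> f z \<otimes> polyder \<delta> b g z)"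
    if "f \<in> polyfun" "g \<in> polyfun" for f g
    using that by (auto simp: polyder_def dirder_mult dirder_closed d polyfun_closed a_ac l_distr r_distr)
  \<comment> \<open>In general neither summand in the definition of \<open>polyder\<close> is
    polynomial in z, since \<delta> is applied to values. That the sum is polynomial follows by
    induction from the rules just shown.\<close>
  have "polyder \<delta> b f \<in> polyfun" if "f \<in> polyfun" for f
    using that
    by (induction rule: polyfun.induct)
      (auto simp: const coord add mult b d intro!: polyfun.intros)
  then show "derivation (fun_ring polyfun) (polyder \<delta> b)"
    by (auto simp: derivation_def add mult)
qed

section \<open>Rational functions and their field structure\<close>

lemma ratfun_closed: "h \<in> ratfun \<Longrightarrow> h z \<in> carrier R"
  by (simp add: ratfun_def)

lemma ratfunE:
  assumes "h \<in> ratfun"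
  obtains p q where "p \<in> polyfun" "q \<in> polyfun" "\<exists>z. q z \<noteq> \<zero>" "\<And>z. h z \<otimes> q z = p z"
  using assms unfolding ratfun_def by blast

lemma ratfunI:
  assumes "\<And>z. h z \<in> carrier R" "p \<in> polyfun" "q \<in> polyfun" "\<exists>z. q z \<noteq> \<zero>" "\<And>z. h z \<otimes> q z = p z"
  shows "h \<in> ratfun"
  unfolding ratfun_def using assms by blast

lemma polyfun_ratfun: "polyfun \<subseteq> ratfun"
proof
  fix p assume p: "p \<in> polyfun"
  show "p \<in> ratfun"
    by (rule ratfunI[OF _ p polyfun.const[of \<one>]]) (use p in \<open>auto simp: polyfun_closed\<close>)
qed

lemma ratfun_add:
  assumes "f \<in> ratfun" "g \<in> ratfun" shows "(\<lambda>z. f z \<oplus> g z) \<in> ratfun"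
proof -
  obtain p q where pq: "p \<in> polyfun" "q \<in> polyfun" "\<exists>z. q z \<noteq> \<zero>" "\<And>z. f z \<otimes> q z = p z"
    by (rule ratfunE[OF assms(1)]) (rule that)
  obtain r s where rs: "r \<in> polyfun" "s \<in> polyfun" "\<exists>z. s z \<noteq> \<zero>" "\<And>z. g z \<otimes> s z = r z"
    by (rule ratfunE[OF assms(2)]) (rule that)
  show ?thesis
  proof (rule ratfunI[where p = "\<lambda>z. p z \<otimes> s z \<oplus> r z \<otimes> q z" and q = "\<lambda>z. q z \<otimes> s z"])
    fix z
    note c = ratfun_closed[OF assms(1), of z] ratfun_closed[OF assms(2), of z]
      polyfun_closed[OF pq(2), of z] polyfun_closed[OF rs(2), of z]
    show "f z \<oplus> g z \<in> carrier R" using c by simp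
    show "(f z \<oplus> g z) \<otimes> (q z \<otimes> s z) = p z \<otimes> s z \<oplus> r z \<otimes> q z"
      using c by (simp add: pq(4)[symmetric] rs(4)[symmetric] l_distr r_distr m_ac)
  qed (use pq rs polyfun_nonzero_mult[OF pq(2,3) rs(2,3)] in \<open>auto intro!: polyfun.intros\<close>)
qed

lemma ratfun_mult:
  assumes "f \<in> ratfun" "g \<in> ratfun" shows "(\<lambda>z. f z \<otimes> g z) \<in> ratfun"
proof -
  obtain p q where pq: "p \<in> polyfun" "q \<in> polyfun" "\<exists>z. q z \<noteq> \<zero>" "\<And>z. f z \<otimes> q z = p z"
    by (rule ratfunE[OF assms(1)]) (rule that)
  obtain r s where rs: "r \<in> polyfun" "s \<in> polyfun" "\<exists>z. s z \<noteq> \<zero>" "\<And>z. g z \<otimes> s z = r z"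
    by (rule ratfunE[OF assms(2)]) (rule that)
  show ?thesis
  proof (rule ratfunI[where p = "\<lambda>z. p z \<otimes> r z" and q = "\<lambda>z. q z \<otimes> s z"])
    fix z
    note c = ratfun_closed[OF assms(1), of z] ratfun_closed[OF assms(2), of z]
      polyfun_closed[OF pq(2), of z] polyfun_closed[OF rs(2), of z]
    show "f z \<otimes> g z \<in> carrier R" using c by simp
    show "(f z \<otimes> g z) \<otimes> (q z \<otimes> s z) = p z \<otimes> r z"
      using c by (simp add: pq(4)[symmetric] rs(4)[symmetric] m_ac)
  qed (use pq rs polyfun_nonzero_mult[OF pq(2,3) rs(2,3)] in \<open>auto intro!: polyfun.intros\<close>)
qed

lemma const_ratfun: "c \<in> carrier R \<Longrightarrow> (\<lambda>z. c) \<in> ratfun"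
  using polyfun_ratfun polyfun.const by blast

lemma ratfun_ring_cring: "cring (fun_ring ratfun)"
proof (rule fun_ring_cring)
  fix f assume f: "f \<in> ratfun"
  have "(\<lambda>z. \<ominus> f z) = (\<lambda>z. (\<ominus> \<one>) \<otimes> f z)"
    using f by (auto simp: ratfun_closed l_minus)
  then show "(\<lambda>z. \<ominus> f z) \<in> ratfun" using ratfun_mult[OF const_ratfun f] by simp
qed (auto simp: ratfun_closed const_ratfun ratfun_add ratfun_mult)

lemma null_ratfunE:
  assumes "h \<in> null_ratfun"
  obtains q where "q \<in> polyfun" "\<exists>z. q z \<noteq> \<zero>" "\<And>z. h z \<otimes> q z = \<zero>" "\<And>z. h z \<in> carrier R"
  using assms unfolding null_ratfun_def by fast

lemma null_ratfunI:
  assumes "\<And>z. h z \<in> carrier R" "q \<in> polyfun" "\<exists>z. q z \<noteq> \<zero>" "\<And>z. h z \<otimes> q z = \<zero>"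
  shows "h \<in> null_ratfun"
  unfolding null_ratfun_def using assms by fast

lemma null_ratfun_subset: "null_ratfun \<subseteq> ratfun"
proof
  fix h assume h: "h \<in> null_ratfun"
  obtain q where "q \<in> polyfun" "\<exists>z. q z \<noteq> \<zero>" "\<And>z. h z \<otimes> q z = \<zero>" "\<And>z. h z \<in> carrier R"
    by (rule null_ratfunE[OF h]) (rule that)
  then show "h \<in> ratfun"
    by (intro ratfunI[of _ "\<lambda>z. \<zero>" q] polyfun.const) auto
qed

text \<open>A function annihilated by q stays so after multiplication by any rational function; if q
  annihilates f and p annihilates g, then the nonzero function q p annihilates the sum.\<close>

lemma null_ratfun_ideal: "ideal (null_ratfun :: (('i \<Rightarrow> 'a) \<Rightarrow> 'a) set) (fun_ring ratfun)"
proof -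
  interpret C: cring "fun_ring (ratfun :: (('i \<Rightarrow> 'a) \<Rightarrow> 'a) set)" by (rule ratfun_ring_cring)
  have mult: "(\<lambda>z. f z \<otimes> g z) \<in> null_ratfun" if fn: "f \<in> null_ratfun" and gr: "g \<in> ratfun" for f g :: "('i \<Rightarrow> 'a) \<Rightarrow> 'a"
  proof -
    obtain q where q: "q \<in> polyfun" "\<exists>z. q z \<noteq> \<zero>" "\<And>z. f z \<otimes> q z = \<zero>" and f: "\<And>z. f z \<in> carrier R"
      by (rule null_ratfunE[OF fn]) (rule that)
    have "f z \<otimes> g z \<otimes> q z = \<zero>" for z
    proof -
      have "f z \<otimes> g z \<otimes> q z = g z \<otimes> (f z \<otimes> q z)"
        using f[of z] ratfun_closed[OF gr, of z] polyfun_closed[OF q(1), of z] by (simp add: m_ac)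
      then show ?thesis using q(3) ratfun_closed[OF gr, of z] by simp
    qed
    then show ?thesis using q(1,2) by (intro null_ratfunI[of _ q]) (simp_all add: f ratfun_closed[OF gr])
  qed
  \<comment> \<open>The additive inverse of \<open>fun_ring ratfun\<close> is defined abstractly and
    has to be identified with pointwise negation, here multiplication by the constant
    \<open>\<ominus> \<one>\<close>.\<close>
  have inv: "\<ominus>\<^bsub>fun_ring ratfun\<^esub> f = (\<lambda>z. \<ominus> f z)" if "f \<in> ratfun" for f :: "('i \<Rightarrow> 'a) \<Rightarrow> 'a"
  proof -
    have "(\<lambda>z. \<ominus> f z) = (\<lambda>z. (\<ominus> \<one>) \<otimes> f z)"
      using that by (auto simp: ratfun_closed l_minus)
    then have "(\<lambda>z. \<ominus> f z) \<in> ratfun" using ratfun_mult[OF const_ratfun that] by simp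
    then show ?thesis using that
      by (intro C.minus_equality) (auto simp: ratfun_closed l_neg)
  qed
  show ?thesis
  proof (rule idealI)
    show "subgroup (null_ratfun :: (('i \<Rightarrow> 'a) \<Rightarrow> 'a) set) (add_monoid (fun_ring ratfun))"
    proof (rule C.add.subgroupI)
      show "(null_ratfun :: (('i \<Rightarrow> 'a) \<Rightarrow> 'a) set) \<subseteq> carrier (fun_ring ratfun)" using null_ratfun_subset by simp
      have "(\<lambda>z :: 'i \<Rightarrow> 'a. \<zero>) \<in> null_ratfun" unfolding null_ratfun_def
        using polyfun.const[of \<one>] one_not_zero by (auto intro!: bexI[of _ "\<lambda>z. \<one>"])
      then show "(null_ratfun :: (('i \<Rightarrow> 'a) \<Rightarrow> 'a) set) \<noteq> {}" by blast
    next
      fix f :: "('i \<Rightarrow> 'a) \<Rightarrow> 'a" assume f: "f \<in> null_ratfun"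
      then have "(\<lambda>z. \<ominus> f z) = (\<lambda>z. f z \<otimes> \<ominus> \<one>)"
        by (auto simp: r_minus elim: null_ratfunE)
      then show "\<ominus>\<^bsub>fun_ring ratfun\<^esub> f \<in> null_ratfun"
        using mult[OF f const_ratfun[of "\<ominus> \<one>"]] inv[of f] f null_ratfun_subset
        by (metis a_inv_closed one_closed subsetD)
    next
      fix f g :: "('i \<Rightarrow> 'a) \<Rightarrow> 'a" assume fg: "f \<in> null_ratfun" "g \<in> null_ratfun"
      obtain q where q: "q \<in> polyfun" "\<exists>z. q z \<noteq> \<zero>" "\<And>z. f z \<otimes> q z = \<zero>" and f: "\<And>z. f z \<in> carrier R"
        by (rule null_ratfunE[OF fg(1)]) (rule that)
      obtain p where p: "p \<in> polyfun" "\<exists>z. p z \<noteq> \<zero>" "\<And>z. g z \<otimes> p z = \<zero>" and g: "\<And>z. g z \<in> carrier R"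
        by (rule null_ratfunE[OF fg(2)]) (rule that)
      have "(f z \<oplus> g z) \<otimes> (q z \<otimes> p z) = \<zero>" for z
      proof -
        have "(f z \<oplus> g z) \<otimes> (q z \<otimes> p z) = (f z \<otimes> q z) \<otimes> p z \<oplus> q z \<otimes> (g z \<otimes> p z)"
          using f[of z] g[of z] polyfun_closed[OF p(1), of z] polyfun_closed[OF q(1), of z]
          by (simp add: l_distr r_distr m_ac)
        then show ?thesis using p(3) q(3) polyfun_closed[OF p(1), of z] polyfun_closed[OF q(1), of z] by simp
      qed
      then have "(\<lambda>z. f z \<oplus> g z) \<in> null_ratfun"
        using f g polyfun_nonzero_mult[OF q(1,2) p(1,2)] polyfun.mult[OF q(1) p(1)]
        by (intro null_ratfunI[of _ "\<lambda>z. q z \<otimes> p z"]) auto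
      then show "f \<oplus>\<^bsub>fun_ring ratfun\<^esub> g \<in> null_ratfun" by simp
    qed
  next
    fix f g :: "('i \<Rightarrow> 'a) \<Rightarrow> 'a" assume f: "f \<in> null_ratfun" and g: "g \<in> carrier (fun_ring ratfun)"
    then show "f \<otimes>\<^bsub>fun_ring ratfun\<^esub> g \<in> null_ratfun" using mult by simp
    then show "g \<otimes>\<^bsub>fun_ring ratfun\<^esub> f \<in> null_ratfun"
      using f g C.m_comm[of g f] null_ratfun_subset by auto
  qed (rule C.ring_axioms)
qed

lemma ratfun_class_hom: "ring_hom_cring (fun_ring ratfun) ratfun_field ratfun_class"
  unfolding ratfun_field_def ratfun_class_def
  using ideal.rcos_ring_hom_cring[OF null_ratfun_ideal ratfun_ring_cring] .

lemma ratfun_class_surj: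
  assumes "x \<in> carrier ratfun_field" obtains h where "h \<in> ratfun" "x = ratfun_class h"
proof -
  have "x \<in> (\<Union>h\<in>ratfun. {ratfun_class h})"
    using assms by (simp add: ratfun_field_def ratfun_class_def FactRing_def A_RCOSETS_def')
  then show ?thesis using that by blast
qed

lemma ratfun_class_zero_iff:
  fixes h :: "('i \<Rightarrow> 'a) \<Rightarrow> 'a"
  assumes "h \<in> ratfun"
  shows "ratfun_class h = \<zero>\<^bsub>ratfun_field\<^esub> \<longleftrightarrow> h \<in> null_ratfun"
proof -
  interpret C: cring "fun_ring (ratfun :: (('i \<Rightarrow> 'a) \<Rightarrow> 'a) set)" by (rule ratfun_ring_cring)
  have "abelian_subgroup (null_ratfun :: (('i \<Rightarrow> 'a) \<Rightarrow> 'a) set) (fun_ring ratfun)"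
    by (rule abelian_subgroupI3[OF ideal.axioms(1)[OF null_ratfun_ideal] C.is_abelian_group])
  then have "null_ratfun +>\<^bsub>fun_ring ratfun\<^esub> h = null_ratfun" if "h \<in> null_ratfun"
    by (rule abelian_subgroup.a_rcos_const[OF _ that])
  moreover have "h \<in> null_ratfun" if "null_ratfun +>\<^bsub>fun_ring ratfun\<^esub> h = null_ratfun"
    by (rule ideal.rcos_const_imp_mem[OF null_ratfun_ideal _ that]) (simp add: assms)
  moreover have "\<zero>\<^bsub>ratfun_field\<^esub> = (null_ratfun :: (('i \<Rightarrow> 'a) \<Rightarrow> 'a) set)" by (simp add: ratfun_field_def FactRing_def)
  ultimately show ?thesis unfolding ratfun_class_def by argo
qed

text \<open>The inverse of p/q is q/p: if p were the zero function, q would annihilate the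
  representative and the class would be zero.\<close>

lemma ratfun_field_field: "field (ratfun_field :: (('i \<Rightarrow> 'a) \<Rightarrow> 'a) set ring)"
proof -
  interpret c: ring_hom_cring "fun_ring ratfun" "ratfun_field :: (('i \<Rightarrow> 'a) \<Rightarrow> 'a) set ring" ratfun_class
    by (rule ratfun_class_hom)
  show ?thesis
  proof (rule c.S.cring_fieldI2)
    show "\<zero>\<^bsub>ratfun_field\<^esub> \<noteq> (\<one>\<^bsub>ratfun_field\<^esub> :: (('i \<Rightarrow> 'a) \<Rightarrow> 'a) set)"
    proof
      assume eq: "\<zero>\<^bsub>ratfun_field\<^esub> = (\<one>\<^bsub>ratfun_field\<^esub> :: (('i \<Rightarrow> 'a) \<Rightarrow> 'a) set)"
      have "ratfun_class (\<lambda>z :: 'i \<Rightarrow> 'a. \<one>) = \<one>\<^bsub>ratfun_field\<^esub>" using c.hom_one by simp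
      from trans[OF this eq[symmetric]] have "(\<lambda>z :: 'i \<Rightarrow> 'a. \<one>) \<in> null_ratfun"
        by (rule ratfun_class_zero_iff[THEN iffD1, rotated]) (simp add: const_ratfun)
      then obtain q where "q \<in> polyfun" "\<exists>z :: 'i \<Rightarrow> 'a. q z \<noteq> \<zero>" "\<And>z. \<one> \<otimes> q z = \<zero>"
        by (rule null_ratfunE) (rule that)
      then show False by (auto simp: polyfun_closed)
    qed
  next
    fix x :: "(('i \<Rightarrow> 'a) \<Rightarrow> 'a) set" assume x: "x \<in> carrier ratfun_field" "x \<noteq> \<zero>\<^bsub>ratfun_field\<^esub>"
    obtain h where h: "h \<in> ratfun" "x = ratfun_class h"
      by (rule ratfun_class_surj[OF x(1)])
    obtain p q where pq: "p \<in> polyfun" "q \<in> polyfun" "\<exists>z. q z \<noteq> \<zero>" "\<And>z. h z \<otimes> q z = p z"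
      by (rule ratfunE[OF h(1)]) (rule that)
    have p0: "\<exists>z. p z \<noteq> \<zero>"
    proof (rule ccontr)
      assume "\<not> ?thesis"
      then have "h \<in> null_ratfun" using pq ratfun_closed[OF h(1)] by (intro null_ratfunI[of _ q]) auto
      then show False using x(2) h ratfun_class_zero_iff[OF h(1)] by simp
    qed
    define g where "g z = (if p z = \<zero> then \<zero> else q z \<otimes> inv (p z))" for z
    have gc: "g z \<in> carrier R" for z
      using polyfun_closed[OF pq(1), of z] polyfun_closed[OF pq(2), of z] by (simp add: g_def field_Units)
    \<comment> \<open>The denominator is p^2 and not p: at a zero of p the function g is
      \<open>\<zero>\<close>, so g p = q may fail there, whereas g p^2 = q p holds
      everywhere.\<close>
    have gp: "g z \<otimes> (p z \<otimes> p z) = q z \<otimes> p z" for z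
    proof (cases "p z = \<zero>")
      case True
      then show ?thesis using polyfun_closed[OF pq(2), of z] by (simp add: g_def)
    next
      case False
      have c: "p z \<in> carrier R" "q z \<in> carrier R" "inv (p z) \<in> carrier R" "inv (p z) \<otimes> p z = \<one>"
        using pq False by (auto simp: field_Units polyfun_closed)
      have "q z \<otimes> inv (p z) \<otimes> (p z \<otimes> p z) = q z \<otimes> (inv (p z) \<otimes> p z) \<otimes> p z"
        using c(1-3) by (simp add: m_assoc)
      then show ?thesis using False c by (simp add: g_def)
    qed
    have g: "g \<in> ratfun"
      using gc gp polyfun_nonzero_mult[OF pq(1) p0 pq(1) p0]
      by (intro ratfunI[of _ "\<lambda>z. q z \<otimes> p z" "\<lambda>z. p z \<otimes> p z"]) (auto intro!: polyfun.intros pq)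
    \<comment> \<open>Clearing the denominator gives h g p^2 = h q p = p^2, so p^2 annihilates the
      difference.\<close>
    have hg: "(\<lambda>z. h z \<otimes> g z \<ominus> \<one>) \<in> null_ratfun"
    proof (rule null_ratfunI[of _ "\<lambda>z. p z \<otimes> p z"])
      fix z
      note c = ratfun_closed[OF h(1), of z] gc[of z] polyfun_closed[OF pq(1), of z] polyfun_closed[OF pq(2), of z]
      show "h z \<otimes> g z \<ominus> \<one> \<in> carrier R" using c by simp
      have "(h z \<otimes> g z \<ominus> \<one>) \<otimes> (p z \<otimes> p z) = h z \<otimes> (g z \<otimes> (p z \<otimes> p z)) \<ominus> p z \<otimes> p z"
        using c by algebra
      also have "\<dots> = (h z \<otimes> q z) \<otimes> p z \<ominus> p z \<otimes> p z"
        using c unfolding gp by algebra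
      also have "\<dots> = \<zero>" using c pq(4) by (simp add: r_right_minus_eq)
      finally show "(h z \<otimes> g z \<ominus> \<one>) \<otimes> (p z \<otimes> p z) = \<zero>" .
    qed (use pq p0 polyfun_nonzero_mult[OF pq(1) p0 pq(1) p0] in \<open>auto intro!: polyfun.intros\<close>)
    have "(\<lambda>z. h z \<otimes> g z) = (\<lambda>z. (h z \<otimes> g z \<ominus> \<one>) \<oplus> \<one>)"
    proof
      fix z
      show "h z \<otimes> g z = (h z \<otimes> g z \<ominus> \<one>) \<oplus> \<one>"
        using ratfun_closed[OF h(1), of z] gc[of z] by algebra
    qed
    then have "x \<otimes>\<^bsub>ratfun_field\<^esub> ratfun_class g =
        ratfun_class ((\<lambda>z. h z \<otimes> g z \<ominus> \<one>) \<oplus>\<^bsub>fun_ring ratfun\<^esub> \<one>\<^bsub>fun_ring ratfun\<^esub>)"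
      using c.hom_mult[of h g] h g by simp
    also have "\<dots> = ratfun_class (\<lambda>z. h z \<otimes> g z \<ominus> \<one>) \<oplus>\<^bsub>ratfun_field\<^esub> \<one>\<^bsub>ratfun_field\<^esub>"
      using subsetD[OF null_ratfun_subset hg] c.hom_add[of "\<lambda>z. h z \<otimes> g z \<ominus> \<one>" "\<one>\<^bsub>fun_ring ratfun\<^esub>"] c.hom_one
        c.R.one_closed by (simp only: fun_ring_simps(1))
    also have "\<dots> = \<one>\<^bsub>ratfun_field\<^esub>"
      using ratfun_class_zero_iff[OF subsetD[OF null_ratfun_subset hg]] hg by simp
    finally show "\<exists>y\<in>carrier ratfun_field. x \<otimes>\<^bsub>ratfun_field\<^esub> y = \<one>\<^bsub>ratfun_field\<^esub>"
      using c.hom_closed g by auto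
  qed
qed

end

section \<open>Derivations on fields of fractions\<close>

text \<open>Abstracts from functions: L is the field of fractions of the image of A. Extending a
  derivation relies only on injectivity and on presentations s x = p.\<close>

locale fractions = L: field L + hom: ring_hom_cring A L \<phi>
  for A :: "('a, 'r) ring_scheme" and L :: "('b, 's) ring_scheme" and \<phi> +
  assumes inj: "\<lbrakk>a \<in> carrier A; b \<in> carrier A; \<phi> a = \<phi> b\<rbrakk> \<Longrightarrow> a = b"
    and fraction: "x \<in> carrier L \<Longrightarrow>
      \<exists>s\<in>carrier A. \<exists>p\<in>carrier A. \<phi> s \<noteq> \<zero>\<^bsub>L\<^esub> \<and> \<phi> s \<otimes>\<^bsub>L\<^esub> x = \<phi> p"
begin

text \<open>What differentiating \<open>\<phi> s \<otimes> x = \<phi> p\<close> says about the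
  derivative y of x, with denominators cleared.\<close>

definition quotient_rule :: "('a \<Rightarrow> 'a) \<Rightarrow> 'b \<Rightarrow> 'b \<Rightarrow> 'a \<Rightarrow> 'a \<Rightarrow> bool" where
  "quotient_rule D x y s p \<longleftrightarrow> s \<in> carrier A \<and> p \<in> carrier A \<and> \<phi> s \<noteq> \<zero>\<^bsub>L\<^esub> \<and> \<phi> s \<otimes>\<^bsub>L\<^esub> x = \<phi> p \<and>
     y \<in> carrier L \<and> \<phi> s \<otimes>\<^bsub>L\<^esub> y \<oplus>\<^bsub>L\<^esub> \<phi> (D s) \<otimes>\<^bsub>L\<^esub> x = \<phi> (D p)"

definition frac_der :: "('a \<Rightarrow> 'a) \<Rightarrow> 'b \<Rightarrow> 'b" where
  "frac_der D x = (THE y. \<exists>s p. quotient_rule D x y s p)"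

text \<open>Two presentations s x = p and t x = q give s q = t p, by injectivity already in A, where
  D can be applied. Multiplying the equations for y and y' by t and s then yields s t y = s t
  y'.\<close>

lemma quotient_rule_unique:
  assumes D: "derivation A D" and x: "x \<in> carrier L"
    and "quotient_rule D x y s p" "quotient_rule D x y' t q"
  shows "y = y'"
proof -
  note d = derivationD[OF D]
  have A: "s \<in> carrier A" "p \<in> carrier A" "t \<in> carrier A" "q \<in> carrier A"
    and L: "y \<in> carrier L" "y' \<in> carrier L" and nz: "\<phi> s \<noteq> \<zero>\<^bsub>L\<^esub>" "\<phi> t \<noteq> \<zero>\<^bsub>L\<^esub>"
    and sx: "\<phi> s \<otimes>\<^bsub>L\<^esub> x = \<phi> p" and tx: "\<phi> t \<otimes>\<^bsub>L\<^esub> x = \<phi> q"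
    and sy: "\<phi> s \<otimes>\<^bsub>L\<^esub> y \<oplus>\<^bsub>L\<^esub> \<phi> (D s) \<otimes>\<^bsub>L\<^esub> x = \<phi> (D p)"
    and ty: "\<phi> t \<otimes>\<^bsub>L\<^esub> y' \<oplus>\<^bsub>L\<^esub> \<phi> (D t) \<otimes>\<^bsub>L\<^esub> x = \<phi> (D q)"
    using assms(3,4) by (auto simp: quotient_rule_def)
  note dc = d(1)[OF A(1)] d(1)[OF A(2)] d(1)[OF A(3)] d(1)[OF A(4)]
  note c = hom.hom_closed[OF A(1)] hom.hom_closed[OF A(2)] hom.hom_closed[OF A(3)] hom.hom_closed[OF A(4)]
    hom.hom_closed[OF dc(1)] hom.hom_closed[OF dc(2)] hom.hom_closed[OF dc(3)] hom.hom_closed[OF dc(4)]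
  have "\<phi> (s \<otimes>\<^bsub>A\<^esub> q) = \<phi> (t \<otimes>\<^bsub>A\<^esub> p)"
    using A c x by (simp add: sx[symmetric] tx[symmetric] L.m_ac)
  then have "s \<otimes>\<^bsub>A\<^esub> q = t \<otimes>\<^bsub>A\<^esub> p" by (intro inj) (auto simp: A)
  then have "D (s \<otimes>\<^bsub>A\<^esub> q) = D (t \<otimes>\<^bsub>A\<^esub> p)" by simp
  then have "\<phi> (D (s \<otimes>\<^bsub>A\<^esub> q)) = \<phi> (D (t \<otimes>\<^bsub>A\<^esub> p))" by simp
  then have *: "\<phi> (D s) \<otimes>\<^bsub>L\<^esub> \<phi> q \<oplus>\<^bsub>L\<^esub> \<phi> s \<otimes>\<^bsub>L\<^esub> \<phi> (D q) = \<phi> (D t) \<otimes>\<^bsub>L\<^esub> \<phi> p \<oplus>\<^bsub>L\<^esub> \<phi> t \<otimes>\<^bsub>L\<^esub> \<phi> (D p)"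
    using A dc by (simp add: d)
  \<comment> \<open>The part common to both sides once t D(s) x is rewritten as D(s) q and s D(t) x
    as D(t) p.\<close>
  let ?u = "\<phi> (D s) \<otimes>\<^bsub>L\<^esub> \<phi> q \<oplus>\<^bsub>L\<^esub> \<phi> (D t) \<otimes>\<^bsub>L\<^esub> \<phi> p"
  have "?u \<oplus>\<^bsub>L\<^esub> \<phi> s \<otimes>\<^bsub>L\<^esub> \<phi> t \<otimes>\<^bsub>L\<^esub> y = \<phi> (D t) \<otimes>\<^bsub>L\<^esub> \<phi> p \<oplus>\<^bsub>L\<^esub> \<phi> t \<otimes>\<^bsub>L\<^esub> (\<phi> s \<otimes>\<^bsub>L\<^esub> y \<oplus>\<^bsub>L\<^esub> \<phi> (D s) \<otimes>\<^bsub>L\<^esub> x)"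
    using c x L by (simp add: tx[symmetric] L.r_distr L.m_ac L.a_ac)
  also have "\<dots> = \<phi> (D s) \<otimes>\<^bsub>L\<^esub> \<phi> q \<oplus>\<^bsub>L\<^esub> \<phi> s \<otimes>\<^bsub>L\<^esub> (\<phi> t \<otimes>\<^bsub>L\<^esub> y' \<oplus>\<^bsub>L\<^esub> \<phi> (D t) \<otimes>\<^bsub>L\<^esub> x)"
    unfolding sy ty using * by simp
  also have "\<dots> = ?u \<oplus>\<^bsub>L\<^esub> \<phi> s \<otimes>\<^bsub>L\<^esub> \<phi> t \<otimes>\<^bsub>L\<^esub> y'"
    using c x L by (simp add: sx[symmetric] L.r_distr L.m_ac L.a_ac)
  finally have "\<phi> s \<otimes>\<^bsub>L\<^esub> \<phi> t \<otimes>\<^bsub>L\<^esub> y = \<phi> s \<otimes>\<^bsub>L\<^esub> \<phi> t \<otimes>\<^bsub>L\<^esub> y'"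
    using c x L by simp
  then show ?thesis using c L nz L.m_lcancel[of "\<phi> s \<otimes>\<^bsub>L\<^esub> \<phi> t" y y'] L.integral_iff by auto
qed

lemma frac_der_eqI:
  assumes "derivation A D" "x \<in> carrier L" "quotient_rule D x y s p"
  shows "frac_der D x = y"
  unfolding frac_der_def using assms quotient_rule_unique by blast

text \<open>Dividing by \<open>\<phi> s\<close> solves the quotient rule for y, and uniqueness
  identifies y with \<open>frac_der D x\<close>. Hence every presentation of x may be used, not just
  a chosen one.\<close>

lemma frac_der_rule:
  assumes D: "derivation A D" and x: "x \<in> carrier L"
    and s: "s \<in> carrier A" "p \<in> carrier A" "\<phi> s \<noteq> \<zero>\<^bsub>L\<^esub>" "\<phi> s \<otimes>\<^bsub>L\<^esub> x = \<phi> p"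
  shows "quotient_rule D x (frac_der D x) s p"
proof -
  let ?y = "inv\<^bsub>L\<^esub> \<phi> s \<otimes>\<^bsub>L\<^esub> (\<phi> (D p) \<ominus>\<^bsub>L\<^esub> \<phi> (D s) \<otimes>\<^bsub>L\<^esub> x)"
  note dc = derivationD(1)[OF D s(1)] derivationD(1)[OF D s(2)]
  note c = hom.hom_closed[OF s(1)] hom.hom_closed[OF s(2)] hom.hom_closed[OF dc(1)] hom.hom_closed[OF dc(2)]
  have i: "inv\<^bsub>L\<^esub> \<phi> s \<in> carrier L" "\<phi> s \<otimes>\<^bsub>L\<^esub> inv\<^bsub>L\<^esub> \<phi> s = \<one>\<^bsub>L\<^esub>"
    using s c by (auto simp: L.field_Units)
  have "\<phi> s \<otimes>\<^bsub>L\<^esub> ?y = (\<phi> s \<otimes>\<^bsub>L\<^esub> inv\<^bsub>L\<^esub> \<phi> s) \<otimes>\<^bsub>L\<^esub> (\<phi> (D p) \<ominus>\<^bsub>L\<^esub> \<phi> (D s) \<otimes>\<^bsub>L\<^esub> x)"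
    using c i(1) x by (simp add: L.m_assoc)
  also have "\<dots> = \<phi> (D p) \<ominus>\<^bsub>L\<^esub> \<phi> (D s) \<otimes>\<^bsub>L\<^esub> x" unfolding i(2) using c x by simp
  finally have "\<phi> s \<otimes>\<^bsub>L\<^esub> ?y \<oplus>\<^bsub>L\<^esub> \<phi> (D s) \<otimes>\<^bsub>L\<^esub> x = \<phi> (D p)"
    using c x by (simp add: a_minus_def L.a_assoc L.l_neg)
  then have "quotient_rule D x ?y s p" unfolding quotient_rule_def using s c i x by simp
  with frac_der_eqI[OF D x this] show ?thesis by simp
qed

lemma frac_der_hom:
  assumes D: "derivation A D" and a: "a \<in> carrier A"
  shows "frac_der D (\<phi> a) = \<phi> (D a)"
proof (rule frac_der_eqI[OF D])
  \<comment> \<open>The presentation of \<open>\<phi> a\<close> has denominator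
    \<open>\<one>\<close>, whose derivative must vanish; Leibniz on \<one> = \<one> \<cdot> \<one>
    gives this.\<close>
  have "D \<one>\<^bsub>A\<^esub> = D \<one>\<^bsub>A\<^esub> \<oplus>\<^bsub>A\<^esub> D \<one>\<^bsub>A\<^esub>"
    using derivationD(3)[OF D hom.R.one_closed hom.R.one_closed] derivationD(1)[OF D hom.R.one_closed] by simp
  then have "D \<one>\<^bsub>A\<^esub> = \<zero>\<^bsub>A\<^esub>"
    using derivationD(1)[OF D hom.R.one_closed] by (metis hom.R.add.l_cancel_one')
  then show "quotient_rule D (\<phi> a) (\<phi> (D a)) \<one>\<^bsub>A\<^esub> a"
    unfolding quotient_rule_def using a derivationD(1)[OF D a] by simp
qed (use a in auto)

text \<open>From s x = p and t y = q come the presentations with denominator s t and numerators p t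
  + s q for the sum and p q for the product; the quotient rule for them expands into the two given
  ones.\<close>

lemma frac_der_derivation:
  assumes D: "derivation A D"
  shows "derivation L (frac_der D)"
  unfolding derivation_def
proof (intro conjI ballI)
  note d = derivationD[OF D]
  fix x assume x: "x \<in> carrier L"
  obtain s p where sp: "s \<in> carrier A" "p \<in> carrier A" "\<phi> s \<noteq> \<zero>\<^bsub>L\<^esub>" "\<phi> s \<otimes>\<^bsub>L\<^esub> x = \<phi> p"
    using fraction[OF x] by blast
  have r: "\<phi> s \<otimes>\<^bsub>L\<^esub> frac_der D x \<oplus>\<^bsub>L\<^esub> \<phi> (D s) \<otimes>\<^bsub>L\<^esub> x = \<phi> (D p)" and xc: "frac_der D x \<in> carrier L"
    using frac_der_rule[OF D x sp] by (auto simp: quotient_rule_def)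
  show "frac_der D x \<in> carrier L" by (rule xc)
  fix y assume y: "y \<in> carrier L"
  obtain t q where tq: "t \<in> carrier A" "q \<in> carrier A" "\<phi> t \<noteq> \<zero>\<^bsub>L\<^esub>" "\<phi> t \<otimes>\<^bsub>L\<^esub> y = \<phi> q"
    using fraction[OF y] by blast
  have r': "\<phi> t \<otimes>\<^bsub>L\<^esub> frac_der D y \<oplus>\<^bsub>L\<^esub> \<phi> (D t) \<otimes>\<^bsub>L\<^esub> y = \<phi> (D q)" and yc: "frac_der D y \<in> carrier L"
    using frac_der_rule[OF D y tq] by (auto simp: quotient_rule_def)
  note dc = d(1)[OF sp(1)] d(1)[OF sp(2)] d(1)[OF tq(1)] d(1)[OF tq(2)]
  note c = hom.hom_closed[OF sp(1)] hom.hom_closed[OF tq(1)]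
    hom.hom_closed[OF dc(1)] hom.hom_closed[OF dc(3)]
  have nz: "\<phi> (s \<otimes>\<^bsub>A\<^esub> t) \<noteq> \<zero>\<^bsub>L\<^esub>" using sp tq by (simp add: L.integral_iff)
  show "frac_der D (x \<oplus>\<^bsub>L\<^esub> y) = frac_der D x \<oplus>\<^bsub>L\<^esub> frac_der D y"
  proof (rule frac_der_eqI[OF D])
    show "quotient_rule D (x \<oplus>\<^bsub>L\<^esub> y) (frac_der D x \<oplus>\<^bsub>L\<^esub> frac_der D y) (s \<otimes>\<^bsub>A\<^esub> t) (p \<otimes>\<^bsub>A\<^esub> t \<oplus>\<^bsub>A\<^esub> s \<otimes>\<^bsub>A\<^esub> q)"
      unfolding quotient_rule_def
    proof (intro conjI nz)
      show "\<phi> (s \<otimes>\<^bsub>A\<^esub> t) \<otimes>\<^bsub>L\<^esub> (x \<oplus>\<^bsub>L\<^esub> y) = \<phi> (p \<otimes>\<^bsub>A\<^esub> t \<oplus>\<^bsub>A\<^esub> s \<otimes>\<^bsub>A\<^esub> q)"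
        using c x y sp tq by (simp add: sp(4)[symmetric] tq(4)[symmetric] L.r_distr L.m_ac)
      show "\<phi> (s \<otimes>\<^bsub>A\<^esub> t) \<otimes>\<^bsub>L\<^esub> (frac_der D x \<oplus>\<^bsub>L\<^esub> frac_der D y) \<oplus>\<^bsub>L\<^esub> \<phi> (D (s \<otimes>\<^bsub>A\<^esub> t)) \<otimes>\<^bsub>L\<^esub> (x \<oplus>\<^bsub>L\<^esub> y) =
        \<phi> (D (p \<otimes>\<^bsub>A\<^esub> t \<oplus>\<^bsub>A\<^esub> s \<otimes>\<^bsub>A\<^esub> q))"
        using c x y xc yc sp(1,2) tq(1,2) dc
        by (simp add: d r[symmetric] r'[symmetric] sp(4)[symmetric] tq(4)[symmetric] L.r_distr L.l_distr L.m_ac L.a_ac)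
    qed (use sp tq x y xc yc in auto)
  qed (use x y in auto)
  show "frac_der D (x \<otimes>\<^bsub>L\<^esub> y) = frac_der D x \<otimes>\<^bsub>L\<^esub> y \<oplus>\<^bsub>L\<^esub> x \<otimes>\<^bsub>L\<^esub> frac_der D y"
  proof (rule frac_der_eqI[OF D])
    show "quotient_rule D (x \<otimes>\<^bsub>L\<^esub> y) (frac_der D x \<otimes>\<^bsub>L\<^esub> y \<oplus>\<^bsub>L\<^esub> x \<otimes>\<^bsub>L\<^esub> frac_der D y) (s \<otimes>\<^bsub>A\<^esub> t) (p \<otimes>\<^bsub>A\<^esub> q)"
      unfolding quotient_rule_def
    proof (intro conjI nz)
      show "\<phi> (s \<otimes>\<^bsub>A\<^esub> t) \<otimes>\<^bsub>L\<^esub> (x \<otimes>\<^bsub>L\<^esub> y) = \<phi> (p \<otimes>\<^bsub>A\<^esub> q)"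
        using c x y sp tq by (simp add: sp(4)[symmetric] tq(4)[symmetric] L.m_ac)
      show "\<phi> (s \<otimes>\<^bsub>A\<^esub> t) \<otimes>\<^bsub>L\<^esub> (frac_der D x \<otimes>\<^bsub>L\<^esub> y \<oplus>\<^bsub>L\<^esub> x \<otimes>\<^bsub>L\<^esub> frac_der D y) \<oplus>\<^bsub>L\<^esub> \<phi> (D (s \<otimes>\<^bsub>A\<^esub> t)) \<otimes>\<^bsub>L\<^esub> (x \<otimes>\<^bsub>L\<^esub> y) =
        \<phi> (D (p \<otimes>\<^bsub>A\<^esub> q))"
        using c x y xc yc sp(1,2) tq(1,2) dc
        by (simp add: d r[symmetric] r'[symmetric] sp(4)[symmetric] tq(4)[symmetric] L.r_distr L.l_distr L.m_ac L.a_ac)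
    qed (use sp tq x y xc yc in auto)
  qed (use x y in auto)
qed

text \<open>Differentiating s D(x) + D(s) x = D(p) by E, and likewise with D and E exchanged, gives
  equal right sides because D and E commute on A. All terms on the left match except s E(D(x)) and s
  D(E(x)), and s can be cancelled.\<close>

lemma frac_der_commute:
  assumes D: "derivation A D" and E: "derivation A E"
    and comm: "\<And>a. a \<in> carrier A \<Longrightarrow> D (E a) = E (D a)" and x: "x \<in> carrier L"
  shows "frac_der D (frac_der E x) = frac_der E (frac_der D x)"
proof -
  obtain s p where sp: "s \<in> carrier A" "p \<in> carrier A" "\<phi> s \<noteq> \<zero>\<^bsub>L\<^esub>" "\<phi> s \<otimes>\<^bsub>L\<^esub> x = \<phi> p"
    using fraction[OF x] by blast
  have *: "\<phi> (E s) \<otimes>\<^bsub>L\<^esub> frac_der D x \<oplus>\<^bsub>L\<^esub> \<phi> s \<otimes>\<^bsub>L\<^esub> frac_der E (frac_der D x) \<oplus>\<^bsub>L\<^esub>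
      (\<phi> (E (D s)) \<otimes>\<^bsub>L\<^esub> x \<oplus>\<^bsub>L\<^esub> \<phi> (D s) \<otimes>\<^bsub>L\<^esub> frac_der E x) = \<phi> (E (D p))"
    if D: "derivation A D" and E: "derivation A E" for D E
  proof -
    note e = derivationD[OF frac_der_derivation[OF E]]
    have r: "\<phi> s \<otimes>\<^bsub>L\<^esub> frac_der D x \<oplus>\<^bsub>L\<^esub> \<phi> (D s) \<otimes>\<^bsub>L\<^esub> x = \<phi> (D p)" and xc: "frac_der D x \<in> carrier L"
      using frac_der_rule[OF D x sp] by (auto simp: quotient_rule_def)
    have dc: "D s \<in> carrier A" "D p \<in> carrier A" using sp derivationD(1)[OF D] by auto
    have "frac_der E (\<phi> s \<otimes>\<^bsub>L\<^esub> frac_der D x \<oplus>\<^bsub>L\<^esub> \<phi> (D s) \<otimes>\<^bsub>L\<^esub> x) = \<phi> (E (D p))"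
      unfolding r using frac_der_hom[OF E dc(2)] .
    then show ?thesis using xc sp(1,2) dc x
      by (simp add: e frac_der_hom[OF E])
  qed
  have c: "\<phi> s \<in> carrier L" "\<phi> (D s) \<in> carrier L" "\<phi> (E s) \<in> carrier L" "\<phi> (E (D s)) \<in> carrier L"
    using sp(1) derivationD(1)[OF D] derivationD(1)[OF E] by auto
  have y: "frac_der D x \<in> carrier L" "frac_der E x \<in> carrier L"
      "frac_der D (frac_der E x) \<in> carrier L" "frac_der E (frac_der D x) \<in> carrier L"
    using x derivationD(1)[OF frac_der_derivation[OF D]] derivationD(1)[OF frac_der_derivation[OF E]]
    by blast+
  let ?u = "\<phi> (E s) \<otimes>\<^bsub>L\<^esub> frac_der D x \<oplus>\<^bsub>L\<^esub> (\<phi> (E (D s)) \<otimes>\<^bsub>L\<^esub> x \<oplus>\<^bsub>L\<^esub> \<phi> (D s) \<otimes>\<^bsub>L\<^esub> frac_der E x)"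
  have u: "?u \<in> carrier L" using c x y by simp
  have "?u \<oplus>\<^bsub>L\<^esub> \<phi> s \<otimes>\<^bsub>L\<^esub> frac_der D (frac_der E x) =
      \<phi> (D s) \<otimes>\<^bsub>L\<^esub> frac_der E x \<oplus>\<^bsub>L\<^esub> \<phi> s \<otimes>\<^bsub>L\<^esub> frac_der D (frac_der E x) \<oplus>\<^bsub>L\<^esub>
      (\<phi> (E (D s)) \<otimes>\<^bsub>L\<^esub> x \<oplus>\<^bsub>L\<^esub> \<phi> (E s) \<otimes>\<^bsub>L\<^esub> frac_der D x)"
    using c x y by (simp add: L.a_ac)
  also have "\<dots> = \<phi> (E (D p))"
    using *[OF E D] unfolding comm[OF sp(1)] comm[OF sp(2)] .
  also have "\<dots> = \<phi> (E s) \<otimes>\<^bsub>L\<^esub> frac_der D x \<oplus>\<^bsub>L\<^esub> \<phi> s \<otimes>\<^bsub>L\<^esub> frac_der E (frac_der D x) \<oplus>\<^bsub>L\<^esub>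
      (\<phi> (E (D s)) \<otimes>\<^bsub>L\<^esub> x \<oplus>\<^bsub>L\<^esub> \<phi> (D s) \<otimes>\<^bsub>L\<^esub> frac_der E x)"
    using *[OF D E] by (rule sym)
  also have "\<dots> = ?u \<oplus>\<^bsub>L\<^esub> \<phi> s \<otimes>\<^bsub>L\<^esub> frac_der E (frac_der D x)"
    using c x y by (simp add: L.a_ac)
  finally have "\<phi> s \<otimes>\<^bsub>L\<^esub> frac_der D (frac_der E x) = \<phi> s \<otimes>\<^bsub>L\<^esub> frac_der E (frac_der D x)"
    by (rule L.add.l_cancel) (use u c y in simp_all)
  then show ?thesis using sp(3) c y by (simp add: L.m_lcancel)
qed

end

context infinite_field
begin

text \<open>Injectivity holds because a polynomial function annihilated by a nonzero one is zero,
  the polynomial functions forming a domain.\<close>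

lemma ratfun_field_fractions:
  "fractions (fun_ring polyfun) (ratfun_field :: (('i \<Rightarrow> 'a) \<Rightarrow> 'a) set ring) ratfun_class"
proof -
  let ?L = "ratfun_field :: (('i \<Rightarrow> 'a) \<Rightarrow> 'a) set ring"
  let ?P = "polyfun :: (('i \<Rightarrow> 'a) \<Rightarrow> 'a) set"
  interpret c: ring_hom_cring "fun_ring ratfun" ?L ratfun_class
    by (rule ratfun_class_hom)
  interpret L: field ?L by (rule ratfun_field_field)
  interpret P: cring "fun_ring ?P" by (rule polyfun_ring_cring)
  have sub: "p \<in> carrier (fun_ring ratfun)" if "p \<in> ?P" for p
    using that polyfun_ratfun by auto
  have hom: "ratfun_class \<in> ring_hom (fun_ring ?P) ?L"
  proof (rule ring_hom_memI)
    fix p q assume p: "p \<in> carrier (fun_ring ?P)"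
    then show "ratfun_class p \<in> carrier ?L" using sub c.hom_closed by simp
    assume q: "q \<in> carrier (fun_ring ?P)"
    show "ratfun_class (p \<otimes>\<^bsub>fun_ring ?P\<^esub> q) = ratfun_class p \<otimes>\<^bsub>?L\<^esub> ratfun_class q"
      using c.hom_mult[of p q] sub p q by simp
    show "ratfun_class (p \<oplus>\<^bsub>fun_ring ?P\<^esub> q) = ratfun_class p \<oplus>\<^bsub>?L\<^esub> ratfun_class q"
      using c.hom_add[of p q] sub p q by simp
  next
    show "ratfun_class \<one>\<^bsub>fun_ring ?P\<^esub> = \<one>\<^bsub>?L\<^esub>" using c.hom_one by simp
  qed
  interpret h: ring_hom_cring "fun_ring ?P" ?L ratfun_class
    by unfold_locales (rule hom)
  have zero: "p = (\<lambda>z. \<zero>)" if "p \<in> ?P" "ratfun_class p = \<zero>\<^bsub>?L\<^esub>" for p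
  proof (rule ccontr)
    assume "p \<noteq> (\<lambda>z. \<zero>)"
    then have p: "\<exists>z. p z \<noteq> \<zero>" by auto
    have "p \<in> null_ratfun" using that ratfun_class_zero_iff[of p] sub by simp
    then obtain q where q: "q \<in> polyfun" "\<exists>z. q z \<noteq> \<zero>" "\<And>z. p z \<otimes> q z = \<zero>"
      by (rule null_ratfunE) (rule that)
    show False using polyfun_nonzero_mult[OF that(1) p q(1,2)] q(3) by simp
  qed
  show ?thesis
  proof (unfold_locales)
    fix p q assume p: "p \<in> carrier (fun_ring ?P)" and q: "q \<in> carrier (fun_ring ?P)"
      and eq: "ratfun_class p = ratfun_class q"
    have "ratfun_class (p \<ominus>\<^bsub>fun_ring ?P\<^esub> q) = ratfun_class p \<ominus>\<^bsub>?L\<^esub> ratfun_class q"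
      using h.hom_add[OF p P.a_inv_closed[OF q]] h.hom_a_inv[OF q] by (simp only: a_minus_def)
    also have "\<dots> = \<zero>\<^bsub>?L\<^esub>" using eq p q h.hom_closed by (simp add: c.S.r_right_minus_eq)
    finally have "p \<ominus>\<^bsub>fun_ring ?P\<^esub> q = \<zero>\<^bsub>fun_ring ?P\<^esub>"
      using zero[of "p \<ominus>\<^bsub>fun_ring ?P\<^esub> q"] P.minus_closed[OF p q] by simp
    then show "p = q" using p q P.r_right_minus_eq by blast
  next
    fix x assume "x \<in> carrier ?L"
    then obtain h where h: "h \<in> ratfun" "x = ratfun_class h"
      by (rule ratfun_class_surj)
    obtain p q where pq: "p \<in> polyfun" "q \<in> polyfun" "\<exists>z. q z \<noteq> \<zero>" "\<And>z. h z \<otimes> q z = p z"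
      by (rule ratfunE[OF h(1)]) (rule that)
    have "q \<otimes>\<^bsub>fun_ring ratfun\<^esub> h = p"
      using pq ratfun_closed[OF h(1)] polyfun_closed[OF pq(2)] by (auto simp: m_comm)
    then have "ratfun_class q \<otimes>\<^bsub>?L\<^esub> x = ratfun_class p"
      using c.hom_mult[of q h] h sub[OF pq(2)] by simp
    moreover have "ratfun_class q \<noteq> \<zero>\<^bsub>?L\<^esub>" using zero[OF pq(2)] pq(3) by auto
    ultimately show "\<exists>s\<in>carrier (fun_ring ?P). \<exists>p\<in>carrier (fun_ring ?P).
        ratfun_class s \<noteq> \<zero>\<^bsub>?L\<^esub> \<and> ratfun_class s \<otimes>\<^bsub>?L\<^esub> x = ratfun_class p"
      using pq by - (rule bexI[of _ q], rule bexI[of _ p], simp_all)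
  qed
qed

end

section \<open>The differential field of rational functions\<close>

sublocale diff_field \<subseteq> infinite_field K
  by unfold_locales (rule infinite_carrier)

context diff_field
begin

lemma der_derivation: "i < m \<Longrightarrow> derivation K (der K i)"
  by (simp add: derivation_def der_closed der_add der_mult)

text \<open>The commutator of two derivations is again a derivation, so it vanishes once it vanishes
  on generators: on constants by commutativity in K, on coordinates by \<open>comm\<close>.\<close>

lemma polyder_commute:
  assumes ij: "i < m" "j < m" and b: "\<And>i a. i < m \<Longrightarrow> b i a \<in> polyfun"
    and comm: "\<And>a. polyder (der K i) (b i) (b j a) = polyder (der K j) (b j) (b i a)"
    and f: "f \<in> polyfun"
  shows "polyder (der K i) (b i) (polyder (der K j) (b j) f) = polyder (der K j) (b j) (polyder (der K i) (b i) f)"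
  using f
proof (induction rule: polyfun.induct)
  case (const c)
  then show ?case
    by (simp add: polyder_const[OF der_derivation[OF ij(1)] b[OF ij(1)]]
        polyder_const[OF der_derivation[OF ij(2)] b[OF ij(2)]] ij der_closed der_commute)
next
  case (coord a)
  show ?case
    by (simp add: polyder_coord[OF der_derivation[OF ij(1)] b[OF ij(1)]]
        polyder_coord[OF der_derivation[OF ij(2)] b[OF ij(2)]] comm)
next
  case (add f g)
  have c: "polyder (der K i) (b i) h \<in> polyfun" "polyder (der K j) (b j) h \<in> polyfun" if "h \<in> polyfun" for h
    using that derivationD(1)[OF polyder_derivation[OF der_derivation b]] ij by auto
  show ?case
    using add by (simp add: polyder_add[OF der_derivation[OF ij(1)] b[OF ij(1)]]
        polyder_add[OF der_derivation[OF ij(2)] b[OF ij(2)]] c)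
next
  case (mult f g)
  have c: "polyder (der K i) (b i) h \<in> polyfun" "polyder (der K j) (b j) h \<in> polyfun" if "h \<in> polyfun" for h
    using that derivationD(1)[OF polyder_derivation[OF der_derivation b]] ij by auto
  have cc: "polyder (der K i) (b i) h z \<in> carrier K" "polyder (der K j) (b j) h z \<in> carrier K"
    "polyder (der K i) (b i) (polyder (der K j) (b j) h) z \<in> carrier K"
    "polyder (der K j) (b j) (polyder (der K i) (b i) h) z \<in> carrier K" if "h \<in> polyfun" for h z
    using that c polyfun_closed by blast+
  show ?case
    using mult by (simp add: polyder_mult[OF der_derivation[OF ij(1)] b[OF ij(1)]]
        polyder_mult[OF der_derivation[OF ij(2)] b[OF ij(2)]]
        polyder_add[OF der_derivation[OF ij(1)] b[OF ij(1)]]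
        polyder_add[OF der_derivation[OF ij(2)] b[OF ij(2)]] c polyfun.mult)
      (simp add: cc polyfun_closed a_ac)
qed

definition ratfun_diff_field :: "(nat \<Rightarrow> 'i \<Rightarrow> ('i \<Rightarrow> 'a) \<Rightarrow> 'a) \<Rightarrow> (('i \<Rightarrow> 'a) \<Rightarrow> 'a) set diff_ring" where
  "ratfun_diff_field b = \<lparr>carrier = carrier ratfun_field, monoid.mult = monoid.mult ratfun_field,
     one = one ratfun_field, zero = zero ratfun_field, add = add ratfun_field,
     der = (\<lambda>i. fractions.frac_der (fun_ring polyfun) ratfun_field ratfun_class (polyder (der K i) (b i)))\<rparr>"

lemma ratfun_diff_field_simps [simp]:
  "carrier (ratfun_diff_field b) = carrier ratfun_field"
  "monoid.mult (ratfun_diff_field b) = monoid.mult ratfun_field"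
  "one (ratfun_diff_field b) = one ratfun_field"
  "zero (ratfun_diff_field b) = zero ratfun_field"
  "add (ratfun_diff_field b) = add ratfun_field"
  by (simp_all add: ratfun_diff_field_def)

lemma ratfun_diff_field_field:
  fixes b :: "nat \<Rightarrow> 'i \<Rightarrow> ('i \<Rightarrow> 'a) \<Rightarrow> 'a"
  shows "field (ratfun_diff_field b)"
proof -
  interpret R: field "ratfun_field :: (('i \<Rightarrow> 'a) \<Rightarrow> 'a) set ring" by (rule ratfun_field_field)
  \<comment> \<open>The two records share their operations but differ in type, so the field axioms
    are carried over along the identity.\<close>
  have "(\<lambda>x. x) \<in> ring_iso ratfun_field (ratfun_diff_field b)"
    by (simp add: ring_iso_def ring_hom_def bij_betw_def)
  from R.ring_iso_imp_img_field[OF this] show ?thesis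
    by (simp add: ratfun_diff_field_def[of b])
qed

lemma ratfun_class_diff_hom:
  fixes b :: "nat \<Rightarrow> 'i \<Rightarrow> ('i \<Rightarrow> 'a) \<Rightarrow> 'a"
  shows "ring_hom_cring (fun_ring ratfun) (ratfun_diff_field b) ratfun_class"
proof -
  interpret c: ring_hom_cring "fun_ring (ratfun :: (('i \<Rightarrow> 'a) \<Rightarrow> 'a) set)" ratfun_field ratfun_class
    by (rule ratfun_class_hom)
  interpret L: field "ratfun_diff_field b" by (rule ratfun_diff_field_field)
  show ?thesis
    by unfold_locales (use c.homh in \<open>simp add: ring_hom_def\<close>)
qed

lemma ratfun_diff_field_ext:
  fixes b :: "nat \<Rightarrow> 'i \<Rightarrow> ('i \<Rightarrow> 'a) \<Rightarrow> 'a"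
  assumes b: "\<And>i a. i < m \<Longrightarrow> b i a \<in> polyfun"
    and comm: "\<And>i j a. i < m \<Longrightarrow> j < m \<Longrightarrow>
      polyder (der K i) (b i) (b j a) = polyder (der K j) (b j) (b i a)"
  shows "diff_field_ext m K (ratfun_diff_field b) (\<lambda>c. ratfun_class (\<lambda>z. c))"
    and "\<And>i p. i < m \<Longrightarrow> p \<in> polyfun \<Longrightarrow>
      der (ratfun_diff_field b) i (ratfun_class p) = ratfun_class (polyder (der K i) (b i) p)"
proof -
  let ?L = "ratfun_diff_field b"
  interpret F: fractions "fun_ring polyfun" "ratfun_field :: (('i \<Rightarrow> 'a) \<Rightarrow> 'a) set ring" ratfun_class
    by (rule ratfun_field_fractions)
  interpret L: field ?L by (rule ratfun_diff_field_field)
  have der: "der ?L i = F.frac_der (polyder (der K i) (b i))" for i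
    by (simp add: ratfun_diff_field_def)
  note pd = polyder_derivation[OF der_derivation b]
  show hom: "der ?L i (ratfun_class p) = ratfun_class (polyder (der K i) (b i) p)"
    if "i < m" "p \<in> polyfun" for i p
    using F.frac_der_hom[OF pd] that by (simp add: der)
  let ?\<iota> = "\<lambda>c. ratfun_class (\<lambda>z :: 'i \<Rightarrow> 'a. c)"
  interpret c: ring_hom_cring "fun_ring ratfun" ?L ratfun_class by (rule ratfun_class_diff_hom)
  have \<iota>: "?\<iota> \<in> ring_hom K ?L"
  proof (rule ring_hom_memI)
    fix x y assume x: "x \<in> carrier K"
    show "?\<iota> x \<in> carrier ?L" by (rule c.hom_closed) (simp add: x const_ratfun)
    assume y: "y \<in> carrier K"
    show "?\<iota> (x \<otimes> y) = ?\<iota> x \<otimes>\<^bsub>?L\<^esub> ?\<iota> y"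
      using c.hom_mult[of "\<lambda>z. x" "\<lambda>z. y"] x y by (simp add: const_ratfun)
    show "?\<iota> (x \<oplus> y) = ?\<iota> x \<oplus>\<^bsub>?L\<^esub> ?\<iota> y"
      using c.hom_add[of "\<lambda>z. x" "\<lambda>z. y"] x y by (simp add: const_ratfun)
  next
    show "?\<iota> \<one> = \<one>\<^bsub>?L\<^esub>" using c.hom_one by simp
  qed
  interpret \<iota>: ring_hom_cring K ?L ?\<iota> by unfold_locales (rule \<iota>)
  have pow: "?\<iota> ([n] \<cdot> \<one>) = [n] \<cdot>\<^bsub>?L\<^esub> \<one>\<^bsub>?L\<^esub>" for n :: nat
    using \<iota>.hom_zero \<iota>.hom_add \<iota>.hom_one by (induction n) (simp_all del: ratfun_diff_field_simps)
  have "diff_field ?L m"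
  proof
    show "1 \<le> m" by (rule m_pos)
    show "[n] \<cdot>\<^bsub>?L\<^esub> \<one>\<^bsub>?L\<^esub> \<noteq> \<zero>\<^bsub>?L\<^esub>" if "0 < n" for n :: nat
    proof
      assume "[n] \<cdot>\<^bsub>?L\<^esub> \<one>\<^bsub>?L\<^esub> = \<zero>\<^bsub>?L\<^esub>"
      \<comment> \<open>A multiple of one is the class of a constant function, and polynomial
        functions with equal classes are equal; so characteristic zero is inherited from K.\<close>
      then have "ratfun_class (\<lambda>z. [n] \<cdot> \<one>) = ratfun_class (\<lambda>z :: 'i \<Rightarrow> 'a. \<zero>)"
        using pow[of n] \<iota>.hom_zero by simp
      then have "(\<lambda>z :: 'i \<Rightarrow> 'a. [n] \<cdot> \<one>) = (\<lambda>z. \<zero>)"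
        by (rule F.inj[rotated -1]) (auto intro!: polyfun.const)
      then show False using char_zero[OF that] by (metis (full_types))
    qed
    fix i x y assume i: "i < m"
    note d = derivationD[OF F.frac_der_derivation[OF pd[OF i i]]]
    assume x: "x \<in> carrier ?L"
    then show "der ?L i x \<in> carrier ?L" using d(1) by (simp add: der)
    assume y: "y \<in> carrier ?L"
    show "der ?L i (x \<oplus>\<^bsub>?L\<^esub> y) = der ?L i x \<oplus>\<^bsub>?L\<^esub> der ?L i y"
      "der ?L i (x \<otimes>\<^bsub>?L\<^esub> y) = der ?L i x \<otimes>\<^bsub>?L\<^esub> y \<oplus>\<^bsub>?L\<^esub> x \<otimes>\<^bsub>?L\<^esub> der ?L i y"
      using x y d(2,3) by (simp_all add: der)
  next
    fix i j x assume ij: "i < m" "j < m" and x: "x \<in> carrier ?L"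
    show "der ?L i (der ?L j x) = der ?L j (der ?L i x)"
      unfolding der
    proof (rule F.frac_der_commute)
      show "derivation (fun_ring polyfun) (polyder (der K i) (b i))"
        "derivation (fun_ring polyfun) (polyder (der K j) (b j))"
        using pd ij by auto
      show "x \<in> carrier ratfun_field" using x by simp
      show "polyder (der K i) (b i) (polyder (der K j) (b j) f) = polyder (der K j) (b j) (polyder (der K i) (b i) f)"
        if "f \<in> carrier (fun_ring polyfun)" for f
        using that by (intro polyder_commute ij b comm) simp_all
    qed
  qed
  moreover have "?\<iota> (der K i x) = der ?L i (?\<iota> x)" if "i < m" "x \<in> carrier K" for i x
    using that hom[OF that(1) polyfun.const[OF that(2)]] polyder_const[OF der_derivation[OF that(1)] b[OF that(1)] that(2)]
    by simp
  ultimately show "diff_field_ext m K ?L ?\<iota>"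
    unfolding diff_field_ext_def using \<iota> diff_field_axioms by blast
qed

section \<open>Existential closedness of K in the rational function field\<close>

text \<open>Each member vanishes wherever its annihilating polynomial does not, and the product of
  finitely many nonzero polynomial functions is nonzero somewhere.\<close>

lemma null_ratfun_common_zero:
  fixes F :: "'f \<Rightarrow> ('i \<Rightarrow> 'a) \<Rightarrow> 'a"
  assumes "finite S" "\<And>f. f \<in> S \<Longrightarrow> F f \<in> null_ratfun"
  shows "\<exists>z. \<forall>f\<in>S. F f z = \<zero>"
proof -
  have "\<exists>q\<in>polyfun. (\<exists>z. q z \<noteq> \<zero>) \<and> (\<forall>z. q z \<noteq> \<zero> \<longrightarrow> (\<forall>f\<in>S. F f z = \<zero>))"
    using assms
  proof (induction S rule: finite_induct)
    case empty
    then show ?case by (intro bexI[of _ "\<lambda>z. \<one>"] polyfun.const) auto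
  next
    case (insert f S)
    then obtain q where q: "q \<in> polyfun" "\<exists>z. q z \<noteq> \<zero>" "\<And>z g. q z \<noteq> \<zero> \<Longrightarrow> g \<in> S \<Longrightarrow> F g z = \<zero>"
      by (metis insertCI)
    have "F f \<in> null_ratfun" using insert.prems by simp
    then obtain p where p: "p \<in> polyfun" "\<exists>z. p z \<noteq> \<zero>" "\<And>z. F f z \<otimes> p z = \<zero>" "\<And>z. F f z \<in> carrier K"
      by (rule null_ratfunE) (rule that)
    have "F g z = \<zero>" if "p z \<otimes> q z \<noteq> \<zero>" "g \<in> insert f S" for z g
    proof -
      have "p z \<noteq> \<zero>" "q z \<noteq> \<zero>" using that(1) polyfun_closed[OF p(1), of z] polyfun_closed[OF q(1), of z] by auto
      then show ?thesis using that(2) q(3) integral[OF p(3)[of z] p(4)] polyfun_closed[OF p(1), of z] by auto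
    qed
    then show ?case using polyfun_nonzero_mult[OF p(1,2) q(1,2)] polyfun.mult[OF p(1) q(1)]
      by (intro bexI[of _ "\<lambda>z. p z \<otimes> q z"]) auto
  qed
  then show ?thesis by blast
qed

text \<open>Inserting representatives h of the solution into an equation gives a representative of
  zero. At a common zero z of these finitely many functions the values \<open>h j z\<close> solve
  the system, as evaluation at z is a ring homomorphism.\<close>

lemma ratfun_diff_field_ec:
  fixes b :: "nat \<Rightarrow> 'i \<Rightarrow> ('i \<Rightarrow> 'a) \<Rightarrow> 'a"
  shows "ec_as_field K (ratfun_diff_field b) (\<lambda>c. ratfun_class (\<lambda>z. c))"
  unfolding ec_as_field_def
proof (intro allI impI, elim conjE bexE)
  let ?L = "ratfun_diff_field b"
  let ?\<iota> = "\<lambda>c. ratfun_class (\<lambda>z :: 'i \<Rightarrow> 'a. c)"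
  let ?R = "fun_ring (ratfun :: (('i \<Rightarrow> 'a) \<Rightarrow> 'a) set)"
  interpret L: field ?L by (rule ratfun_diff_field_field)
  interpret c: ring_hom_cring ?R ?L ratfun_class
    by (rule ratfun_class_diff_hom)
  fix k :: nat and S x
  assume fin: "finite S" and S: "S \<subseteq> carrier (mpoly_ring K {..<k})"
    and x: "x \<in> {..<k} \<rightarrow> carrier ?L" and sol: "\<forall>f\<in>S. mpoly_eval K ?L ?\<iota> x f = \<zero>\<^bsub>?L\<^esub>"
  \<comment> \<open>A representative is chosen for every j, arbitrary for j \<ge> k, so that h is
    rational at all indices.\<close>
  have "\<exists>h. h \<in> ratfun \<and> (j < k \<longrightarrow> x j = ratfun_class h)" for j
  proof (cases "j < k")
    case True
    then have "x j \<in> carrier ratfun_field" using x by auto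
    then show ?thesis by (rule ratfun_class_surj) blast
  qed (use const_ratfun in blast)
  then obtain h where h: "\<And>j. h j \<in> ratfun" "\<And>j. j < k \<Longrightarrow> x j = ratfun_class (h j)" by metis
  let ?F = "\<lambda>f. mpoly_eval K ?R (\<lambda>c z. c) h f"
  have Fc: "?F f \<in> ratfun" if "f \<in> S" for f
  proof -
    have fc: "f \<in> carrier (mpoly_ring K {..<k})" using S that by blast
    have "?F f \<in> carrier ?R"
      unfolding mpoly_eval_def
      by (intro c.R.finsum_closed Pi_I c.R.m_closed c.R.finprod_closed c.R.nat_pow_closed)
        (simp_all add: h const_ratfun mpoly_carrier_coeff(1)[OF ring_axioms fc])
    then show ?thesis by simp
  qed
  have "?F f \<in> null_ratfun" if f: "f \<in> S" for f
  proof -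
    have fc: "f \<in> carrier (mpoly_ring K {..<k})" using S f by blast
    have "ratfun_class (?F f) = mpoly_eval K ?L (ratfun_class \<circ> (\<lambda>c z. c)) (ratfun_class \<circ> h) f"
      by (rule hom_mpoly_eval[OF ratfun_class_diff_hom])
        (simp_all add: h const_ratfun mpoly_carrier_coeff(1)[OF ring_axioms fc])
    also have "\<dots> = mpoly_eval K ?L ?\<iota> (ratfun_class \<circ> h) f" by (simp add: o_def)
    also have "\<dots> = mpoly_eval K ?L ?\<iota> x f"
      using c.hom_closed[of "h _"] c.hom_closed[of "\<lambda>z. _"]
      by (intro mpoly_eval_cong[OF ring_axioms L.cring_axioms fc]) (simp_all add: h const_ratfun)
    also have "\<dots> = \<zero>\<^bsub>?L\<^esub>" using sol f by blast
    finally show ?thesis using ratfun_class_zero_iff[OF Fc[OF f]] by simp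
  qed
  then obtain z where z: "\<And>f. f \<in> S \<Longrightarrow> ?F f z = \<zero>"
    using null_ratfun_common_zero[OF fin, of ?F] by blast
  have ev: "ring_hom_cring ?R K (\<lambda>h. h z)"
    by unfold_locales (auto simp: ring_hom_def ratfun_closed)
  have "mpoly_eval K K id (\<lambda>j. h j z) f = \<zero>" if f: "f \<in> S" for f
  proof -
    have fc: "f \<in> carrier (mpoly_ring K {..<k})" using S f by blast
    have "?F f z = mpoly_eval K K ((\<lambda>h. h z) \<circ> (\<lambda>c z. c)) ((\<lambda>h. h z) \<circ> h) f"
      by (rule hom_mpoly_eval[OF ev])
        (simp_all add: h const_ratfun mpoly_carrier_coeff(1)[OF ring_axioms fc])
    then show ?thesis using z[OF f] by (simp add: o_def id_def)
  qed
  then show "\<exists>x\<in>{..<k} \<rightarrow> carrier K. \<forall>f\<in>S. mpoly_eval K K id x f = \<zero>"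
    by (intro bexI[of _ "\<lambda>j. h j z"]) (auto simp: ratfun_closed h)
qed

end

section \<open>Evaluation of linear differential polynomials\<close>

definition mpoly_monom :: "('b, 's) ring_scheme \<Rightarrow> ('c \<Rightarrow> 'b) \<Rightarrow> 'c multiset \<Rightarrow> 'b" where
  "mpoly_monom L x u = (\<Otimes>\<^bsub>L\<^esub>i\<in>set_mset u. x i [^]\<^bsub>L\<^esub> count u i)"

text \<open>Finite support is what allows the sum in \<open>mpoly_eval\<close> to be taken over a
  larger finite index set.\<close>

lemma (in ring) indexed_pset_finite_support:
  assumes "P \<in> indexed_pset I (carrier R)"
  shows "finite {u. P u \<noteq> \<zero>}"
  using assms
proof (induction rule: indexed_pset.induct)
  case (indexed_const k)
  show ?case by (rule finite_subset[of _ "{{#}}"]) (auto simp: indexed_const_def)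
next
  case (indexed_padd P Q)
  have "{u. indexed_padd P Q u \<noteq> \<zero>} \<subseteq> {u. P u \<noteq> \<zero>} \<union> {u. Q u \<noteq> \<zero>}"
    by (auto simp: indexed_padd_def)
  then show ?case by (rule finite_subset) (use indexed_padd in simp)
next
  case (indexed_pmult P i)
  have "{u. indexed_pmult P i u \<noteq> \<zero>} \<subseteq> add_mset i ` {u. P u \<noteq> \<zero>}"
  proof
    fix u assume "u \<in> {u. indexed_pmult P i u \<noteq> \<zero>}"
    then have "i \<in># u" "P (u - {#i#}) \<noteq> \<zero>" by (auto simp: indexed_pmult_def split: if_splits)
    then show "u \<in> add_mset i ` {u. P u \<noteq> \<zero>}"
      by (intro image_eqI[of _ _ "u - {#i#}"]) auto
  qed
  then show ?case by (rule finite_subset) (use indexed_pmult in simp)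
qed

locale mpoly_point = ring_hom_cring K L \<iota> for K (structure) and L (structure) and \<iota> +
  fixes x :: "'v \<Rightarrow> _" and I :: "'v set"
  assumes point: "i \<in> I \<Longrightarrow> x i \<in> carrier L"
begin

lemma mpoly_monom_closed: "set_mset u \<subseteq> I \<Longrightarrow> mpoly_monom L x u \<in> carrier L"
  unfolding mpoly_monom_def using point by (intro S.finprod_closed) auto

lemma mpoly_monom_add_mset:
  assumes "i \<in> I" "set_mset u \<subseteq> I"
  shows "mpoly_monom L x (add_mset i u) = x i \<otimes>\<^bsub>L\<^esub> mpoly_monom L x u"
proof -
  have c: "x j \<in> carrier L" if "j \<in> insert i (set_mset u)" for j using that assms point by auto
  \<comment> \<open>The product over the other variables; i is split off explicitly because it may
    or may not already occur in u.\<close>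
  let ?P = "\<Otimes>\<^bsub>L\<^esub>j\<in>set_mset u - {i}. x j [^]\<^bsub>L\<^esub> count u j"
  have P: "?P \<in> carrier L" using c by (intro S.finprod_closed) auto
  have "mpoly_monom L x (add_mset i u) = (\<Otimes>\<^bsub>L\<^esub>j\<in>insert i (set_mset u - {i}). x j [^]\<^bsub>L\<^esub> count (add_mset i u) j)"
    unfolding mpoly_monom_def by simp
  also have "\<dots> = x i [^]\<^bsub>L\<^esub> Suc (count u i) \<otimes>\<^bsub>L\<^esub> (\<Otimes>\<^bsub>L\<^esub>j\<in>set_mset u - {i}. x j [^]\<^bsub>L\<^esub> count (add_mset i u) j)"
    using c by (subst S.finprod_insert) auto
  also have "(\<Otimes>\<^bsub>L\<^esub>j\<in>set_mset u - {i}. x j [^]\<^bsub>L\<^esub> count (add_mset i u) j) = ?P"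
    using c by (intro S.finprod_cong') auto
  also have "x i [^]\<^bsub>L\<^esub> Suc (count u i) \<otimes>\<^bsub>L\<^esub> ?P = x i \<otimes>\<^bsub>L\<^esub> (x i [^]\<^bsub>L\<^esub> count u i \<otimes>\<^bsub>L\<^esub> ?P)"
    using c P by (simp add: S.m_ac)
  also have "x i [^]\<^bsub>L\<^esub> count u i \<otimes>\<^bsub>L\<^esub> ?P = mpoly_monom L x u"
  proof (cases "i \<in># u")
    case True
    have "mpoly_monom L x u = (\<Otimes>\<^bsub>L\<^esub>j\<in>insert i (set_mset u - {i}). x j [^]\<^bsub>L\<^esub> count u j)"
      unfolding mpoly_monom_def using True by (simp add: insert_absorb)
    also have "\<dots> = x i [^]\<^bsub>L\<^esub> count u i \<otimes>\<^bsub>L\<^esub> ?P"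
      using c by (subst S.finprod_insert) auto
    finally show ?thesis by simp
  next
    case False
    then show ?thesis using P by (simp add: mpoly_monom_def not_in_iff)
  qed
  finally show ?thesis .
qed

text \<open>Cancellation can make the support of a sum smaller than those of its summands, so
  evaluations are compared over a common finite index set.\<close>

lemma mpoly_eval_superset:
  assumes P: "P \<in> carrier (mpoly_ring K I)" and U: "finite U" "\<And>u. P u \<noteq> \<zero>\<^bsub>K\<^esub> \<Longrightarrow> u \<in> U"
    "\<And>u. u \<in> U \<Longrightarrow> set_mset u \<subseteq> I"
  shows "mpoly_eval K L \<iota> x P = (\<Oplus>\<^bsub>L\<^esub>u\<in>U. \<iota> (P u) \<otimes>\<^bsub>L\<^esub> mpoly_monom L x u)"
  unfolding mpoly_eval_def mpoly_monom_def[symmetric]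
  using U mpoly_carrier_coeff(1)[OF R.ring_axioms P]
  by (intro S.add.finprod_mono_neutral_cong_left)
    (auto intro!: S.m_closed mpoly_monom_closed hom_closed simp: mpoly_monom_closed)

lemma mpoly_eval_const:
  assumes "c \<in> carrier K"
  shows "mpoly_eval K L \<iota> x (R.indexed_const c) = \<iota> c"
proof -
  have "R.indexed_const c \<in> carrier (mpoly_ring K I)"
    by (simp add: mpoly_ring_def R.indexed_pset.indexed_const assms)
  then have "mpoly_eval K L \<iota> x (R.indexed_const c) =
      (\<Oplus>\<^bsub>L\<^esub>u\<in>{{#}}. \<iota> (R.indexed_const c u) \<otimes>\<^bsub>L\<^esub> mpoly_monom L x u)"
    by (rule mpoly_eval_superset) (auto simp: R.indexed_const_def split: if_splits)
  then show ?thesis using assms by (simp add: R.indexed_const_def mpoly_monom_def)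
qed

lemma mpoly_eval_padd:
  assumes P: "P \<in> carrier (mpoly_ring K I)" and Q: "Q \<in> carrier (mpoly_ring K I)"
  shows "mpoly_eval K L \<iota> x (R.indexed_padd P Q) = mpoly_eval K L \<iota> x P \<oplus>\<^bsub>L\<^esub> mpoly_eval K L \<iota> x Q"
proof -
  define U where "U = {u. P u \<noteq> \<zero>\<^bsub>K\<^esub>} \<union> {u. Q u \<noteq> \<zero>\<^bsub>K\<^esub>}"
  have fin: "finite U" unfolding U_def
    using R.indexed_pset_finite_support[of P I] R.indexed_pset_finite_support[of Q I] P Q
    by (simp add: mpoly_ring_def)
  have sub: "set_mset u \<subseteq> I" if "u \<in> U" for u
    using that mpoly_carrier_coeff(2)[OF R.ring_axioms P] mpoly_carrier_coeff(2)[OF R.ring_axioms Q] by (auto simp: U_def)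
  have mc: "mpoly_monom L x u \<in> carrier L" if "u \<in> U" for u
    using mpoly_monom_closed[OF sub[OF that]] .
  note c = mpoly_carrier_coeff(1)[OF R.ring_axioms P] mpoly_carrier_coeff(1)[OF R.ring_axioms Q]
  have PQ: "R.indexed_padd P Q \<in> carrier (mpoly_ring K I)"
    using P Q by (simp add: mpoly_ring_def R.indexed_pset.indexed_padd)
  have "mpoly_eval K L \<iota> x (R.indexed_padd P Q) =
      (\<Oplus>\<^bsub>L\<^esub>u\<in>U. \<iota> (R.indexed_padd P Q u) \<otimes>\<^bsub>L\<^esub> mpoly_monom L x u)"
    by (rule mpoly_eval_superset[OF PQ fin _ sub]) (auto simp: R.indexed_padd_def U_def)
  also have "\<dots> = (\<Oplus>\<^bsub>L\<^esub>u\<in>U. \<iota> (P u) \<otimes>\<^bsub>L\<^esub> mpoly_monom L x u \<oplus>\<^bsub>L\<^esub> \<iota> (Q u) \<otimes>\<^bsub>L\<^esub> mpoly_monom L x u)"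
    using mc
    by (intro S.finsum_cong') (auto simp: R.indexed_padd_def c S.l_distr)
  also have "\<dots> = (\<Oplus>\<^bsub>L\<^esub>u\<in>U. \<iota> (P u) \<otimes>\<^bsub>L\<^esub> mpoly_monom L x u) \<oplus>\<^bsub>L\<^esub> (\<Oplus>\<^bsub>L\<^esub>u\<in>U. \<iota> (Q u) \<otimes>\<^bsub>L\<^esub> mpoly_monom L x u)"
    using mc by (intro S.finsum_addf) (auto simp: c)
  also have "(\<Oplus>\<^bsub>L\<^esub>u\<in>U. \<iota> (P u) \<otimes>\<^bsub>L\<^esub> mpoly_monom L x u) = mpoly_eval K L \<iota> x P"
    by (rule mpoly_eval_superset[OF P fin _ sub, symmetric]) (auto simp: U_def)
  also have "(\<Oplus>\<^bsub>L\<^esub>u\<in>U. \<iota> (Q u) \<otimes>\<^bsub>L\<^esub> mpoly_monom L x u) = mpoly_eval K L \<iota> x Q"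
    by (rule mpoly_eval_superset[OF Q fin _ sub, symmetric]) (auto simp: U_def)
  finally show ?thesis .
qed

lemma mpoly_eval_pmult:
  assumes P: "P \<in> carrier (mpoly_ring K I)" and i: "i \<in> I"
  shows "mpoly_eval K L \<iota> x (R.indexed_pmult P i) = mpoly_eval K L \<iota> x P \<otimes>\<^bsub>L\<^esub> x i"
proof -
  define U where "U = {u. P u \<noteq> \<zero>\<^bsub>K\<^esub>}"
  have fin: "finite U" unfolding U_def
    using R.indexed_pset_finite_support[of P I] P by (simp add: mpoly_ring_def)
  have sub: "set_mset u \<subseteq> I" if "u \<in> U" for u
    using that mpoly_carrier_coeff(2)[OF R.ring_axioms P] by (auto simp: U_def)
  have mc: "mpoly_monom L x u \<in> carrier L" if "u \<in> U" for u
    using mpoly_monom_closed[OF sub[OF that]] .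
  have xi: "x i \<in> carrier L" by (rule point[OF i])
  have ma: "mpoly_monom L x (add_mset i u) = x i \<otimes>\<^bsub>L\<^esub> mpoly_monom L x u" if "u \<in> U" for u
    by (rule mpoly_monom_add_mset[OF i sub[OF that]])
  note c = mpoly_carrier_coeff(1)[OF R.ring_axioms P]
  have PQ: "R.indexed_pmult P i \<in> carrier (mpoly_ring K I)"
    using P i by (simp add: mpoly_ring_def R.indexed_pset.indexed_pmult)
  have v: "R.indexed_pmult P i (add_mset i u) = P u" for u by (simp add: R.indexed_pmult_def)
  have "mpoly_eval K L \<iota> x (R.indexed_pmult P i) =
      (\<Oplus>\<^bsub>L\<^esub>u\<in>add_mset i ` U. \<iota> (R.indexed_pmult P i u) \<otimes>\<^bsub>L\<^esub> mpoly_monom L x u)"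
  proof (rule mpoly_eval_superset[OF PQ])
    show "u \<in> add_mset i ` U" if "R.indexed_pmult P i u \<noteq> \<zero>\<^bsub>K\<^esub>" for u
      using that by (intro image_eqI[of _ _ "u - {#i#}"]) (auto simp: R.indexed_pmult_def U_def split: if_splits)
    show "set_mset u \<subseteq> I" if "u \<in> add_mset i ` U" for u using that subsetD[OF sub] i by auto
  qed (use fin in simp)
  also have "\<dots> = (\<Oplus>\<^bsub>L\<^esub>u\<in>U. \<iota> (R.indexed_pmult P i (add_mset i u)) \<otimes>\<^bsub>L\<^esub> mpoly_monom L x (add_mset i u))"
    by (intro S.finsum_reindex) (auto simp: inj_on_def ma mc xi c v)
  also have "\<dots> = (\<Oplus>\<^bsub>L\<^esub>u\<in>U. \<iota> (P u) \<otimes>\<^bsub>L\<^esub> mpoly_monom L x u \<otimes>\<^bsub>L\<^esub> x i)"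
    by (intro S.finsum_cong') (simp_all add: c v ma mc xi S.m_ac)
  also have "\<dots> = (\<Oplus>\<^bsub>L\<^esub>u\<in>U. \<iota> (P u) \<otimes>\<^bsub>L\<^esub> mpoly_monom L x u) \<otimes>\<^bsub>L\<^esub> x i"
    by (intro S.finsum_ldistr[symmetric] fin) (auto simp: c mc xi)
  also have "(\<Oplus>\<^bsub>L\<^esub>u\<in>U. \<iota> (P u) \<otimes>\<^bsub>L\<^esub> mpoly_monom L x u) = mpoly_eval K L \<iota> x P"
    by (rule mpoly_eval_superset[OF P fin _ sub, symmetric]) (auto simp: U_def)
  finally show ?thesis .
qed

end

context ring
begin

text \<open>The form c_0 X_(v 0) + ... + c_(n-1) X_(v (n-1)). The recursion uses the constructors of
  \<open>indexed_pset\<close>, so membership and evaluation follow by induction on n.\<close>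

primrec lin_poly :: "(nat \<Rightarrow> 'a) \<Rightarrow> (nat \<Rightarrow> 'v) \<Rightarrow> nat \<Rightarrow> 'v multiset \<Rightarrow> 'a" where
  "lin_poly c v 0 = indexed_const \<zero>"
| "lin_poly c v (Suc n) = indexed_padd (lin_poly c v n) (indexed_pmult (indexed_const (c n)) (v n))"

lemma mpoly_carrier_intros:
  shows mpoly_const: "c \<in> carrier R \<Longrightarrow> indexed_const c \<in> carrier (mpoly_ring R I)"
    and mpoly_padd: "\<lbrakk>P \<in> carrier (mpoly_ring R I); Q \<in> carrier (mpoly_ring R I)\<rbrakk> \<Longrightarrow>
      indexed_padd P Q \<in> carrier (mpoly_ring R I)"
    and mpoly_pmult: "\<lbrakk>P \<in> carrier (mpoly_ring R I); i \<in> I\<rbrakk> \<Longrightarrow> indexed_pmult P i \<in> carrier (mpoly_ring R I)"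
  by (simp_all add: mpoly_ring_def indexed_pset.intros)

lemma mpoly_lin_poly:
  assumes "\<And>l. l < n \<Longrightarrow> c l \<in> carrier R" "\<And>l. l < n \<Longrightarrow> v l \<in> I"
  shows "lin_poly c v n \<in> carrier (mpoly_ring R I)"
  using assms by (induction n) (auto intro!: mpoly_carrier_intros)

end

lemma (in mpoly_point) mpoly_eval_lin_poly:
  assumes "\<And>l. l < n \<Longrightarrow> c l \<in> carrier K" "\<And>l. l < n \<Longrightarrow> v l \<in> I"
  shows "mpoly_eval K L \<iota> x (R.lin_poly c v n) = (\<Oplus>\<^bsub>L\<^esub>l\<in>{..<n}. \<iota> (c l) \<otimes>\<^bsub>L\<^esub> x (v l))"
  using assms
proof (induction n)
  case 0
  then show ?case by (simp add: mpoly_eval_const)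
next
  case (Suc n)
  have m: "R.lin_poly c v n \<in> carrier (mpoly_ring K I)" "R.indexed_const (c n) \<in> carrier (mpoly_ring K I)"
    using Suc.prems by (auto intro!: R.mpoly_lin_poly R.mpoly_const)
  have "mpoly_eval K L \<iota> x (R.lin_poly c v (Suc n)) =
     (\<Oplus>\<^bsub>L\<^esub>l\<in>{..<n}. \<iota> (c l) \<otimes>\<^bsub>L\<^esub> x (v l)) \<oplus>\<^bsub>L\<^esub> \<iota> (c n) \<otimes>\<^bsub>L\<^esub> x (v n)"
    using Suc m by (simp add: mpoly_eval_padd mpoly_eval_pmult mpoly_eval_const R.mpoly_pmult)
  also have "\<dots> = (\<Oplus>\<^bsub>L\<^esub>l\<in>{..<Suc n}. \<iota> (c l) \<otimes>\<^bsub>L\<^esub> x (v l))"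
    using Suc.prems point unfolding lessThan_Suc
    by (subst S.finsum_insert) (auto intro!: S.a_comm S.finsum_closed)
  finally show ?case .
qed

lemma der_power_empty: "der_power m L {#} y = y"
proof -
  have "foldr (\<lambda>i g. (der L i ^^ count {#} i) \<circ> g) xs id y = y" for xs
    by (induction xs) auto
  then show ?thesis by (simp add: der_power_def)
qed

lemma der_power_single:
  assumes "i < m" shows "der_power m L {#i#} y = der L i y"
proof -
  \<comment> \<open>In a list without repetitions i is met at most once, so the derivation is
    applied once and not several times.\<close>
  have "foldr (\<lambda>j g. (der L j ^^ count {#i#} j) \<circ> g) xs id y = (if i \<in> set xs then der L i y else y)"
    if "distinct xs" for xs
    using that by (induction xs) auto
  from this[of "[0..<m]"] show ?thesis using assms by (simp add: der_power_def)
qed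

section \<open>Solution vectors\<close>

lemma (in abelian_monoid) finsum_swap:
  assumes "finite I" "finite J" "\<And>i j. i \<in> I \<Longrightarrow> j \<in> J \<Longrightarrow> f i j \<in> carrier G"
  shows "(\<Oplus>i\<in>I. \<Oplus>j\<in>J. f i j) = (\<Oplus>j\<in>J. \<Oplus>i\<in>I. f i j)"
  using assms(1,3)
proof (induction I rule: finite_induct)
  case empty
  then show ?case by (simp add: finsum_zero)
next
  case (insert x I)
  have "(\<Oplus>i\<in>insert x I. \<Oplus>j\<in>J. f i j) = (\<Oplus>j\<in>J. f x j) \<oplus> (\<Oplus>j\<in>J. \<Oplus>i\<in>I. f i j)"
    using insert by (subst finsum_insert) (auto intro!: finsum_closed)
  also have "\<dots> = (\<Oplus>j\<in>J. f x j \<oplus> (\<Oplus>i\<in>I. f i j))"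
    using insert by (intro finsum_addf[symmetric]) (auto intro!: finsum_closed)
  also have "\<dots> = (\<Oplus>j\<in>J. \<Oplus>i\<in>insert x I. f i j)"
    using insert by (intro finsum_cong') (auto intro!: finsum_closed)
  finally show ?case .
qed

lemma (in abelian_monoid) a_swap4:
  "\<lbrakk>a \<in> carrier G; b \<in> carrier G; c \<in> carrier G; d \<in> carrier G\<rbrakk> \<Longrightarrow>
    (a \<oplus> b) \<oplus> (c \<oplus> d) = (a \<oplus> c) \<oplus> (b \<oplus> d)"
  by (simp add: a_ac)

section \<open>Linear forms and the generic linear system\<close>

definition (in ring) linfun :: "nat \<Rightarrow> (nat \<Rightarrow> 'a) \<Rightarrow> (nat \<Rightarrow> 'a) \<Rightarrow> 'a" where
  "linfun n c z = (\<Oplus>l\<in>{..<n}. c l \<otimes> coord l z)"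

context diff_field
begin

lemma linfun_polyfun:
  assumes "\<And>l. l < n \<Longrightarrow> c l \<in> carrier K"
  shows "linfun n c \<in> polyfun"
  unfolding linfun_def using assms by (intro polyfun_finsum) (auto intro!: polyfun.intros)

lemma linfun_Suc:
  assumes "\<And>l. l < Suc n \<Longrightarrow> c l \<in> carrier K"
  shows "linfun (Suc n) c = (\<lambda>z. linfun n c z \<oplus> c n \<otimes> coord n z)"
proof
  fix z
  show "linfun (Suc n) c z = linfun n c z \<oplus> c n \<otimes> coord n z"
    unfolding linfun_def lessThan_Suc using assms
    by (subst finsum_insert) (auto intro!: a_comm finsum_closed)
qed

text \<open>Leibniz in each summand: one sum collects the derivatives of the coefficients, the other
  those of the coordinates.\<close>

lemma polyder_linfun:
  assumes i: "i < m" and b: "\<And>a. b a \<in> polyfun" and c: "\<And>l. l < n \<Longrightarrow> c l \<in> carrier K"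
  shows "polyder (der K i) b (linfun n c) = (\<lambda>z. linfun n (\<lambda>l. der K i (c l)) z \<oplus> (\<Oplus>l\<in>{..<n}. c l \<otimes> b l z))"
  using c
proof (induction n)
  case 0
  have "der K i \<zero> = \<zero>" by (rule derivation_zero[OF der_derivation[OF i]])
  then show ?case using polyder_const[OF der_derivation[OF i] b zero_closed] by (simp add: linfun_def)
next
  case (Suc n)
  note pd = der_derivation[OF i] b
  have cn: "c n \<in> carrier K" "der K i (c n) \<in> carrier K" using Suc.prems[of n] i by (simp_all add: der_closed)
  have s: "linfun n c \<in> polyfun" "(\<lambda>z. c n) \<in> polyfun" "coord n \<in> polyfun"
    using Suc.prems by (simp_all add: linfun_polyfun polyfun.const polyfun.coord)
  have IH: "polyder (der K i) b (linfun n c) =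
     (\<lambda>z. linfun n (\<lambda>l. der K i (c l)) z \<oplus> (\<Oplus>l\<in>{..<n}. c l \<otimes> b l z))"
    using Suc.prems by (intro Suc.IH) simp
  have lS: "linfun (Suc n) c = (\<lambda>z. linfun n c z \<oplus> c n \<otimes> coord n z)"
    by (rule linfun_Suc) (rule Suc.prems)
  have "polyder (der K i) b (linfun (Suc n) c) =
     (\<lambda>z. polyder (der K i) b (linfun n c) z \<oplus> (der K i (c n) \<otimes> coord n z \<oplus> c n \<otimes> b n z))"
    unfolding lS polyder_add[OF pd s(1) polyfun.mult[OF s(2,3)]]
      polyder_mult[OF pd s(2,3)] polyder_const[OF pd cn(1)] polyder_coord[OF pd] ..
  also have "\<dots> = (\<lambda>z. linfun n (\<lambda>l. der K i (c l)) z \<oplus> (\<Oplus>l\<in>{..<n}. c l \<otimes> b l z)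
      \<oplus> (der K i (c n) \<otimes> coord n z \<oplus> c n \<otimes> b n z))"
    unfolding IH ..
  also have "\<dots> = (\<lambda>z. linfun (Suc n) (\<lambda>l. der K i (c l)) z \<oplus> (\<Oplus>l\<in>{..<Suc n}. c l \<otimes> b l z))"
  proof
    fix z
    have bz: "b l z \<in> carrier K" for l by (rule polyfun_closed[OF b])
    have dc: "der K i (c l) \<in> carrier K" if "l < Suc n" for l using Suc.prems that i by (simp add: der_closed)
    have S: "(\<Oplus>l\<in>{..<n}. c l \<otimes> b l z) \<in> carrier K" using Suc.prems bz by (intro finsum_closed) auto
    have "linfun n (\<lambda>l. der K i (c l)) \<in> polyfun" by (rule linfun_polyfun) (simp add: dc)
    then have lc: "linfun n (\<lambda>l. der K i (c l)) z \<in> carrier K" by (rule polyfun_closed)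
    have lS': "linfun (Suc n) (\<lambda>l. der K i (c l)) = (\<lambda>z. linfun n (\<lambda>l. der K i (c l)) z \<oplus> der K i (c n) \<otimes> coord n z)"
      by (rule linfun_Suc) (rule dc)
    have S': "(\<Oplus>l\<in>{..<Suc n}. c l \<otimes> b l z) = (\<Oplus>l\<in>{..<n}. c l \<otimes> b l z) \<oplus> c n \<otimes> b n z"
      unfolding lessThan_Suc using Suc.prems bz by (subst finsum_insert) (auto intro!: a_comm finsum_closed)
    show "linfun n (\<lambda>l. der K i (c l)) z \<oplus> (\<Oplus>l\<in>{..<n}. c l \<otimes> b l z)
      \<oplus> (der K i (c n) \<otimes> coord n z \<oplus> c n \<otimes> b n z) =
      linfun (Suc n) (\<lambda>l. der K i (c l)) z \<oplus> (\<Oplus>l\<in>{..<Suc n}. c l \<otimes> b l z)"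
      unfolding S' lS' by (rule a_swap4) (use S lc cn bz[of n] in simp_all)
  qed
  finally show ?case .
qed

text \<open>Integrability rearranged without subtraction as \<delta>_i A_j + A_j A_i = \<delta>_j
  A_i + A_i A_j. The left side is the matrix obtained when \<delta>_i is applied to A_j x for a
  solution x.\<close>

definition integrable_entries :: "nat \<Rightarrow> (nat \<Rightarrow> nat \<times> nat \<Rightarrow> 'a) \<Rightarrow> bool" where
  "integrable_entries n A \<longleftrightarrow> (\<forall>i<m. \<forall>a<n. \<forall>l<n. A i (a, l) \<in> carrier K) \<and>
    (\<forall>i<m. \<forall>j<m. \<forall>a<n. \<forall>l<n.
       der K i (A j (a, l)) \<oplus> (\<Oplus>k\<in>{..<n}. A j (a, k) \<otimes> A i (k, l)) =
       der K j (A i (a, l)) \<oplus> (\<Oplus>k\<in>{..<n}. A i (a, k) \<otimes> A j (k, l)))"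

text \<open>Row a of A_i x, the prescribed derivative of coordinate a. Points are indexed by all
  natural numbers, so there are variables beyond the first n; these are made constants.\<close>

definition generic_der :: "nat \<Rightarrow> (nat \<Rightarrow> nat \<times> nat \<Rightarrow> 'a) \<Rightarrow> nat \<Rightarrow> nat \<Rightarrow> (nat \<Rightarrow> 'a) \<Rightarrow> 'a" where
  "generic_der n A i a = (if a < n then linfun n (\<lambda>l. A i (a, l)) else (\<lambda>z. \<zero>))"

lemma generic_der_polyfun:
  "\<lbrakk>integrable_entries n A; i < m\<rbrakk> \<Longrightarrow> generic_der n A i a \<in> polyfun"
  by (auto simp: generic_der_def integrable_entries_def intro!: linfun_polyfun polyfun.const)

text \<open>Applying \<delta>_i to row a of A_j x gives row a of (\<delta>_i A_j + A_j A_i) x, after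
  an exchange of summations; integrability makes this symmetric in i and j.\<close>

lemma generic_der_commute:
  assumes A: "integrable_entries n A" and ij: "i < m" "j < m"
  shows "polyder (der K i) (generic_der n A i) (generic_der n A j a) =
    polyder (der K j) (generic_der n A j) (generic_der n A i a)"
proof (cases "a < n")
  case False
  have "polyder (der K i) (generic_der n A i) (\<lambda>z. \<zero>) = (\<lambda>z. \<zero>)" if "i < m" for i
    using polyder_const[OF der_derivation[OF that] generic_der_polyfun[OF A that] zero_closed]
      derivation_zero[OF der_derivation[OF that]] by simp
  then show ?thesis using False ij by (simp add: generic_der_def)
next
  case True
  have Ac: "A i (a, l) \<in> carrier K" if "i < m" "a < n" "l < n" for i a l
    using A that by (auto simp: integrable_entries_def)
  have eq: "polyder (der K i) (generic_der n A i) (generic_der n A j a) =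
    (\<lambda>z. \<Oplus>k\<in>{..<n}. (der K i (A j (a, k)) \<oplus> (\<Oplus>l\<in>{..<n}. A j (a, l) \<otimes> A i (l, k))) \<otimes> coord k z)"
    if ij: "i < m" "j < m" for i j
  proof
    fix z
    have dc: "der K i (A j (a, l)) \<in> carrier K" if "l < n" for l
      using Ac[OF ij(2) True that] ij by (simp add: der_closed)
    have Sc: "(\<Oplus>l\<in>{..<n}. A j (a, l) \<otimes> A i (l, k)) \<in> carrier K" if "k < n" for k
      using Ac ij True that by (intro finsum_closed) auto
    have "(\<Oplus>l\<in>{..<n}. A j (a, l) \<otimes> generic_der n A i l z) =
        (\<Oplus>l\<in>{..<n}. \<Oplus>k\<in>{..<n}. A j (a, l) \<otimes> A i (l, k) \<otimes> coord k z)"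
    proof (intro finsum_cong' refl)
      fix l assume l: "l \<in> {..<n}"
      have "A j (a, l) \<otimes> generic_der n A i l z = (\<Oplus>k\<in>{..<n}. A j (a, l) \<otimes> (A i (l, k) \<otimes> coord k z))"
        using l Ac[OF ij(2) True] Ac[OF ij(1)] unfolding generic_der_def linfun_def
        by (auto intro!: finsum_rdistr)
      also have "\<dots> = (\<Oplus>k\<in>{..<n}. A j (a, l) \<otimes> A i (l, k) \<otimes> coord k z)"
        using l Ac[OF ij(2) True] Ac[OF ij(1)] by (intro finsum_cong') (auto simp: m_assoc)
      finally show "A j (a, l) \<otimes> generic_der n A i l z = (\<Oplus>k\<in>{..<n}. A j (a, l) \<otimes> A i (l, k) \<otimes> coord k z)" .
    qed (use Ac[OF ij(2) True] Ac[OF ij(1)] in \<open>auto intro!: finsum_closed\<close>)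
    also have "\<dots> = (\<Oplus>k\<in>{..<n}. \<Oplus>l\<in>{..<n}. A j (a, l) \<otimes> A i (l, k) \<otimes> coord k z)"
      using Ac[OF ij(2) True] Ac[OF ij(1)] by (intro finsum_swap) auto
    also have "\<dots> = (\<Oplus>k\<in>{..<n}. (\<Oplus>l\<in>{..<n}. A j (a, l) \<otimes> A i (l, k)) \<otimes> coord k z)"
      using Ac[OF ij(2) True] Ac[OF ij(1)]
      by (intro finsum_cong') (auto intro!: finsum_closed finsum_ldistr[symmetric])
    finally have *: "(\<Oplus>l\<in>{..<n}. A j (a, l) \<otimes> generic_der n A i l z) = \<dots>" .
    have "polyder (der K i) (generic_der n A i) (generic_der n A j a) z =
      linfun n (\<lambda>l. der K i (A j (a, l))) z \<oplus> (\<Oplus>l\<in>{..<n}. A j (a, l) \<otimes> generic_der n A i l z)"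
      using polyder_linfun[OF ij(1) generic_der_polyfun[OF A ij(1)], of n "\<lambda>l. A j (a, l)"] Ac[OF ij(2) True] True
      by (simp add: generic_der_def[of n A j a])
    also have "\<dots> = (\<Oplus>k\<in>{..<n}. der K i (A j (a, k)) \<otimes> coord k z) \<oplus>
        (\<Oplus>k\<in>{..<n}. (\<Oplus>l\<in>{..<n}. A j (a, l) \<otimes> A i (l, k)) \<otimes> coord k z)"
      unfolding * linfun_def ..
    also have "\<dots> = (\<Oplus>k\<in>{..<n}. der K i (A j (a, k)) \<otimes> coord k z \<oplus> (\<Oplus>l\<in>{..<n}. A j (a, l) \<otimes> A i (l, k)) \<otimes> coord k z)"
      using dc Sc by (intro finsum_addf[symmetric]) auto
    also have "\<dots> = (\<Oplus>k\<in>{..<n}. (der K i (A j (a, k)) \<oplus> (\<Oplus>l\<in>{..<n}. A j (a, l) \<otimes> A i (l, k))) \<otimes> coord k z)"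
      using dc Sc by (intro finsum_cong') (auto simp: l_distr)
    finally show "polyder (der K i) (generic_der n A i) (generic_der n A j a) z = \<dots>" .
  qed
  have "(\<Oplus>k\<in>{..<n}. (der K i (A j (a, k)) \<oplus> (\<Oplus>l\<in>{..<n}. A j (a, l) \<otimes> A i (l, k))) \<otimes> coord k z) =
    (\<Oplus>k\<in>{..<n}. (der K j (A i (a, k)) \<oplus> (\<Oplus>l\<in>{..<n}. A i (a, l) \<otimes> A j (l, k))) \<otimes> coord k z)" for z
    using A ij True by (intro finsum_cong')
      (auto simp: integrable_entries_def intro!: m_closed a_closed der_closed finsum_closed)
  then show ?thesis using eq[OF ij] eq[OF ij(2,1)] by simp
qed

text \<open>Evaluating the differential polynomials at the generic point produces sums in L; this
  recognises them as classes of single polynomial functions.\<close>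

lemma ratfun_class_linfun:
  fixes b :: "nat \<Rightarrow> nat \<Rightarrow> (nat \<Rightarrow> 'a) \<Rightarrow> 'a"
  assumes c: "\<And>l. l < n \<Longrightarrow> c l \<in> carrier K"
  shows "ratfun_class (linfun n c) = (\<Oplus>\<^bsub>ratfun_diff_field b\<^esub>l\<in>{..<n}. ratfun_class (\<lambda>z. c l) \<otimes>\<^bsub>ratfun_diff_field b\<^esub> ratfun_class (coord l))"
  using c
proof (induction n)
  let ?L = "ratfun_diff_field b"
  interpret h: ring_hom_cring "fun_ring (ratfun :: ((nat \<Rightarrow> 'a) \<Rightarrow> 'a) set)" ?L ratfun_class
    by (rule ratfun_class_diff_hom)
  {
    case 0
    have "linfun 0 c = \<zero>\<^bsub>fun_ring ratfun\<^esub>" by (simp add: linfun_def fun_eq_iff)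
    then show ?case using h.hom_zero by (simp only: lessThan_0 h.S.finsum_empty)
  next
    case (Suc n)
    have cc: "(\<lambda>z. c l) \<in> carrier (fun_ring ratfun)" if "l < Suc n" for l
      using Suc.prems that by (simp add: const_ratfun)
    have co: "coord l \<in> carrier (fun_ring ratfun)" for l
      using subsetD[OF polyfun_ratfun polyfun.coord] by simp
    have lf: "linfun n c \<in> carrier (fun_ring ratfun)"
      using polyfun_ratfun linfun_polyfun[of n c] Suc.prems by auto
    have "linfun (Suc n) c = linfun n c \<oplus>\<^bsub>fun_ring ratfun\<^esub> ((\<lambda>z. c n) \<otimes>\<^bsub>fun_ring ratfun\<^esub> coord n)"
      using linfun_Suc Suc.prems by simp
    then have "ratfun_class (linfun (Suc n) c) = ratfun_class (linfun n c) \<oplus>\<^bsub>?L\<^esub>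
       ratfun_class (\<lambda>z. c n) \<otimes>\<^bsub>?L\<^esub> ratfun_class (coord n)"
      using h.hom_add[OF lf h.R.m_closed[OF cc co]] h.hom_mult[OF cc co] by (simp only: lessI)
    also have "ratfun_class (linfun n c) = (\<Oplus>\<^bsub>?L\<^esub>l\<in>{..<n}. ratfun_class (\<lambda>z. c l) \<otimes>\<^bsub>?L\<^esub> ratfun_class (coord l))"
      using Suc by simp
    also have "\<dots> \<oplus>\<^bsub>?L\<^esub> ratfun_class (\<lambda>z. c n) \<otimes>\<^bsub>?L\<^esub> ratfun_class (coord n) =
      (\<Oplus>\<^bsub>?L\<^esub>l\<in>{..<Suc n}. ratfun_class (\<lambda>z. c l) \<otimes>\<^bsub>?L\<^esub> ratfun_class (coord l))"
      unfolding lessThan_Suc using h.hom_closed[OF cc] h.hom_closed[OF co]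
      by (subst h.S.finsum_insert) (auto intro!: h.S.a_comm h.S.finsum_closed h.S.m_closed simp del: ratfun_diff_field_simps)
    finally show ?case .
  }
qed

end

lemma (in diff_field) ring_hom_cring_id: "ring_hom_cring K K id"
  by unfold_locales (simp add: ring_hom_def)

lemma linear_system_solution:
  fixes K :: "'a diff_ring" (structure)
  assumes dl: "differentially_large m K" and A: "diff_field.integrable_entries K m n A"
    and c: "\<And>l. l < n \<Longrightarrow> c l \<in> carrier K" and r: "r < n" "c r \<noteq> \<zero>\<^bsub>K\<^esub>"
  shows "\<exists>x. (\<forall>l<n. x l \<in> carrier K) \<and>
    (\<forall>i<m. \<forall>a<n. der K i (x a) = (\<Oplus>\<^bsub>K\<^esub>l\<in>{..<n}. A i (a, l) \<otimes>\<^bsub>K\<^esub> x l)) \<and>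
    (\<Oplus>\<^bsub>K\<^esub>l\<in>{..<n}. c l \<otimes>\<^bsub>K\<^esub> x l) \<noteq> \<zero>\<^bsub>K\<^esub>"
proof -
  interpret diff_field K m using dl by (simp add: differentially_large_def)
  define b where "b = generic_der n A"
  define L where "L = ratfun_diff_field b"
  define \<iota> where "\<iota> = (\<lambda>c. ratfun_class (\<lambda>z :: nat \<Rightarrow> 'a. c))"
  have Ac: "A i (a, l) \<in> carrier K" if "i < m" "a < n" "l < n" for i a l
    using A that by (simp add: integrable_entries_def)
  note bp = generic_der_polyfun[OF A] and bc = generic_der_commute[OF A]
  have ext: "diff_field_ext m K L \<iota>"
    unfolding L_def \<iota>_def b_def using ratfun_diff_field_ext(1)[of "generic_der n A", OF bp bc] .
  have derL: "der L i (ratfun_class p) = ratfun_class (polyder (der K i) (b i) p)" if "i < m" "p \<in> polyfun" for i p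
    unfolding L_def b_def using ratfun_diff_field_ext(2)[of "generic_der n A", OF bp bc that] .
  have "ec_as_field K L \<iota>" unfolding L_def \<iota>_def by (rule ratfun_diff_field_ec)
  with ext have ec: "ec_as_diff_field m K L \<iota>" by (rule differentially_large_extension[OF dl])
  interpret L: diff_field L m using ext by (simp add: diff_field_ext_def)
  interpret \<iota>: ring_hom_cring K L \<iota>
    using ext by unfold_locales (simp add: diff_field_ext_def)
  interpret h: ring_hom_cring "fun_ring (ratfun :: ((nat \<Rightarrow> 'a) \<Rightarrow> 'a) set)" L ratfun_class
    unfolding L_def by (rule ratfun_class_diff_hom)
  have lin: "ratfun_class (linfun n c) = (\<Oplus>\<^bsub>L\<^esub>l\<in>{..<n}. \<iota> (c l) \<otimes>\<^bsub>L\<^esub> ratfun_class (coord l))"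
    if "\<And>l. l < n \<Longrightarrow> c l \<in> carrier K" for c
    unfolding L_def \<iota>_def by (rule ratfun_class_linfun) (rule that)
  have lp: "linfun n c \<in> polyfun" by (rule linfun_polyfun) (rule c)
  \<comment> \<open>The r-th unit vector detects \<open>c r\<close>. So the form is not the zero
    function and, as polynomial functions embed into L, its class is invertible there.\<close>
  have "linfun n c (\<lambda>l. if l = r then \<one> else \<zero>) = (\<Oplus>l\<in>{..<n}. if r = l then c l else \<zero>)"
    unfolding linfun_def using c by (intro finsum_cong') (auto simp: coord_def)
  also have "\<dots> = c r" using r c finsum_singleton[of r "{..<n}" c] by auto
  finally have "linfun n c \<noteq> (\<lambda>z. \<zero>)" using r(2) by (metis (full_types))
  then have nz: "ratfun_class (linfun n c) \<noteq> \<zero>\<^bsub>L\<^esub>"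
    using fractions.inj[OF ratfun_field_fractions, of "linfun n c" "\<lambda>z. \<zero>"] lp h.hom_zero polyfun.const[OF zero_closed]
    by auto
  have coc: "ratfun_class (coord l) \<in> carrier L" for l
    by (rule h.hom_closed) (simp add: subsetD[OF polyfun_ratfun polyfun.coord])
  have lc: "ratfun_class (linfun n c) \<in> carrier L"
    by (rule h.hom_closed) (simp add: subsetD[OF polyfun_ratfun lp])
  \<comment> \<open>The equation A_i X = \<delta>_i X in row a: the variable \<open>(l, {#})\<close>
    is X_l itself and \<open>(a, {#i#})\<close> is \<delta>_i X_a.\<close>
  define f where "f = (\<lambda>(i, a). indexed_padd (lin_poly (\<lambda>l. A i (a, l)) (\<lambda>l. (l, {#})) n)
      (indexed_pmult (indexed_const (\<ominus> \<one>)) (a, {#i#})))"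
  \<comment> \<open>The equation c(X) X_n = 1 turns the inequation for c(X) into an equation; its
    extra unknown X_n accounts for the \<open>Suc n\<close> unknowns.\<close>
  define g where "g = indexed_padd (indexed_pmult (lin_poly c (\<lambda>l. (l, {#} :: nat multiset)) n) (n, {#})) (indexed_const (\<ominus> \<one>))"
  define S where "S = insert g (f ` ({..<m} \<times> {..<n}))"
  let ?V = "diff_vars m (Suc n)"
  have v: "(l, {#}) \<in> ?V" if "l \<le> n" for l using that by (simp add: diff_vars_def)
  have v': "(a, {#i#}) \<in> ?V" if "a < n" "i < m" for a i using that by (simp add: diff_vars_def)
  have linp: "lin_poly c (\<lambda>l. (l, {#})) n \<in> carrier (mpoly_ring K ?V)"
    if "\<And>l. l < n \<Longrightarrow> c l \<in> carrier K" for c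
    using that v by (intro mpoly_lin_poly) auto
  have fc: "f (i, a) \<in> carrier (mpoly_ring K ?V)" if "i < m" "a < n" for i a
    unfolding f_def using that Ac v' by (auto intro!: mpoly_carrier_intros linp)
  have gc: "g \<in> carrier (mpoly_ring K ?V)"
    unfolding g_def using c v by (auto intro!: mpoly_carrier_intros linp)
  \<comment> \<open>Stated over an arbitrary differential field M, as it is applied twice: to the
    generic point in L and to the point of K returned by existential closedness.\<close>
  have evf: "diff_poly_eval m K M \<kappa> x (f (i, a)) =
      (\<Oplus>\<^bsub>M\<^esub>l\<in>{..<n}. \<kappa> (A i (a, l)) \<otimes>\<^bsub>M\<^esub> x l) \<ominus>\<^bsub>M\<^esub> der M i (x a)" (is "?F")
    and evg: "diff_poly_eval m K M \<kappa> x g = (\<Oplus>\<^bsub>M\<^esub>l\<in>{..<n}. \<kappa> (c l) \<otimes>\<^bsub>M\<^esub> x l) \<otimes>\<^bsub>M\<^esub> x n \<ominus>\<^bsub>M\<^esub> \<one>\<^bsub>M\<^esub>" (is "?G")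
    if i: "i < m" and a: "a < n" and M: "diff_field M m" and \<kappa>: "ring_hom_cring K M \<kappa>"
      and x: "x \<in> {..<Suc n} \<rightarrow> carrier M"
    for i a and M :: "'b diff_ring" and \<kappa> x
  proof -
    interpret M: diff_field M m by (rule M)
    interpret \<kappa>: ring_hom_cring K M \<kappa> by (rule \<kappa>)
    let ?x = "\<lambda>(j, \<alpha>). der_power m M \<alpha> (x j)"
    interpret P: mpoly_point K M \<kappa> ?x ?V
      using x by unfold_locales (auto simp: diff_vars_def intro!: M.der_power_closed)
    have lin: "mpoly_eval K M \<kappa> ?x (lin_poly c (\<lambda>l. (l, {#})) n) = (\<Oplus>\<^bsub>M\<^esub>l\<in>{..<n}. \<kappa> (c l) \<otimes>\<^bsub>M\<^esub> x l)"
      if "\<And>l. l < n \<Longrightarrow> c l \<in> carrier K" for c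
      using P.mpoly_eval_lin_poly[of n c "\<lambda>l. (l, {#})"] that v by (simp add: der_power_empty)
    have sc: "(\<Oplus>\<^bsub>M\<^esub>l\<in>{..<n}. \<kappa> (c l) \<otimes>\<^bsub>M\<^esub> x l) \<in> carrier M" if "\<And>l. l < n \<Longrightarrow> c l \<in> carrier K" for c
      using that x by (intro M.finsum_closed) (auto simp: Pi_iff)
    have da: "der M i (x a) \<in> carrier M" "x n \<in> carrier M" using i a x by (auto intro!: M.der_closed)
    have m1: "indexed_const (\<ominus> \<one>) \<in> carrier (mpoly_ring K ?V)" by (rule mpoly_const) simp
    have "diff_poly_eval m K M \<kappa> x (f (i, a)) = (\<Oplus>\<^bsub>M\<^esub>l\<in>{..<n}. \<kappa> (A i (a, l)) \<otimes>\<^bsub>M\<^esub> x l) \<oplus>\<^bsub>M\<^esub> \<kappa> (\<ominus> \<one>) \<otimes>\<^bsub>M\<^esub> der M i (x a)"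
      unfolding diff_poly_eval_def f_def prod.case
      using P.mpoly_eval_padd[OF linp mpoly_pmult[OF m1 v'[OF a i]], of "\<lambda>l. A i (a, l)"]
        P.mpoly_eval_pmult[OF m1 v'[OF a i]] P.mpoly_eval_const[of "\<ominus> \<one>"] lin[of "\<lambda>l. A i (a, l)"] Ac[OF i a]
      by (simp add: der_power_single[OF i])
    then show ?F using da by (simp add: a_minus_def M.l_minus)
    have "diff_poly_eval m K M \<kappa> x g = (\<Oplus>\<^bsub>M\<^esub>l\<in>{..<n}. \<kappa> (c l) \<otimes>\<^bsub>M\<^esub> x l) \<otimes>\<^bsub>M\<^esub> x n \<oplus>\<^bsub>M\<^esub> \<kappa> (\<ominus> \<one>)"
      unfolding diff_poly_eval_def g_def
      using P.mpoly_eval_padd[OF mpoly_pmult[OF linp v] m1, of c n]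
        P.mpoly_eval_pmult[OF linp v, of c n] P.mpoly_eval_const[of "\<ominus> \<one>"] lin[of c] c
      by (simp add: der_power_empty)
    then show ?G by (simp add: a_minus_def)
  qed
  \<comment> \<open>The witness in L: the coordinate functions, and at index n the inverse of the
    linear form.\<close>
  define x where "x = (\<lambda>j. if j < n then ratfun_class (coord j) else inv\<^bsub>L\<^esub> ratfun_class (linfun n c))"
  have inv: "inv\<^bsub>L\<^esub> ratfun_class (linfun n c) \<in> carrier L"
    "ratfun_class (linfun n c) \<otimes>\<^bsub>L\<^esub> inv\<^bsub>L\<^esub> ratfun_class (linfun n c) = \<one>\<^bsub>L\<^esub>"
    using lc nz by (auto simp: L.field_Units)
  have xc: "x \<in> {..<Suc n} \<rightarrow> carrier L" using coc inv(1) by (simp add: x_def)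
  have sumx: "(\<Oplus>\<^bsub>L\<^esub>l\<in>{..<n}. \<iota> (c l) \<otimes>\<^bsub>L\<^esub> x l) = ratfun_class (linfun n c)"
    if "\<And>l. l < n \<Longrightarrow> c l \<in> carrier K" for c
  proof -
    have "ratfun_class (linfun n c) = (\<Oplus>\<^bsub>L\<^esub>l\<in>{..<n}. \<iota> (c l) \<otimes>\<^bsub>L\<^esub> ratfun_class (coord l))"
      by (rule lin) (rule that)
    also have "\<dots> = (\<Oplus>\<^bsub>L\<^esub>l\<in>{..<n}. \<iota> (c l) \<otimes>\<^bsub>L\<^esub> x l)"
      using that xc by (intro L.finsum_cong') (simp_all add: x_def Pi_iff coc)
    finally show ?thesis ..
  qed
  have "diff_poly_eval m K L \<iota> x p = \<zero>\<^bsub>L\<^esub>" if "p \<in> S" for p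
  proof -
    have m0: "0 < m" using m_pos by simp
    \<comment> \<open>The evaluation rules for f and g are stated jointly for a pair of indices; in
      the case p = g the pair \<open>0\<close>, \<open>r\<close> provides one.\<close>
    have *: "\<exists>i<m. \<exists>a<n. p = f (i, a) \<or> p = g"
      using that m0 r(1) unfolding S_def by blast
    then obtain i a where ia: "i < m" "a < n" and p: "p = f (i, a) \<or> p = g" by blast
    note e = evf[OF ia L.diff_field_axioms \<iota>.ring_hom_cring_axioms xc]
      evg[OF ia L.diff_field_axioms \<iota>.ring_hom_cring_axioms xc]
    have Al: "linfun n (\<lambda>l. A i (a, l)) \<in> polyfun" by (rule linfun_polyfun) (rule Ac[OF ia])
    have "der L i (x a) = ratfun_class (linfun n (\<lambda>l. A i (a, l)))"
      using derL[OF ia(1) polyfun.coord] ia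
        polyder_coord[OF der_derivation[OF ia(1)], of "b i" a, OF bp[OF ia(1), folded b_def]]
      by (simp add: x_def b_def generic_der_def)
    moreover have "ratfun_class (linfun n (\<lambda>l. A i (a, l))) \<in> carrier L"
      by (rule h.hom_closed) (simp add: subsetD[OF polyfun_ratfun Al])
    ultimately have "diff_poly_eval m K L \<iota> x (f (i, a)) = \<zero>\<^bsub>L\<^esub>"
      unfolding e(1) using sumx[of "\<lambda>l. A i (a, l)"] Ac[OF ia] by (simp add: L.r_right_minus_eq)
    moreover have "diff_poly_eval m K L \<iota> x g = \<zero>\<^bsub>L\<^esub>"
      unfolding e(2) using sumx[of c] c inv by (simp add: x_def L.r_right_minus_eq)
    ultimately show ?thesis using p by blast
  qed
  moreover have "finite S" "S \<subseteq> carrier (mpoly_ring K ?V)" using fc gc by (auto simp: S_def)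
  ultimately obtain y where y: "y \<in> {..<Suc n} \<rightarrow> carrier K"
    and ys: "\<And>p. p \<in> S \<Longrightarrow> diff_poly_eval m K K id y p = \<zero>"
    using ec[unfolded ec_as_diff_field_def, rule_format, of S "Suc n"] xc by blast
  have yc: "y l \<in> carrier K" if "l < n" for l using y that by auto
  have m0: "0 < m" using m_pos by simp
  have "der K i (y a) = (\<Oplus>l\<in>{..<n}. A i (a, l) \<otimes> y l)" if ia: "i < m" "a < n" for i a
  proof -
    have "f (i, a) \<in> S" using ia by (auto simp: S_def)
    then have "(\<Oplus>l\<in>{..<n}. A i (a, l) \<otimes> y l) \<ominus> der K i (y a) = \<zero>"
      using ys evf[OF ia diff_field_axioms ring_hom_cring_id y] by simp
    moreover have "(\<Oplus>l\<in>{..<n}. A i (a, l) \<otimes> y l) \<in> carrier K"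
      using Ac[OF ia] yc by (intro finsum_closed) auto
    ultimately show ?thesis using ia yc r_right_minus_eq[of "\<Oplus>l\<in>{..<n}. A i (a, l) \<otimes> y l" "der K i (y a)"]
      by (simp add: der_closed)
  qed
  moreover have "(\<Oplus>l\<in>{..<n}. c l \<otimes> y l) \<noteq> \<zero>"
  proof
    assume "(\<Oplus>l\<in>{..<n}. c l \<otimes> y l) = \<zero>"
    then have "\<zero> \<otimes> y n \<ominus> \<one> = \<zero>"
      using ys[of g] evg[OF m0 r(1) diff_field_axioms ring_hom_cring_id y] by (simp add: S_def)
    moreover have "y n \<in> carrier K" using y by auto
    ultimately show False by (simp add: r_right_minus_eq)
  qed
  ultimately show ?thesis using yc by blast
qed

section \<open>Matrices\<close>

context cring
begin

lemma mat_entry [simp]: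
  assumes "i < n" "j < n"
  shows "(A \<otimes>\<^bsub>mat_ring R n\<^esub> B) (i, j) = (\<Oplus>l\<in>{..<n}. A (i, l) \<otimes> B (l, j))"
    and "(A \<oplus>\<^bsub>mat_ring R n\<^esub> B) (i, j) = A (i, j) \<oplus> B (i, j)"
    and "\<one>\<^bsub>mat_ring R n\<^esub> (i, j) = (if i = j then \<one> else \<zero>)"
    and "\<zero>\<^bsub>mat_ring R n\<^esub> (i, j) = \<zero>"
  using assms by (simp_all add: mat_ring_def)

lemma mat_closed: "\<lbrakk>A \<in> carrier (mat_ring R n); i < n; j < n\<rbrakk> \<Longrightarrow> A (i, j) \<in> carrier R"
  by (auto simp: mat_ring_def)

lemma mat_eqI:
  assumes "A \<in> carrier (mat_ring R n)" "B \<in> carrier (mat_ring R n)"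
    and "\<And>i j. i < n \<Longrightarrow> j < n \<Longrightarrow> A (i, j) = B (i, j)"
  shows "A = B"
proof (rule PiE_ext)
  show "A \<in> {..<n} \<times> {..<n} \<rightarrow>\<^sub>E carrier R" "B \<in> {..<n} \<times> {..<n} \<rightarrow>\<^sub>E carrier R"
    using assms(1,2) by (simp_all add: mat_ring_def)
  show "A p = B p" if "p \<in> {..<n} \<times> {..<n}" for p using that assms(3) by auto
qed

lemma mat_restrict_closed:
  assumes "\<And>i j. i < n \<Longrightarrow> j < n \<Longrightarrow> f i j \<in> carrier R"
  shows "(\<lambda>(i, j)\<in>{..<n} \<times> {..<n}. f i j) \<in> carrier (mat_ring R n)"
  using assms by (auto simp: mat_ring_def)

lemma mat_mult_closed:
  assumes "A \<in> carrier (mat_ring R n)" "B \<in> carrier (mat_ring R n)"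
  shows "A \<otimes>\<^bsub>mat_ring R n\<^esub> B \<in> carrier (mat_ring R n)"
  using mat_restrict_closed[of n "\<lambda>i j. \<Oplus>l\<in>{..<n}. A (i, l) \<otimes> B (l, j)"]
    mat_closed[OF assms(1)] mat_closed[OF assms(2)]
  by (simp add: mat_ring_def finsum_closed Pi_iff)

lemma mat_add_closed:
  assumes "A \<in> carrier (mat_ring R n)" "B \<in> carrier (mat_ring R n)"
  shows "A \<oplus>\<^bsub>mat_ring R n\<^esub> B \<in> carrier (mat_ring R n)"
  using mat_restrict_closed[of n "\<lambda>i j. A (i, j) \<oplus> B (i, j)"]
    mat_closed[OF assms(1)] mat_closed[OF assms(2)]
  by (simp add: mat_ring_def)

lemma mat_one_closed: "\<one>\<^bsub>mat_ring R n\<^esub> \<in> carrier (mat_ring R n)"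
  using mat_restrict_closed[of n "\<lambda>i j. if i = j then \<one> else \<zero>"] by (simp add: mat_ring_def)

lemma mat_zero_closed: "\<zero>\<^bsub>mat_ring R n\<^esub> \<in> carrier (mat_ring R n)"
  using mat_restrict_closed[of n "\<lambda>i j. \<zero>"] by (simp add: mat_ring_def)

lemma finsum_delta:
  assumes "finite I" "k \<in> I" "\<And>l. l \<in> I \<Longrightarrow> f l \<in> carrier R"
    "\<And>l. l \<in> I \<Longrightarrow> l \<noteq> k \<Longrightarrow> f l = \<zero>"
  shows "(\<Oplus>l\<in>I. f l) = f k"
proof -
  have "(\<Oplus>l\<in>I. f l) = (\<Oplus>l\<in>I. if k = l then f l else \<zero>)"
    using assms by (intro finsum_cong') auto
  also have "\<dots> = f k" using assms by (intro finsum_singleton) auto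
  finally show ?thesis .
qed

lemma mat_ring_ring: "ring (mat_ring R n)"
proof (rule ringI)
  let ?M = "mat_ring R n"
  show "abelian_group ?M"
  proof (rule abelian_groupI)
    fix A assume A: "A \<in> carrier ?M"
    let ?B = "\<lambda>(i, j)\<in>{..<n} \<times> {..<n}. \<ominus> A (i, j)"
    have B: "?B \<in> carrier ?M" by (rule mat_restrict_closed) (simp add: mat_closed[OF A])
    have "?B \<oplus>\<^bsub>?M\<^esub> A = \<zero>\<^bsub>?M\<^esub>"
      by (rule mat_eqI[OF mat_add_closed[OF B A] mat_zero_closed]) (simp add: mat_closed[OF A] l_neg)
    with B show "\<exists>B\<in>carrier ?M. B \<oplus>\<^bsub>?M\<^esub> A = \<zero>\<^bsub>?M\<^esub>" by blast
  next
    fix A B C assume A: "A \<in> carrier ?M" and B: "B \<in> carrier ?M" and C: "C \<in> carrier ?M"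
    show "A \<oplus>\<^bsub>?M\<^esub> B \<oplus>\<^bsub>?M\<^esub> C = A \<oplus>\<^bsub>?M\<^esub> (B \<oplus>\<^bsub>?M\<^esub> C)"
      by (rule mat_eqI[where n = n]) (simp_all add: A B C mat_add_closed mat_closed[OF A] mat_closed[OF B] mat_closed[OF C] a_assoc)
  next
    fix A B assume A: "A \<in> carrier ?M" and B: "B \<in> carrier ?M"
    show "A \<oplus>\<^bsub>?M\<^esub> B = B \<oplus>\<^bsub>?M\<^esub> A"
      by (rule mat_eqI[where n = n]) (simp_all add: A B mat_add_closed mat_closed[OF A] mat_closed[OF B] a_comm)
  next
    fix A assume A: "A \<in> carrier ?M"
    show "\<zero>\<^bsub>?M\<^esub> \<oplus>\<^bsub>?M\<^esub> A = A"
      by (rule mat_eqI[where n = n]) (simp_all add: A mat_add_closed mat_zero_closed mat_closed[OF A])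
  qed (simp_all add: mat_add_closed mat_zero_closed)
  show "monoid ?M"
  proof (rule monoidI)
    fix A assume A: "A \<in> carrier ?M"
    show "\<one>\<^bsub>?M\<^esub> \<otimes>\<^bsub>?M\<^esub> A = A"
    proof (rule mat_eqI[OF mat_mult_closed[OF mat_one_closed A] A])
      fix i j assume ij: "i < n" "j < n"
      have "(\<Oplus>l\<in>{..<n}. \<one>\<^bsub>?M\<^esub> (i, l) \<otimes> A (l, j)) = \<one>\<^bsub>?M\<^esub> (i, i) \<otimes> A (i, j)"
        using ij by (intro finsum_delta) (simp_all add: mat_closed[OF A])
      then show "(\<one>\<^bsub>?M\<^esub> \<otimes>\<^bsub>?M\<^esub> A) (i, j) = A (i, j)" using ij by (simp add: mat_closed[OF A])
    qed
    show "A \<otimes>\<^bsub>?M\<^esub> \<one>\<^bsub>?M\<^esub> = A"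
    proof (rule mat_eqI[OF mat_mult_closed[OF A mat_one_closed] A])
      fix i j assume ij: "i < n" "j < n"
      have "(\<Oplus>l\<in>{..<n}. A (i, l) \<otimes> \<one>\<^bsub>?M\<^esub> (l, j)) = A (i, j) \<otimes> \<one>\<^bsub>?M\<^esub> (j, j)"
        using ij by (intro finsum_delta) (simp_all add: mat_closed[OF A])
      then show "(A \<otimes>\<^bsub>?M\<^esub> \<one>\<^bsub>?M\<^esub>) (i, j) = A (i, j)" using ij by (simp add: mat_closed[OF A])
    qed
  next
    fix A B C assume A: "A \<in> carrier ?M" and B: "B \<in> carrier ?M" and C: "C \<in> carrier ?M"
    note c = mat_closed[OF A] mat_closed[OF B] mat_closed[OF C]
    show "A \<otimes>\<^bsub>?M\<^esub> B \<otimes>\<^bsub>?M\<^esub> C = A \<otimes>\<^bsub>?M\<^esub> (B \<otimes>\<^bsub>?M\<^esub> C)"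
    proof (rule mat_eqI[where n = n])
      fix i j assume ij: "i < n" "j < n"
      have "(A \<otimes>\<^bsub>?M\<^esub> B \<otimes>\<^bsub>?M\<^esub> C) (i, j) = (\<Oplus>l\<in>{..<n}. (\<Oplus>k\<in>{..<n}. A (i, k) \<otimes> B (k, l)) \<otimes> C (l, j))"
        using ij c unfolding mat_entry(1)[OF ij] by (intro finsum_cong') (auto intro!: finsum_closed)
      also have "\<dots> = (\<Oplus>l\<in>{..<n}. \<Oplus>k\<in>{..<n}. A (i, k) \<otimes> B (k, l) \<otimes> C (l, j))"
        using ij c by (intro finsum_cong') (auto intro!: finsum_closed finsum_ldistr)
      also have "\<dots> = (\<Oplus>k\<in>{..<n}. \<Oplus>l\<in>{..<n}. A (i, k) \<otimes> B (k, l) \<otimes> C (l, j))"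
        using ij c by (intro finsum_swap) auto
      also have "\<dots> = (\<Oplus>k\<in>{..<n}. A (i, k) \<otimes> (\<Oplus>l\<in>{..<n}. B (k, l) \<otimes> C (l, j)))"
      proof (intro finsum_cong' refl)
        fix k assume k: "k \<in> {..<n}"
        have "A (i, k) \<otimes> (\<Oplus>l\<in>{..<n}. B (k, l) \<otimes> C (l, j)) = (\<Oplus>l\<in>{..<n}. A (i, k) \<otimes> (B (k, l) \<otimes> C (l, j)))"
          using ij k c by (intro finsum_rdistr) auto
        also have "\<dots> = (\<Oplus>l\<in>{..<n}. A (i, k) \<otimes> B (k, l) \<otimes> C (l, j))"
          using ij k c by (intro finsum_cong') (auto simp: m_assoc)
        finally show "(\<Oplus>l\<in>{..<n}. A (i, k) \<otimes> B (k, l) \<otimes> C (l, j)) = A (i, k) \<otimes> (\<Oplus>l\<in>{..<n}. B (k, l) \<otimes> C (l, j))" ..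
      qed (use ij c in \<open>auto intro!: finsum_closed\<close>)
      also have "\<dots> = (A \<otimes>\<^bsub>?M\<^esub> (B \<otimes>\<^bsub>?M\<^esub> C)) (i, j)"
        using ij c unfolding mat_entry(1)[OF ij] by (intro finsum_cong') (auto intro!: finsum_closed)
      finally show "(A \<otimes>\<^bsub>?M\<^esub> B \<otimes>\<^bsub>?M\<^esub> C) (i, j) = (A \<otimes>\<^bsub>?M\<^esub> (B \<otimes>\<^bsub>?M\<^esub> C)) (i, j)" .
    qed (simp_all add: A B C mat_mult_closed)
  qed (simp_all add: mat_mult_closed mat_one_closed)
  fix A B C assume A: "A \<in> carrier ?M" and B: "B \<in> carrier ?M" and C: "C \<in> carrier ?M"
  note c = mat_closed[OF A] mat_closed[OF B] mat_closed[OF C]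
  show "(A \<oplus>\<^bsub>?M\<^esub> B) \<otimes>\<^bsub>?M\<^esub> C = A \<otimes>\<^bsub>?M\<^esub> C \<oplus>\<^bsub>?M\<^esub> B \<otimes>\<^bsub>?M\<^esub> C"
  proof (rule mat_eqI[where n = n])
    fix i j assume ij: "i < n" "j < n"
    have "((A \<oplus>\<^bsub>?M\<^esub> B) \<otimes>\<^bsub>?M\<^esub> C) (i, j) = (\<Oplus>l\<in>{..<n}. A (i, l) \<otimes> C (l, j) \<oplus> B (i, l) \<otimes> C (l, j))"
      using ij c unfolding mat_entry(1)[OF ij] by (intro finsum_cong') (auto simp: l_distr)
    also have "\<dots> = (A \<otimes>\<^bsub>?M\<^esub> C \<oplus>\<^bsub>?M\<^esub> B \<otimes>\<^bsub>?M\<^esub> C) (i, j)"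
      using ij c unfolding mat_entry(2)[OF ij] mat_entry(1)[OF ij] by (intro finsum_addf) auto
    finally show "((A \<oplus>\<^bsub>?M\<^esub> B) \<otimes>\<^bsub>?M\<^esub> C) (i, j) = (A \<otimes>\<^bsub>?M\<^esub> C \<oplus>\<^bsub>?M\<^esub> B \<otimes>\<^bsub>?M\<^esub> C) (i, j)" .
  qed (simp_all add: A B C mat_mult_closed mat_add_closed)
  show "C \<otimes>\<^bsub>?M\<^esub> (A \<oplus>\<^bsub>?M\<^esub> B) = C \<otimes>\<^bsub>?M\<^esub> A \<oplus>\<^bsub>?M\<^esub> C \<otimes>\<^bsub>?M\<^esub> B"
  proof (rule mat_eqI[where n = n])
    fix i j assume ij: "i < n" "j < n"
    have "(C \<otimes>\<^bsub>?M\<^esub> (A \<oplus>\<^bsub>?M\<^esub> B)) (i, j) = (\<Oplus>l\<in>{..<n}. C (i, l) \<otimes> A (l, j) \<oplus> C (i, l) \<otimes> B (l, j))"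
      using ij c unfolding mat_entry(1)[OF ij] by (intro finsum_cong') (auto simp: r_distr)
    also have "\<dots> = (C \<otimes>\<^bsub>?M\<^esub> A \<oplus>\<^bsub>?M\<^esub> C \<otimes>\<^bsub>?M\<^esub> B) (i, j)"
      using ij c unfolding mat_entry(2)[OF ij] mat_entry(1)[OF ij] by (intro finsum_addf) auto
    finally show "(C \<otimes>\<^bsub>?M\<^esub> (A \<oplus>\<^bsub>?M\<^esub> B)) (i, j) = (C \<otimes>\<^bsub>?M\<^esub> A \<oplus>\<^bsub>?M\<^esub> C \<otimes>\<^bsub>?M\<^esub> B) (i, j)" .
  qed (simp_all add: A B C mat_mult_closed mat_add_closed)
qed

section \<open>Invertibility after replacing a column\<close>

text \<open>For the identity matrix in place of Z this is an elementary matrix P, and Z P is Z with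
  column k replaced by the combination of its columns with coefficients x.\<close>

definition column_replaced :: "nat \<Rightarrow> (nat \<times> nat \<Rightarrow> 'a) \<Rightarrow> nat \<Rightarrow> (nat \<Rightarrow> 'a) \<Rightarrow> (nat \<times> nat \<Rightarrow> 'a)" where
  "column_replaced n Z k x = (\<lambda>(i, j)\<in>{..<n} \<times> {..<n}. if j = k then x i else Z (i, j))"

lemma column_replaced_closed:
  assumes "Z \<in> carrier (mat_ring R n)" "\<And>i. i < n \<Longrightarrow> x i \<in> carrier R"
  shows "column_replaced n Z k x \<in> carrier (mat_ring R n)"
  unfolding column_replaced_def by (rule mat_restrict_closed) (simp add: assms mat_closed[OF assms(1)])

lemma column_replaced_entry:
  "\<lbrakk>i < n; j < n\<rbrakk> \<Longrightarrow> column_replaced n Z k x (i, j) = (if j = k then x i else Z (i, j))"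
  by (simp add: column_replaced_def)

text \<open>A row operation: row k is scaled by \<open>c k\<close>, and \<open>c i\<close> times row
  k is added to each other row i. In the sum only l = k and the diagonal term l = i
  contribute.\<close>

lemma mult_column_replaced_one:
  assumes k: "k < n" and c: "\<And>i. i < n \<Longrightarrow> c i \<in> carrier R" and B: "B \<in> carrier (mat_ring R n)"
    and ij: "i < n" "j < n"
  shows "(column_replaced n \<one>\<^bsub>mat_ring R n\<^esub> k c \<otimes>\<^bsub>mat_ring R n\<^esub> B) (i, j) =
    (if i = k then c k \<otimes> B (k, j) else B (i, j) \<oplus> c i \<otimes> B (k, j))"
proof -
  note bc = mat_closed[OF B]
  let ?f = "\<lambda>l. column_replaced n \<one>\<^bsub>mat_ring R n\<^esub> k c (i, l) \<otimes> B (l, j)"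
  have f: "?f l = (if l = k then c i \<otimes> B (k, j) else if i = l then B (l, j) else \<zero>)" if "l < n" for l
    using that ij by (simp add: column_replaced_entry bc)
  have fc: "?f l \<in> carrier R" if "l < n" for l unfolding f[OF that] using that ij k c bc by simp
  have "(\<Oplus>l\<in>insert k ({..<n} - {k}). ?f l) = ?f k \<oplus> (\<Oplus>l\<in>{..<n} - {k}. ?f l)"
    using fc k by (intro finsum_insert) auto
  moreover have "insert k ({..<n} - {k}) = {..<n}" using k by auto
  moreover have "(\<Oplus>l\<in>{..<n} - {k}. ?f l) = (if i = k then \<zero> else B (i, j))"
  proof (cases "i = k")
    case True
    have "?f l = \<zero>" if "l \<in> {..<n} - {k}" for l using f[of l] that True by simp
    then have "(\<Oplus>l\<in>{..<n} - {k}. ?f l) = (\<Oplus>l\<in>{..<n} - {k}. \<zero>)"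
      by (intro finsum_cong') simp_all
    then show ?thesis using True by simp
  next
    case False
    have "(\<Oplus>l\<in>{..<n} - {k}. ?f l) = ?f i"
      using False ij fc by (intro finsum_delta) (auto simp: f bc)
    then show ?thesis using False ij by (simp add: f bc)
  qed
  ultimately have "(\<Oplus>l\<in>{..<n}. ?f l) = ?f k \<oplus> (if i = k then \<zero> else B (i, j))" by simp
  then show ?thesis using k ij c bc by (simp add: f a_comm)
qed

end

context field
begin

lemma column_replaced_one_unit:
  assumes k: "k < n" and c: "\<And>i. i < n \<Longrightarrow> c i \<in> carrier R" and ck: "c k \<noteq> \<zero>"
  shows "column_replaced n \<one>\<^bsub>mat_ring R n\<^esub> k c \<in> Units (mat_ring R n)"
proof -
  interpret M: ring "mat_ring R n" by (rule mat_ring_ring)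
  \<comment> \<open>The inverse is sought in the same shape, with column k equal to d. By the row
    operation this requires c_k d_k = 1 and d_i + c_i d_k = 0 for the other i.\<close>
  define d where "d i = (if i = k then inv (c k) else \<ominus> (inv (c k) \<otimes> c i))" for i
  have inv: "inv (c k) \<in> carrier R" "inv (c k) \<otimes> c k = \<one>" "c k \<otimes> inv (c k) = \<one>"
    using c[OF k] ck by (auto simp: field_Units)
  have d: "d i \<in> carrier R" if "i < n" for i using that c inv by (simp add: d_def)
  let ?T = "column_replaced n \<one>\<^bsub>mat_ring R n\<^esub> k"
  have cl: "?T c \<in> carrier (mat_ring R n)" "?T d \<in> carrier (mat_ring R n)"
    using c d by (auto intro!: column_replaced_closed mat_one_closed)
  have 1: "?T c \<otimes>\<^bsub>mat_ring R n\<^esub> ?T d = \<one>\<^bsub>mat_ring R n\<^esub>"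
  proof (rule mat_eqI[OF mat_mult_closed[OF cl] mat_one_closed])
    fix i j assume ij: "i < n" "j < n"
    have "\<ominus> (inv (c k) \<otimes> c i) \<oplus> c i \<otimes> inv (c k) = \<zero>"
      using inv(1) c[OF ij(1)] by (simp add: m_comm l_neg)
    moreover have "(?T c \<otimes>\<^bsub>mat_ring R n\<^esub> ?T d) (i, j) =
        (if i = k then c k \<otimes> ?T d (k, j) else ?T d (i, j) \<oplus> c i \<otimes> ?T d (k, j))"
      by (rule mult_column_replaced_one[OF k _ cl(2) ij]) (rule c)
    ultimately show "(?T c \<otimes>\<^bsub>mat_ring R n\<^esub> ?T d) (i, j) = \<one>\<^bsub>mat_ring R n\<^esub> (i, j)"
      using ij k c inv by (simp add: column_replaced_entry d_def del: mat_entry(1))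
  qed
  \<comment> \<open>\<open>Units\<close> asks for a two-sided inverse; in this order the
    off-diagonal condition is c_i + d_i c_k = 0.\<close>
  have 2: "?T d \<otimes>\<^bsub>mat_ring R n\<^esub> ?T c = \<one>\<^bsub>mat_ring R n\<^esub>"
  proof (rule mat_eqI[OF mat_mult_closed[OF cl(2,1)] mat_one_closed])
    fix i j assume ij: "i < n" "j < n"
    have "inv (c k) \<otimes> c i \<otimes> c k = inv (c k) \<otimes> c k \<otimes> c i"
      using inv(1) c[OF ij(1)] c[OF k] by (simp add: m_ac)
    then have "c i \<oplus> \<ominus> (inv (c k) \<otimes> c i) \<otimes> c k = \<zero>"
      using inv c[OF ij(1)] c[OF k] by (simp add: l_minus r_neg)
    moreover have "(?T d \<otimes>\<^bsub>mat_ring R n\<^esub> ?T c) (i, j) =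
        (if i = k then d k \<otimes> ?T c (k, j) else ?T c (i, j) \<oplus> d i \<otimes> ?T c (k, j))"
      by (rule mult_column_replaced_one[OF k _ cl(1) ij]) (rule d)
    ultimately show "(?T d \<otimes>\<^bsub>mat_ring R n\<^esub> ?T c) (i, j) = \<one>\<^bsub>mat_ring R n\<^esub> (i, j)"
      using ij k c inv by (simp add: column_replaced_entry d_def del: mat_entry(1))
  qed
  show ?thesis using 1 2 cl unfolding Units_def by blast
qed

text \<open>Multiplying the new matrix by W turns the old columns into unit vectors and the new one
  into c = W x, which gives an elementary matrix P with \<open>c k\<close> nonzero by
  \<open>nz\<close>. So the new matrix is Z P, a product of units.\<close>

lemma column_replaced_unit:
  assumes Z: "Z \<in> carrier (mat_ring R n)" and W: "W \<in> carrier (mat_ring R n)"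
    and ZW: "Z \<otimes>\<^bsub>mat_ring R n\<^esub> W = \<one>\<^bsub>mat_ring R n\<^esub>" and WZ: "W \<otimes>\<^bsub>mat_ring R n\<^esub> Z = \<one>\<^bsub>mat_ring R n\<^esub>"
    and k: "k < n" and x: "\<And>i. i < n \<Longrightarrow> x i \<in> carrier R"
    and nz: "(\<Oplus>l\<in>{..<n}. W (k, l) \<otimes> x l) \<noteq> \<zero>"
  shows "column_replaced n Z k x \<in> Units (mat_ring R n)"
proof -
  interpret M: ring "mat_ring R n" by (rule mat_ring_ring)
  let ?Z = "column_replaced n Z k x"
  define c where "c i = (\<Oplus>l\<in>{..<n}. W (i, l) \<otimes> x l)" for i
  have cc: "c i \<in> carrier R" if "i < n" for i
    unfolding c_def using that x mat_closed[OF W] by (intro finsum_closed) auto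
  have Zc: "?Z \<in> carrier (mat_ring R n)" by (rule column_replaced_closed[OF Z x])
  let ?P = "column_replaced n \<one>\<^bsub>mat_ring R n\<^esub> k c"
  have "W \<otimes>\<^bsub>mat_ring R n\<^esub> ?Z = ?P"
  proof (rule mat_eqI[OF mat_mult_closed[OF W Zc] column_replaced_closed[OF mat_one_closed cc]])
    fix i j assume ij: "i < n" "j < n"
    have "(W \<otimes>\<^bsub>mat_ring R n\<^esub> ?Z) (i, j) = (\<Oplus>l\<in>{..<n}. W (i, l) \<otimes> (if j = k then x l else Z (l, j)))"
      using ij x mat_closed[OF W] mat_closed[OF Z]
      unfolding mat_entry(1)[OF ij] by (intro finsum_cong') (auto simp: column_replaced_entry)
    also have "\<dots> = (if j = k then c i else (W \<otimes>\<^bsub>mat_ring R n\<^esub> Z) (i, j))"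
      using ij by (simp add: c_def)
    finally show "(W \<otimes>\<^bsub>mat_ring R n\<^esub> ?Z) (i, j) = ?P (i, j)"
      using ij by (simp only: WZ column_replaced_entry)
  qed
  then have "Z \<otimes>\<^bsub>mat_ring R n\<^esub> ?P = ?Z"
    using M.m_assoc[OF Z W Zc] ZW Zc by simp
  moreover have "?P \<in> Units (mat_ring R n)"
    by (rule column_replaced_one_unit[OF k cc]) (simp_all add: c_def nz)
  moreover have "Z \<in> Units (mat_ring R n)" using Z W ZW WZ unfolding Units_def by blast
  ultimately show ?thesis using M.Units_m_closed by metis
qed

end

section \<open>From the integrability condition to an invertible solution matrix\<close>

lemma (in diff_field) integrable_system_entries:
  assumes A: "A \<in> {..<m} \<rightarrow> carrier (mat_ring K n)" and int: "integrable_system m K n A"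
  shows "integrable_entries n A"
proof -
  let ?M = "mat_ring K n"
  interpret M: ring ?M by (rule mat_ring_ring)
  have Ac: "A i \<in> carrier ?M" if "i < m" for i using A that by auto
  have dc: "mat_der K n i (A j) \<in> carrier ?M" if "i < m" "j < m" for i j
    using mat_closed[OF Ac[OF that(2)]] that(1) by (auto simp: mat_der_def mat_ring_def der_closed)
  show ?thesis unfolding integrable_entries_def
  proof (intro conjI allI impI)
    show "A i (a, l) \<in> carrier K" if "i < m" "a < n" "l < n" for i a l
      using mat_closed[OF Ac] that by blast
    fix i j a l assume ij: "i < m" "j < m" and al: "a < n" "l < n"
    let ?D = "mat_der K n i (A j)" and ?E = "mat_der K n j (A i)"
    let ?P = "A i \<otimes>\<^bsub>?M\<^esub> A j" and ?Q = "A j \<otimes>\<^bsub>?M\<^esub> A i"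
    have c: "?D \<in> carrier ?M" "?E \<in> carrier ?M" "?P \<in> carrier ?M" "?Q \<in> carrier ?M"
      using ij dc Ac by auto
    have eq: "?D \<ominus>\<^bsub>?M\<^esub> ?E = ?P \<ominus>\<^bsub>?M\<^esub> ?Q"
      using int ij unfolding integrable_system_def commutator_def by blast
    \<comment> \<open>Adding and subtracting E exposes the difference D - E, which integrability
      replaces by P - Q; then Q cancels.\<close>
    have "?D \<oplus>\<^bsub>?M\<^esub> ?Q = (?D \<ominus>\<^bsub>?M\<^esub> ?E) \<oplus>\<^bsub>?M\<^esub> (?E \<oplus>\<^bsub>?M\<^esub> ?Q)"
      using c by (simp add: a_minus_def M.a_assoc M.r_neg2 M.r_neg1)
    also have "\<dots> = ?E \<oplus>\<^bsub>?M\<^esub> ?P"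
      unfolding eq using c by (simp add: a_minus_def M.a_ac M.r_neg2 M.r_neg1 M.l_neg M.r_neg)
    finally have "(?D \<oplus>\<^bsub>?M\<^esub> ?Q) (a, l) = (?E \<oplus>\<^bsub>?M\<^esub> ?P) (a, l)" by simp
    then show "der K i (A j (a, l)) \<oplus> (\<Oplus>k\<in>{..<n}. A j (a, k) \<otimes> A i (k, l)) =
       der K j (A i (a, l)) \<oplus> (\<Oplus>k\<in>{..<n}. A i (a, k) \<otimes> A j (k, l))"
      using al by (simp add: mat_der_def)
  qed
qed

theorem lemma5p8:
  fixes K :: "'a diff_ring" and m :: nat
  assumes "differentially_large m K"
  shows "PV_closed m K"
  unfolding PV_closed_def
proof (intro allI impI ballI)
  interpret diff_field K m using assms by (simp add: differentially_large_def)
  fix n :: nat and A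
  let ?M = "mat_ring K n"
  assume A: "A \<in> {..<m} \<rightarrow> carrier ?M" and int: "integrable_system m K n A"
  note ie = integrable_system_entries[OF A int]
  interpret M: ring ?M by (rule mat_ring_ring)
  define sol where "sol Z j \<longleftrightarrow> (\<forall>i<m. \<forall>a<n. der K i (Z (a, j)) = (\<Oplus>\<^bsub>K\<^esub>l\<in>{..<n}. A i (a, l) \<otimes>\<^bsub>K\<^esub> Z (l, j)))"
    for Z :: "nat \<times> nat \<Rightarrow> 'a" and j
  \<comment> \<open>Invariant of the replacement process: Z is invertible and its first r columns
    are solutions.\<close>
  have "\<exists>Z\<in>Units ?M. \<forall>j<r. sol Z j"
    if "r \<le> n" for r
    using that
  proof (induction r)
    case 0
    show ?case by (rule bexI[OF _ M.Units_one_closed]) simp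
  next
    case (Suc r)
    have r: "r < n" using Suc.prems by simp
    obtain Z where Z: "Z \<in> Units ?M" and sol: "\<forall>j<r. sol Z j"
      using Suc.IH[OF less_imp_le[OF r]] by blast
    obtain W where W: "W \<in> carrier ?M" "W \<otimes>\<^bsub>?M\<^esub> Z = \<one>\<^bsub>?M\<^esub>" "Z \<otimes>\<^bsub>?M\<^esub> W = \<one>\<^bsub>?M\<^esub>"
      using Z unfolding Units_def by blast
    have Zc: "Z \<in> carrier ?M" using Z by (rule M.Units_closed)
    \<comment> \<open>Row r of W times column r of Z is one, so this row is a nonzero linear form;
      its value at x is the r-th coordinate of W x.\<close>
    have "\<exists>l<n. W (r, l) \<noteq> \<zero>\<^bsub>K\<^esub>"
    proof (rule ccontr)
      assume "\<not> ?thesis"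
      then have "(\<Oplus>\<^bsub>K\<^esub>l\<in>{..<n}. W (r, l) \<otimes>\<^bsub>K\<^esub> Z (l, r)) = (\<Oplus>\<^bsub>K\<^esub>l\<in>{..<n}. \<zero>\<^bsub>K\<^esub>)"
        using mat_closed[OF Zc _ r] by (intro finsum_cong') auto
      moreover have "(W \<otimes>\<^bsub>?M\<^esub> Z) (r, r) = \<one>\<^bsub>K\<^esub>" unfolding W(2) using r by simp
      ultimately show False using r by simp
    qed
    then obtain l where l: "l < n" "W (r, l) \<noteq> \<zero>\<^bsub>K\<^esub>" by blast
    obtain x where x: "\<forall>l<n. x l \<in> carrier K"
      and xs: "\<forall>i<m. \<forall>a<n. der K i (x a) = (\<Oplus>\<^bsub>K\<^esub>l\<in>{..<n}. A i (a, l) \<otimes>\<^bsub>K\<^esub> x l)"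
      and nz: "(\<Oplus>\<^bsub>K\<^esub>l\<in>{..<n}. W (r, l) \<otimes>\<^bsub>K\<^esub> x l) \<noteq> \<zero>\<^bsub>K\<^esub>"
    proof (rule exE[OF linear_system_solution[OF assms ie, where c = "\<lambda>l. W (r, l)" and r = l]])
      show "W (r, l) \<in> carrier K" if "l < n" for l using mat_closed[OF W(1) r that] .
    qed (use l that in auto)
    let ?Z = "column_replaced n Z r x"
    have U: "?Z \<in> Units ?M" by (rule column_replaced_unit[OF Zc W(1,3,2) r _ nz]) (use x in simp)
    \<comment> \<open>Column r is the new solution vector, and the columns before it are unchanged,
      so they remain solutions.\<close>
    have "sol ?Z j" if j: "j < Suc r" for j
      unfolding sol_def
    proof (intro allI impI)
      fix i a assume ia: "i < m" "a < n"
      have jn: "j < n" using j r by simp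
      have "A i \<in> carrier ?M" using A ia by auto
      then have Aia: "A i (a, l) \<in> carrier K" if "l < n" for l
        using mat_closed ia(2) that by blast
      have "(\<Oplus>\<^bsub>K\<^esub>l\<in>{..<n}. A i (a, l) \<otimes>\<^bsub>K\<^esub> ?Z (l, j)) =
          (\<Oplus>\<^bsub>K\<^esub>l\<in>{..<n}. A i (a, l) \<otimes>\<^bsub>K\<^esub> (if j = r then x l else Z (l, j)))"
        using jn x Aia mat_closed[OF Zc] by (intro finsum_cong') (auto simp: column_replaced_entry)
      also have "\<dots> = der K i (if j = r then x a else Z (a, j))"
        using j ia xs sol unfolding sol_def by (cases "j = r") simp_all
      finally show "der K i (?Z (a, j)) = (\<Oplus>\<^bsub>K\<^esub>l\<in>{..<n}. A i (a, l) \<otimes>\<^bsub>K\<^esub> ?Z (l, j))"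
        using jn ia by (simp add: column_replaced_entry)
    qed
    with U show ?case by blast
  qed
  then obtain Z where Z: "Z \<in> Units ?M" and sol: "\<forall>j<n. sol Z j"
    by blast
  have Zc: "Z \<in> carrier ?M" using Z by (rule M.Units_closed)
  have "mat_der K n i Z = A i \<otimes>\<^bsub>?M\<^esub> Z" if i: "i < m" for i
  proof (rule mat_eqI[where n = n])
    show "mat_der K n i Z \<in> carrier ?M"
      using mat_closed[OF Zc] i by (auto simp: mat_der_def mat_ring_def der_closed)
    show "A i \<otimes>\<^bsub>?M\<^esub> Z \<in> carrier ?M" using A i Zc by (intro mat_mult_closed) auto
    show "mat_der K n i Z (a, j) = (A i \<otimes>\<^bsub>?M\<^esub> Z) (a, j)" if "a < n" "j < n" for a j
      using sol i that by (simp add: sol_def mat_der_def)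
  qed
  with Z show "\<exists>Z\<in>Units ?M. \<forall>i<m. mat_der K n i Z = A i \<otimes>\<^bsub>?M\<^esub> Z" by blast
qed

end
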